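(* Let $X$ be a projective toric variety of dimension $d-1\ge1$ over an algebraically closed field $K$ of characteristic $p>0$, with a very ample $T$-Cartier divisor $D$. Let $(R,\mathbf{m})$ be the homogeneous coordinate ring of $(X,D)$ with its graded maximal ideal. Then $$\lim_{k\to\infty}\frac{e_{HK}(R,\mathbf{m}^k)-e_0(R,\mathbf{m}^k)/d!}{k^{d-1}}=\frac{e_0(R,\mathbf{m})}{(d-1)!}\int_0^\infty\varphi_D(\lambda)\,d\lambda,$$ where $\varphi_D:[0,\infty)\to[0,\infty)$, defined from the polytope $P_D$ of $(X,D)$ by $$\varphi_D(\lambda)=\mathrm{Vol}_{d-1}\Big(\big[W_v\times\{z=\lambda+1\}\big]\setminus\bigcup_{u\in\mathbb{Z}^{d-1}}\big[(u,1)+C_D\big]\Big)$$ for any $v\in\mathbb{Z}^{d-1}$, is a compactly supported continuous function.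
   Context: Toric pair: Let $T$ be a torus with cocharacter lattice $N\cong\mathbb{Z}^{d-1}$ and character lattice $M=\mathrm{Hom}(N,\mathbb{Z})$, identified with $\mathbb{Z}^{d-1}$, so $M_{\mathbb{R}}=\mathbb{R}^{d-1}$. $X$ is given by a complete fan in $N_{\mathbb{R}}$ whose rays have primitive generators $v_1,\dots,v_n$, and $D=\sum_i a_iD_i$ with $a_i\in\mathbb{Z}$ and $D_i$ the $T$-invariant prime divisor corresponding to $v_i$. The associated lattice polytope is $P_D=\{u\in M_{\mathbb{R}}\mid \langle u,v_i\rangle\ge -a_i \text{ for all } i\}$. Homogeneous coordinate ring: if $P_D\cap M=\{u_1,\dots,u_r\}$ and $S\subset M\times\mathbb{Z}$ is the semigroup generated by $(u_1,1),\dots,(u_r,1)$, then $R=K[S]=K[\chi^{(u_1,1)},\dots,\chi^{(u_r,1)}]$, a standard graded ring of dimension $d$ with $\deg\chi^{(u_i,1)}=1$; $\mathbf{m}$ is its graded maximal ideal. For an ideal $I\subset R$ of finite colength, $e_0(R,I)$ is the Hilbert-Samuel multiplicity and $e_{HK}(R,I)=\lim_{n\to\infty}\ell(R/I^{[q]})/q^{d}$, $q=p^n$, is the Hilbert-Kunz multiplicity, where $I^{[q]}$ is the ideal generated by $q$-th powers of elements of $I$. $C_D\subset\mathbb{R}^{d}$ is the convex cone (with apex the origin) spanned by $P_D\times\{1\}\subset\mathbb{R}^{d-1}\times\mathbb{R}$. $W_v=v+[0,1]^{d-1}\subset\mathbb{R}^{d-1}$ is the unit cell at $v\in\mathbb{Z}^{d-1}$.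 The last coordinate of $\mathbb{R}^d$ is $z$; $W_v\times\{z=\mu\}=\{(x,\mu)\mid x\in W_v\}$, and $\mathrm{Vol}_{d-1}$ is $(d-1)$-dimensional Lebesgue volume in the hyperplane $\{z=\mu\}$. *)

theory Defs
  imports
    "HOL-Analysis.Analysis"
    "HOL-Computational_Algebra.Polynomial"
    "HOL-Library.Poly_Mapping"
    "HOL-Algebra.QuotRing"
    "HOL-Algebra.Ideal_Product"
begin

section \<open>Fans\<close>

text \<open>
  The cocharacter lattice \<open>N\<close> and the character lattice \<open>M\<close> are both \<open>int ^ 'n\<close>, paired by the
  standard inner product of the ambient spaces \<open>real ^ 'n\<close>.
\<close>

definition rvec :: "int ^ 'n \<Rightarrow> real ^ 'n" where
  "rvec u = (\<chi> i. of_int (u $ i))"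

text \<open>Cones of a fan are strongly convex, i.e. they contain no line.\<close>

definition fan_cone :: "(real ^ 'n) set \<Rightarrow> bool" where
  "fan_cone \<sigma> \<longleftrightarrow>
     (\<exists>G :: (int ^ 'n) set. finite G \<and> \<sigma> = convex_cone hull (rvec ` G)) \<and>
     (\<forall>x. x \<in> \<sigma> \<and> - x \<in> \<sigma> \<longrightarrow> x = 0)"

text \<open>
  \<open>(face_of)\<close> is the convex-geometric notion of a face, which admits the empty set. The nonempty
  faces of a polyhedral cone are its intersections with supporting hyperplanes, and the cone itself.
\<close>

definition fan :: "(real ^ 'n) set set \<Rightarrow> bool" where
  "fan \<Delta> \<longleftrightarrow>
     finite \<Delta> \<and> \<Delta> \<noteq> {} \<and> (\<forall>\<sigma>\<in>\<Delta>. fan_cone \<sigma>) \<and>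
     (\<forall>\<sigma>\<in>\<Delta>. \<forall>\<tau>. \<tau> face_of \<sigma> \<and> \<tau> \<noteq> {} \<longrightarrow> \<tau> \<in> \<Delta>) \<and>
     (\<forall>\<sigma>\<in>\<Delta>. \<forall>\<tau>\<in>\<Delta>. (\<sigma> \<inter> \<tau>) face_of \<sigma> \<and> (\<sigma> \<inter> \<tau>) face_of \<tau>)"

definition complete_fan :: "(real ^ 'n) set set \<Rightarrow> bool" where
  "complete_fan \<Delta> \<longleftrightarrow> fan \<Delta> \<and> \<Union>\<Delta> = UNIV"

definition primitive_vec :: "int ^ 'n \<Rightarrow> bool" where
  "primitive_vec v \<longleftrightarrow> Gcd ((\<lambda>i. v $ i) ` UNIV) = 1"

text \<open>The primitive generators \<open>v\<^sub>1, \<dots>, v\<^sub>n\<close> of the rays of the fan.\<close>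

definition ray_gens :: "(real ^ 'n) set set \<Rightarrow> (int ^ 'n) set" where
  "ray_gens \<Delta> = {v. primitive_vec v \<and> convex_cone hull {rvec v} \<in> \<Delta>}"


section \<open>The toric variety of a fan\<close>

definition dual_semigroup :: "(real ^ 'n) set \<Rightarrow> (int ^ 'n) set" where
  "dual_semigroup \<sigma> = {u. \<forall>x\<in>\<sigma>. rvec u \<bullet> x \<ge> 0}"

text \<open>
  The group algebra \<open>K[M]\<close> is the convolution ring \<open>(int ^ 'n) \<Rightarrow>\<^sub>0 'k\<close>, with \<open>\<chi>\<^sup>u\<close> rendered as
  \<open>Poly_Mapping.single u 1\<close>. Below is the coordinate ring of the chart \<open>U\<^sub>\<sigma>\<close>.
\<close>

definition chart_ring :: "(real ^ 'n) set \<Rightarrow> ((int ^ 'n) \<Rightarrow>\<^sub>0 'k::field) set" where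
  "chart_ring \<sigma> = {g. Poly_Mapping.keys g \<subseteq> dual_semigroup \<sigma>}"

text \<open>
  The closed points of \<open>U\<^sub>\<sigma> = Spec K[\<sigma>\<^sup>\<or> \<inter> M]\<close> over an algebraically closed field \<open>K\<close>, i.e. the
  \<open>K\<close>-algebra homomorphisms \<open>K[\<sigma>\<^sup>\<or> \<inter> M] \<rightarrow> K\<close>, given by their values on the characters.
\<close>

definition chart :: "(real ^ 'n) set \<Rightarrow> (int ^ 'n \<Rightarrow> 'k::field) set" where
  "chart \<sigma> = {\<gamma> \<in> extensional (dual_semigroup \<sigma>).
     \<gamma> 0 = 1 \<and> (\<forall>u\<in>dual_semigroup \<sigma>. \<forall>w\<in>dual_semigroup \<sigma>. \<gamma> (u + w) = \<gamma> u * \<gamma> w)}"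

definition eval_at :: "((int ^ 'n) \<Rightarrow>\<^sub>0 'k::field) \<Rightarrow> (int ^ 'n \<Rightarrow> 'k) \<Rightarrow> 'k" where
  "eval_at g \<gamma> = (\<Sum>u\<in>Poly_Mapping.keys g. Poly_Mapping.lookup g u * \<gamma> u)"

text \<open>
  The charts \<open>U\<^sub>\<sigma>\<close> and \<open>U\<^sub>\<tau>\<close> are glued along \<open>U\<^bsub>\<sigma> \<inter> \<tau>\<^esub>\<close>; a point of the variety is the class of
  all its representatives \<open>(\<sigma>, \<gamma>)\<close>.
\<close>

definition chart_points :: "(real ^ 'n) set set \<Rightarrow> ((real ^ 'n) set \<times> (int ^ 'n \<Rightarrow> 'k::field)) set" where
  "chart_points \<Delta> = (SIGMA \<sigma>:\<Delta>. chart \<sigma>)"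

definition glue :: "(real ^ 'n) set set \<Rightarrow>
    (((real ^ 'n) set \<times> (int ^ 'n \<Rightarrow> 'k::field)) \<times> ((real ^ 'n) set \<times> (int ^ 'n \<Rightarrow> 'k))) set" where
  "glue \<Delta> = {((\<sigma>, \<gamma>), (\<tau>, \<eta>)). (\<sigma>, \<gamma>) \<in> chart_points \<Delta> \<and> (\<tau>, \<eta>) \<in> chart_points \<Delta> \<and>
     (\<exists>\<delta>\<in>chart (\<sigma> \<inter> \<tau>). \<gamma> = restrict \<delta> (dual_semigroup \<sigma>) \<and> \<eta> = restrict \<delta> (dual_semigroup \<tau>))}"

definition toric_variety ::
    "(real ^ 'n) set set \<Rightarrow> ((real ^ 'n) set \<times> (int ^ 'n \<Rightarrow> 'k::field)) set set" where
  "toric_variety \<Delta> = chart_points \<Delta> // glue \<Delta>"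

definition toric_zariski ::
    "(real ^ 'n) set set \<Rightarrow> ((real ^ 'n) set \<times> (int ^ 'n \<Rightarrow> 'k::field)) set topology" where
  "toric_zariski \<Delta> = topology_generated_by
     {{x \<in> toric_variety \<Delta>. \<exists>\<gamma>. (\<sigma>, \<gamma>) \<in> x \<and> eval_at g \<gamma> \<noteq> 0} | \<sigma> g.
        \<sigma> \<in> \<Delta> \<and> g \<in> chart_ring \<sigma>}"


section \<open>Projective space with coordinates indexed by a finite set\<close>

definition line_of :: "'a set \<Rightarrow> ('a \<Rightarrow> 'k::field) \<Rightarrow> ('a \<Rightarrow> 'k) set" where
  "line_of L y = {(\<lambda>u\<in>L. c * y u) | c. c \<noteq> 0}"

text \<open>A point is the set of all its homogeneous coordinate vectors.\<close>

definition proj_space :: "'a set \<Rightarrow> ('a \<Rightarrow> 'k::field) set set" where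
  "proj_space L = {line_of L y | y. y \<in> extensional L \<and> (\<exists>u\<in>L. y u \<noteq> 0)}"

definition homogeneous :: "'a set \<Rightarrow> nat \<Rightarrow> (('a \<Rightarrow>\<^sub>0 nat) \<Rightarrow>\<^sub>0 'k::field) \<Rightarrow> bool" where
  "homogeneous L e F \<longleftrightarrow> (\<forall>t\<in>Poly_Mapping.keys F.
     Poly_Mapping.keys t \<subseteq> L \<and> (\<Sum>u\<in>Poly_Mapping.keys t. Poly_Mapping.lookup t u) = e)"

text \<open>Substitution of \<open>y\<close> for the variables, coefficients being mapped by \<open>h\<close>.\<close>

definition poly_subst ::
    "('k::field \<Rightarrow> 'b::comm_ring_1) \<Rightarrow> (('a \<Rightarrow>\<^sub>0 nat) \<Rightarrow>\<^sub>0 'k) \<Rightarrow> ('a \<Rightarrow> 'b) \<Rightarrow> 'b" where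
  "poly_subst h F y = (\<Sum>t\<in>Poly_Mapping.keys F.
     h (Poly_Mapping.lookup F t) * (\<Prod>u\<in>Poly_Mapping.keys t. y u ^ Poly_Mapping.lookup t u))"

definition proj_zariski :: "'a set \<Rightarrow> ('a \<Rightarrow> 'k::field) set topology" where
  "proj_zariski L = topology_generated_by
     {{l \<in> proj_space L. \<forall>y\<in>l. poly_subst id F y \<noteq> 0} | F e. homogeneous L e F}"


section \<open>Divisors\<close>

text \<open>
  A \<open>T\<close>-invariant divisor \<open>D = \<Sum>\<^sub>i a\<^sub>i D\<^sub>i\<close> is given by a function \<open>a\<close> on lattice vectors, of which only
  the values \<open>a\<^sub>i = a v\<^sub>i\<close> at ray generators matter.
\<close>

definition div_polytope :: "(real ^ 'n) set set \<Rightarrow> (int ^ 'n \<Rightarrow> int) \<Rightarrow> (real ^ 'n) set" where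
  "div_polytope \<Delta> a = {u. \<forall>v\<in>ray_gens \<Delta>. u \<bullet> rvec v \<ge> - of_int (a v)}"

definition lattice_points :: "(real ^ 'n) set \<Rightarrow> (int ^ 'n) set" where
  "lattice_points P = {u. rvec u \<in> P}"

text \<open>
  \<open>D = div(\<chi>\<^sup>-\<^sup>m)\<close> on \<open>U\<^sub>\<sigma>\<close>, i.e. \<open>\<O>(D)\<close> is generated by \<open>\<chi>\<^sup>m\<close> on \<open>U\<^sub>\<sigma>\<close>. Such an \<open>m\<close> is unique
  up to the characters that are invertible on \<open>U\<^sub>\<sigma>\<close>.
\<close>

definition local_datum ::
    "(real ^ 'n) set set \<Rightarrow> (int ^ 'n \<Rightarrow> int) \<Rightarrow> (real ^ 'n) set \<Rightarrow> int ^ 'n \<Rightarrow> bool" where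
  "local_datum \<Delta> a \<sigma> m \<longleftrightarrow>
     (\<forall>v\<in>ray_gens \<Delta>. rvec v \<in> \<sigma> \<longrightarrow> rvec m \<bullet> rvec v = - of_int (a v))"

definition T_Cartier :: "(real ^ 'n) set set \<Rightarrow> (int ^ 'n \<Rightarrow> int) \<Rightarrow> bool" where
  "T_Cartier \<Delta> a \<longleftrightarrow> (\<forall>\<sigma>\<in>\<Delta>. \<exists>m. local_datum \<Delta> a \<sigma> m)"

text \<open>
  The map defined by the complete linear system \<open>H\<^sup>0(X, \<O>(D)) = \<Oplus> K \<chi>\<^sup>u\<close>, with \<open>u\<close> ranging over
  \<open>P\<^sub>D \<inter> M\<close>. In the trivialization of \<open>\<O>(D)\<close> by \<open>\<chi>\<^sup>m\<close> on \<open>U\<^sub>\<sigma>\<close>, the section \<open>\<chi>\<^sup>u\<close> is the function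
  \<open>\<chi>\<^bsup>u-m\<^esup>\<close>. The coordinate vectors coming from different choices of \<open>\<sigma>\<close>, \<open>\<gamma>\<close>, \<open>m\<close> for the same point
  are proportional, so that the set below is a single point of projective space unless all sections
  vanish at \<open>x\<close>, in which case it is \<open>{0}\<close>.
\<close>

definition section_map :: "(real ^ 'n) set set \<Rightarrow> (int ^ 'n \<Rightarrow> int) \<Rightarrow>
    ((real ^ 'n) set \<times> (int ^ 'n \<Rightarrow> 'k::field)) set \<Rightarrow> (int ^ 'n \<Rightarrow> 'k) set" where
  "section_map \<Delta> a x =
     {(\<lambda>u\<in>lattice_points (div_polytope \<Delta> a). c * \<gamma> (u - m)) | c \<sigma> \<gamma> m.
        c \<noteq> 0 \<and> (\<sigma>, \<gamma>) \<in> x \<and> local_datum \<Delta> a \<sigma> m}"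

definition pullback :: "int ^ 'n \<Rightarrow> (((int ^ 'n) \<Rightarrow>\<^sub>0 nat) \<Rightarrow>\<^sub>0 'k::field) \<Rightarrow> ((int ^ 'n) \<Rightarrow>\<^sub>0 'k)" where
  "pullback m F = poly_subst (Poly_Mapping.single 0) F (\<lambda>u. Poly_Mapping.single (u - m) 1)"

text \<open>
  Surjectivity of the homomorphisms of local rings \<open>\<O>\<^bsub>\<P>,f(x)\<^esub> \<rightarrow> \<O>\<^bsub>X,x\<^esub>\<close> for \<open>f = section_map\<close>:
  every fraction \<open>g/h\<close> that is regular at \<open>x\<close> is the pullback of some \<open>F/G\<close> that is regular at \<open>f(x)\<close>,
  with \<open>F\<close> and \<open>G\<close> homogeneous of the same degree.
\<close>

definition surjective_on_stalks ::
    "'k::field itself \<Rightarrow> (real ^ 'n) set set \<Rightarrow> (int ^ 'n \<Rightarrow> int) \<Rightarrow> bool" where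
  "surjective_on_stalks (_ :: 'k itself) \<Delta> a \<longleftrightarrow>
     (\<forall>x \<in> toric_variety \<Delta>. \<forall>\<sigma> \<gamma> m. (\<sigma>, \<gamma> :: int ^ 'n \<Rightarrow> 'k) \<in> x \<and> local_datum \<Delta> a \<sigma> m \<longrightarrow>
       (\<forall>g \<in> chart_ring \<sigma>. \<forall>h \<in> chart_ring \<sigma>. eval_at h \<gamma> \<noteq> 0 \<longrightarrow>
          (\<exists>e F G. homogeneous (lattice_points (div_polytope \<Delta> a)) e F \<and>
                   homogeneous (lattice_points (div_polytope \<Delta> a)) e G \<and>
                   eval_at (pullback m G) \<gamma> \<noteq> 0 \<and>
                   g * pullback m G = pullback m F * h)))"

text \<open>
  \<open>D\<close> is very ample if it has no base points and its complete linear system defines a closed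
  immersion into projective space (a homeomorphism onto a closed subset that is surjective on
  stalks).
\<close>

definition very_ample ::
    "'k::field itself \<Rightarrow> (real ^ 'n) set set \<Rightarrow> (int ^ 'n \<Rightarrow> int) \<Rightarrow> bool" where
  "very_ample (K :: 'k itself) \<Delta> a \<longleftrightarrow>
     (let X = toric_variety \<Delta> :: ((real ^ 'n) set \<times> (int ^ 'n \<Rightarrow> 'k)) set set;
          L = lattice_points (div_polytope \<Delta> a);
          f = section_map \<Delta> a
      in T_Cartier \<Delta> a \<and>
         f \<in> X \<rightarrow> proj_space L \<and>
         embedding_map (toric_zariski \<Delta>) (proj_zariski L) f \<and>
         closedin (proj_zariski L) (f ` X) \<and>
         surjective_on_stalks K \<Delta> a)"


section \<open>The homogeneous coordinate ring\<close>

text \<open>The monoid generated by the \<open>(u, 1)\<close>; \<open>0\<close> is the empty sum.\<close>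

definition coord_semigroup :: "(real ^ 'n) set \<Rightarrow> ((int ^ 'n) \<times> int) set" where
  "coord_semigroup P = {sum_list ws | ws. set ws \<subseteq> lattice_points P \<times> {1}}"

definition coord_ring :: "(real ^ 'n) set \<Rightarrow> (((int ^ 'n) \<times> int) \<Rightarrow>\<^sub>0 'k::field) ring" where
  "coord_ring P = \<lparr>carrier = {f. Poly_Mapping.keys f \<subseteq> coord_semigroup P},
     mult = (*), one = 1, zero = 0, add = (+)\<rparr>"

definition graded_max_ideal :: "(real ^ 'n) set \<Rightarrow> (((int ^ 'n) \<times> int) \<Rightarrow>\<^sub>0 'k::field) set" where
  "graded_max_ideal P = {f \<in> carrier (coord_ring P). \<forall>s\<in>Poly_Mapping.keys f. snd s > 0}"


section \<open>Multiplicities\<close>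

text \<open>
  The length of a ring as a module over itself. For \<open>A = R Quot I\<close> this is also the length of \<open>R/I\<close>
  as an \<open>R\<close>-module.
\<close>

definition ring_length :: "('a, 'b) ring_scheme \<Rightarrow> enat" where
  "ring_length A = Sup {enat n | n.
     \<exists>J. (\<forall>i\<le>n. ideal (J i) A) \<and> (\<forall>i<n. J i \<subset> J (Suc i))}"

definition colength :: "('a, 'b) ring_scheme \<Rightarrow> 'a set \<Rightarrow> real" where
  "colength R I = real (the_enat (ring_length (R Quot I)))"

definition ideal_power :: "('a, 'b) ring_scheme \<Rightarrow> 'a set \<Rightarrow> nat \<Rightarrow> 'a set" where
  "ideal_power R I k = I [^]\<^bsub>ideals_set R\<^esub> k"

definition frobenius_power :: "('a, 'b) ring_scheme \<Rightarrow> 'a set \<Rightarrow> nat \<Rightarrow> 'a set" where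
  "frobenius_power R I q = Idl\<^bsub>R\<^esub> {x [^]\<^bsub>R\<^esub> q | x. x \<in> I}"

text \<open>In both definitions \<open>d\<close> is the Krull dimension of \<open>R\<close>, and \<open>I\<close> has finite colength.\<close>

definition hilbert_samuel_mult :: "nat \<Rightarrow> ('a, 'b) ring_scheme \<Rightarrow> 'a set \<Rightarrow> real" where
  "hilbert_samuel_mult d R I = lim (\<lambda>n. fact d * colength R (ideal_power R I n) / real n ^ d)"

definition hilbert_kunz_mult :: "nat \<Rightarrow> nat \<Rightarrow> ('a, 'b) ring_scheme \<Rightarrow> 'a set \<Rightarrow> real" where
  "hilbert_kunz_mult p d R I =
     lim (\<lambda>n. colength R (frobenius_power R I (p ^ n)) / real (p ^ n) ^ d)"


section \<open>The function \<open>\<phi>\<^sub>D\<close>\<close>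

definition poly_cone :: "(real ^ 'n) set \<Rightarrow> ((real ^ 'n) \<times> real) set" where
  "poly_cone P = convex_cone hull (P \<times> {1})"

definition unit_cell :: "int ^ 'n \<Rightarrow> (real ^ 'n) set" where
  "unit_cell v = (+) (rvec v) ` {w. \<forall>i. 0 \<le> w $ i \<and> w $ i \<le> 1}"

text \<open>Volume in the hyperplane \<open>z = \<mu>\<close>.\<close>

definition slice_vol :: "real \<Rightarrow> ((real ^ 'n) \<times> real) set \<Rightarrow> real" where
  "slice_vol \<mu> A = measure lebesgue {x. (x, \<mu>) \<in> A}"

definition phi :: "(real ^ 'n) set \<Rightarrow> int ^ 'n \<Rightarrow> real \<Rightarrow> real" where
  "phi P v \<mu> = slice_vol (\<mu> + 1)
     (unit_cell v \<times> {\<mu> + 1} - (\<Union>u. (+) (rvec u, 1) ` poly_cone P))"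

end

theory Submission
  imports Defs
begin

text \<open>
  Let \<open>S\<close> be the semigroup and \<open>C\<close> the cone of \<open>P\<^sub>D\<close>. All ideals that occur are spanned by monomials, so
  their colengths count elements of \<open>S\<close>; in characteristic \<open>p\<close> the Frobenius power of \<open>\<mm>\<^sup>k\<close> is
  spanned by the elements of \<open>q e + S\<close> with \<open>e \<in> S\<close> of degree \<open>k\<close>. Very ampleness enters twice: the absence
  of base points makes \<open>P\<^sub>D\<close> the convex hull of its lattice points, and the surjectivity on stalks makes \<open>S\<close>
  generate the whole lattice, whence \<open>S\<close> contains a translate of all lattice points of \<open>C\<close>. Therefore
  counting elements of \<open>S\<close> is asymptotically the same as measuring volume in \<open>C\<close>, so that
  \<open>e\<^sub>H\<^sub>K(\<mm>\<^sup>k) - e\<^sub>0(\<mm>\<^sup>k)/d!\<close> is the volume of the part of \<open>C\<close> above height \<open>k\<close> that is not covered by the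
  cones \<open>e + C\<close>. At height \<open>k + \<lambda>\<close> this part is empty for large \<open>\<lambda>\<close>; otherwise it looks, away from the
  boundary of \<open>C\<close>, like the complement of the lattice translates of \<open>\<lambda> P\<^sub>D\<close>, which has density \<open>\<phi>\<^sub>D(\<lambda>)\<close>.
  Dominated convergence in \<open>\<lambda>\<close> gives the limit.
\<close>

section \<open>Monoid algebras and monomial ideals\<close>

text \<open>The obstacle is that \<open>S\<close> need not contain every lattice point of the cone,
  so its counts are not lattice point counts of polytopes. Two devices absorb this. An element
  \<open>c\<close> of \<open>S\<close> with \<open>c\<close> plus all lattice points of
  \<open>C\<close> inside \<open>S\<close> costs only a bounded displacement: it vanishes after
  rescaling by 1/q, and in high slices it affects only a neighbourhood of the boundary. And counting
  goes through rounding: a rescaled count is exactly the volume of a union of half-open cells, so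
  only the behaviour of almost every fixed point x as q grows matters, and frontiers of convex sets
  are null. The subtraction of e_0/d! is exact: a cone e + C with e of degree k starts at height k,
  so everything in \<open>C\<close> below that height is uncovered. The constant
  \<open>card L\<close>, with \<open>L\<close> the lattice points of the polytope, arises because
  rounding down the coefficients of a combination of the generators loses less than 1 for each of
  them; it bounds the support of \<open>phi\<close> and supplies the dominating function in the
  final limit.\<close>

lemma poly_mapping_eq_sum_single:
  "f = (\<Sum>k\<in>Poly_Mapping.keys f. Poly_Mapping.single k (Poly_Mapping.lookup f k))"
  by (rule poly_mapping_eqI) (auto simp: lookup_sum lookup_single when_def in_keys_iff if_distrib cong: if_cong)

text \<open>The multiple q s of an exponent is a constant sum, because exponents are only assumed to
  form a commutative monoid.\<close>

lemma single_power:
  "Poly_Mapping.single (s :: 'a::comm_monoid_add) (c :: 'k::comm_ring_1) ^ q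
     = Poly_Mapping.single (\<Sum>i<q. s) (c ^ q)"
  by (induction q) (auto simp: mult_single add.commute)

text \<open>Carries the characteristic of the field to the convolution ring, where the additivity of
  Frobenius is applied. The coefficient at exponent 0 decides whether a numeral vanishes.\<close>

lemma CHAR_poly_mapping: "CHAR(('a::comm_monoid_add) \<Rightarrow>\<^sub>0 'k::comm_ring_1) = CHAR('k)"
proof (rule CHAR_eqI)
  have *: "(of_nat m = (0 :: 'a \<Rightarrow>\<^sub>0 'k)) \<longleftrightarrow> (of_nat m = (0 :: 'k))" for m
  proof
    assume "of_nat m = (0 :: 'a \<Rightarrow>\<^sub>0 'k)"
    then have "Poly_Mapping.lookup (of_nat m :: 'a \<Rightarrow>\<^sub>0 'k) 0 = 0"
      by simp
    then show "of_nat m = (0 :: 'k)"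
      by (simp add: lookup_of_nat)
  next
    assume "of_nat m = (0 :: 'k)"
    then show "of_nat m = (0 :: 'a \<Rightarrow>\<^sub>0 'k)"
      by (simp flip: single_of_nat)
  qed
  show "of_nat CHAR('k) = (0 :: 'a \<Rightarrow>\<^sub>0 'k)"
    by (simp add: *)
  show "CHAR('k) dvd x" if "of_nat x = (0 :: 'a \<Rightarrow>\<^sub>0 'k)" for x
    using that by (simp add: * of_nat_eq_0_iff_char_dvd)
qed

text \<open>\<open>coord_ring\<close> with an arbitrary exponent set, so that the ideal theory does
  not see the polytope. The operations are those of the ambient convolution ring, hence type class
  algebra is available inside the carrier.\<close>

definition monoid_algebra :: "'a::comm_monoid_add set \<Rightarrow> ('a \<Rightarrow>\<^sub>0 'k::field) ring" where
  "monoid_algebra S = \<lparr>carrier = {f. Poly_Mapping.keys f \<subseteq> S},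
     mult = (*), one = 1, zero = 0, add = (+)\<rparr>"

definition monomial_span :: "'a::comm_monoid_add set \<Rightarrow> ('a \<Rightarrow>\<^sub>0 'k::field) set" where
  "monomial_span E = {f. Poly_Mapping.keys f \<subseteq> E}"

lemma monoid_algebra_simps [simp]:
  "carrier (monoid_algebra S) = monomial_span S"
  "f \<otimes>\<^bsub>monoid_algebra S\<^esub> g = f * g" "\<one>\<^bsub>monoid_algebra S\<^esub> = 1"
  "f \<oplus>\<^bsub>monoid_algebra S\<^esub> g = f + g" "\<zero>\<^bsub>monoid_algebra S\<^esub> = 0"
  by (simp_all add: monoid_algebra_def monomial_span_def)

lemma monoid_algebra_pow [simp]: "f [^]\<^bsub>monoid_algebra S\<^esub> (n::nat) = f ^ n"
  by (induction n) (simp_all add: nat_pow_def mult.commute)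

lemma zero_in_monomial_span [simp]: "0 \<in> monomial_span E"
  by (simp add: monomial_span_def)

lemma add_in_monomial_span:
  "f \<in> monomial_span E \<Longrightarrow> g \<in> monomial_span E \<Longrightarrow> f + g \<in> monomial_span E"
  unfolding monomial_span_def using keys_add[of f g] by auto

lemma sum_in_monomial_span:
  "(\<And>i. i \<in> A \<Longrightarrow> f i \<in> monomial_span E) \<Longrightarrow> sum f A \<in> monomial_span E"
  by (induction A rule: infinite_finite_induct) (auto intro: add_in_monomial_span)

lemma uminus_in_monomial_span:
  "f \<in> monomial_span E \<Longrightarrow> - f \<in> monomial_span E"
  by (simp add: monomial_span_def)

lemma single_in_monomial_span: "s \<in> E \<Longrightarrow> Poly_Mapping.single s c \<in> monomial_span E"
  by (simp add: monomial_span_def)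

lemma single_in_monomial_span_iff:
  "c \<noteq> 0 \<Longrightarrow> Poly_Mapping.single s c \<in> monomial_span E \<longleftrightarrow> s \<in> E"
  by (simp add: monomial_span_def)

lemma mult_in_monomial_span:
  assumes "f \<in> monomial_span A" "g \<in> monomial_span B" "\<And>a b. a \<in> A \<Longrightarrow> b \<in> B \<Longrightarrow> a + b \<in> E"
  shows "f * g \<in> monomial_span E"
  using assms keys_mult[of f g] unfolding monomial_span_def by blast

section \<open>Monomial ideals in the algebra of a submonoid\<close>

locale submonoid =
  fixes S :: "'a::ab_group_add set"
  assumes zero_mem: "0 \<in> S" and add_mem: "\<And>s t. s \<in> S \<Longrightarrow> t \<in> S \<Longrightarrow> s + t \<in> S"
begin

abbreviation R :: "('a \<Rightarrow>\<^sub>0 'k::field) ring" where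
  "R \<equiv> monoid_algebra S"

lemma cring_R: "cring (R :: ('a \<Rightarrow>\<^sub>0 'k::field) ring)"
proof (rule cringI)
  show "abelian_group (R :: ('a \<Rightarrow>\<^sub>0 'k) ring)"
    by (rule abelian_groupI)
       (auto simp: add_in_monomial_span algebra_simps intro!: bexI[of _ "- _"] uminus_in_monomial_span)
  have "(1 :: 'a \<Rightarrow>\<^sub>0 'k) \<in> monomial_span S"
    using zero_mem by (simp add: monomial_span_def)
  then show "comm_monoid (R :: ('a \<Rightarrow>\<^sub>0 'k) ring)"
    by unfold_locales (auto simp: algebra_simps intro: mult_in_monomial_span add_mem)
qed (simp add: algebra_simps)

lemma ring_R: "ring (R :: ('a \<Rightarrow>\<^sub>0 'k::field) ring)"
  using cring_R by (rule cring.axioms(1))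

text \<open>The ideals of the monoid \<open>S\<close>, the combinatorial counterpart of monomial
  ideals.\<close>

definition upset :: "'a set \<Rightarrow> bool" where
  "upset E \<longleftrightarrow> E \<subseteq> S \<and> (\<forall>e\<in>E. \<forall>s\<in>S. e + s \<in> E)"

lemma ideal_monomial_span:
  assumes "upset E"
  shows "ideal (monomial_span E :: ('a \<Rightarrow>\<^sub>0 'k::field) set) R"
proof (rule idealI[OF ring_R])
  have sub: "(monomial_span E :: ('a \<Rightarrow>\<^sub>0 'k) set) \<subseteq> monomial_span S"
    using assms by (auto simp: upset_def monomial_span_def)
  interpret cring "R :: ('a \<Rightarrow>\<^sub>0 'k) ring" by (rule cring_R)
  show "subgroup (monomial_span E :: ('a \<Rightarrow>\<^sub>0 'k) set) (add_monoid R)"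
  proof (rule add.subgroupI)
    show "\<ominus>\<^bsub>R\<^esub> f \<in> monomial_span E" if "f \<in> monomial_span E" for f :: "'a \<Rightarrow>\<^sub>0 'k"
    proof -
      have "\<ominus>\<^bsub>R\<^esub> f = - f"
        using that sub by (intro minus_equality) (auto simp: uminus_in_monomial_span)
      then show ?thesis
        using that by (simp add: uminus_in_monomial_span)
    qed
  qed (use sub in \<open>auto intro: add_in_monomial_span zero_in_monomial_span\<close>)
  show "x \<otimes>\<^bsub>R\<^esub> a \<in> monomial_span E" "a \<otimes>\<^bsub>R\<^esub> x \<in> monomial_span E"
    if "a \<in> monomial_span E" "x \<in> carrier R" for a x :: "'a \<Rightarrow>\<^sub>0 'k"
    using that assms mult_in_monomial_span[of x S a E E] mult_in_monomial_span[of a E x S E]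
    unfolding upset_def monoid_algebra_simps by (metis add.commute)+
qed

lemma mult_mem: "s \<in> S \<Longrightarrow> (\<Sum>i<m. s) \<in> S" for m :: nat
  by (induction m) (auto simp: zero_mem add_mem)

lemma upset_multiples:
  fixes q :: nat
  assumes "E0 \<subseteq> S"
  shows "upset {(\<Sum>i<q. e) + s | e s. e \<in> E0 \<and> s \<in> S}"
  unfolding upset_def
proof safe
  fix e s assume es: "e \<in> E0" "s \<in> S"
  then show "(\<Sum>i<q. e) + s \<in> S"
    using assms by (auto intro!: add_mem mult_mem)
  fix t assume "t \<in> S"
  then show "\<exists>ea sa. (\<Sum>i<q. e) + s + t = (\<Sum>i<q. ea) + sa \<and> ea \<in> E0 \<and> sa \<in> S"
    using es by (intro exI[of _ e] exI[of _ "s + t"]) (auto simp: add_mem add.assoc)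
qed

lemma ideal_sum_closed:
  assumes "ideal J (R :: ('a \<Rightarrow>\<^sub>0 'k::field) ring)" "\<And>i. i \<in> A \<Longrightarrow> f i \<in> J"
  shows "sum f A \<in> J"
proof -
  note J = ideal.axioms(1)[OF assms(1)]
  show ?thesis
    using assms(2) additive_subgroup.a_closed[OF J] additive_subgroup.zero_closed[OF J]
    by (induction A rule: infinite_finite_induct) auto
qed

lemma in_ideal_if_singles:
  assumes "ideal J (R :: ('a \<Rightarrow>\<^sub>0 'k::field) ring)"
    and "\<And>s c. s \<in> Poly_Mapping.keys f \<Longrightarrow> Poly_Mapping.single s c \<in> J"
  shows "f \<in> J"
  by (subst poly_mapping_eq_sum_single) (rule ideal_sum_closed[OF assms(1)], rule assms(2))

lemma ideal_prod_monomial_span: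
  assumes "upset A" "upset B"
  shows "ideal_prod R (monomial_span A) (monomial_span B)
           = (monomial_span {a + b | a b. a \<in> A \<and> b \<in> B} :: ('a \<Rightarrow>\<^sub>0 'k::field) set)" (is "?l = monomial_span ?E")
proof
  interpret cring "R :: ('a \<Rightarrow>\<^sub>0 'k) ring" by (rule cring_R)
  show "?l \<subseteq> monomial_span ?E"
  proof
    fix x assume "x \<in> ?l"
    then show "x \<in> monomial_span ?E"
      by induction (auto intro!: mult_in_monomial_span add_in_monomial_span)
  qed
  have I: "ideal ?l R"
    using assms by (intro ideal_prod_is_ideal ideal_monomial_span)
  show "monomial_span ?E \<subseteq> ?l"
  proof
    fix f :: "'a \<Rightarrow>\<^sub>0 'k" assume f: "f \<in> monomial_span ?E"
    show "f \<in> ?l"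
    proof (rule in_ideal_if_singles[OF I])
      fix s c assume "s \<in> Poly_Mapping.keys f"
      then obtain a b where s: "s = a + b" "a \<in> A" "b \<in> B"
        using f by (auto simp: monomial_span_def)
      have "Poly_Mapping.single a c \<otimes>\<^bsub>R\<^esub> Poly_Mapping.single b 1 \<in> ?l"
        using s by (intro ideal_prod.prod single_in_monomial_span)
      then show "Poly_Mapping.single s c \<in> ?l"
        by (simp add: s mult_single)
    qed
  qed
qed

text \<open>Raising to the power \<open>q\<close> is additive in characteristic p, so the power of a
  sum of monomials is the sum of their powers. \<open>E0\<close> generates \<open>E\<close> over
  \<open>S\<close>, and the multiple q (e0 + s) lies in q e0 + S, so the powers of generators
  suffice.\<close>

lemma frobenius_power_monomial_span:
  assumes char: "prime CHAR('k::field)" and q: "q = CHAR('k) ^ n"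
    and up: "upset E" and E0: "E0 \<subseteq> E" "\<And>e. e \<in> E \<Longrightarrow> \<exists>e0\<in>E0. \<exists>s\<in>S. e = e0 + s"
  shows "frobenius_power R (monomial_span E) q
           = (monomial_span {(\<Sum>i<q. e) + s | e s. e \<in> E0 \<and> s \<in> S} :: ('a \<Rightarrow>\<^sub>0 'k) set)"
    (is "?l = monomial_span ?F")
proof
  interpret cring "R :: ('a \<Rightarrow>\<^sub>0 'k) ring" by (rule cring_R)
  have upF: "upset ?F"
    using up E0(1) by (intro upset_multiples) (auto simp: upset_def)
  have powers: "x ^ q \<in> monomial_span ?F" if x: "x \<in> monomial_span E" for x :: "'a \<Rightarrow>\<^sub>0 'k"
  proof -
    have "x ^ q = (\<Sum>k\<in>Poly_Mapping.keys x. Poly_Mapping.single k (Poly_Mapping.lookup x k)) ^ q"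
      by (subst (1) poly_mapping_eq_sum_single) simp
    also have "\<dots> = (\<Sum>k\<in>Poly_Mapping.keys x. Poly_Mapping.single k (Poly_Mapping.lookup x k) ^ q)"
      using char q by (intro freshmans_dream_sum') (auto simp: CHAR_poly_mapping)
    also have "\<dots> \<in> monomial_span ?F"
    proof (rule sum_in_monomial_span, unfold single_power, rule single_in_monomial_span)
      fix k assume "k \<in> Poly_Mapping.keys x"
      then obtain e0 s where "e0 \<in> E0" "s \<in> S" "k = e0 + s"
        using x E0(2)[of k] by (auto simp: monomial_span_def)
      then show "(\<Sum>i<q. k) \<in> ?F"
        using mult_mem[of s q] by (auto simp: sum.distrib)
    qed
    finally show ?thesis .
  qed
  show "?l \<subseteq> monomial_span ?F"
    unfolding frobenius_power_def
    by (rule genideal_minimal[OF ideal_monomial_span[OF upF]]) (auto intro: powers)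
  have sub: "{x [^]\<^bsub>R\<^esub> q |x. x \<in> monomial_span E} \<subseteq> carrier (R :: ('a \<Rightarrow>\<^sub>0 'k) ring)"
  proof safe
    fix x :: "'a \<Rightarrow>\<^sub>0 'k" assume "x \<in> monomial_span E"
    then show "x [^]\<^bsub>R\<^esub> q \<in> carrier R"
      using powers[of x] upF by (simp add: upset_def monomial_span_def subset_trans[of _ ?F S])
  qed
  have I: "ideal ?l R"
    unfolding frobenius_power_def by (rule genideal_ideal[OF sub])
  show "monomial_span ?F \<subseteq> ?l"
  proof
    fix f :: "'a \<Rightarrow>\<^sub>0 'k" assume f: "f \<in> monomial_span ?F"
    show "f \<in> ?l"
    proof (rule in_ideal_if_singles[OF I])
      fix t c assume "t \<in> Poly_Mapping.keys f"
      then obtain e s where t: "t = (\<Sum>i<q. e) + s" "e \<in> E0" "s \<in> S"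
        using f by (auto simp: monomial_span_def)
      have "Poly_Mapping.single e 1 [^]\<^bsub>R\<^esub> q \<in> ?l"
        unfolding frobenius_power_def
        using genideal_self[OF sub] t E0 by (auto intro!: single_in_monomial_span)
      \<comment> \<open>The coefficient \<open>c\<close> is carried by the factor with exponent
        \<open>s\<close>, so no \<open>q\<close>-th root of it has to be taken.\<close>
      then have "Poly_Mapping.single s c \<otimes>\<^bsub>R\<^esub> Poly_Mapping.single e 1 [^]\<^bsub>R\<^esub> q \<in> ?l"
        using t by (intro ideal.I_l_closed[OF I]) (auto intro: single_in_monomial_span)
      then show "Poly_Mapping.single t c \<in> ?l"
        by (simp add: t single_power mult_single add.commute)
    qed
  qed
qed

text \<open>An ideal containing a monomial ideal is determined by the coefficients on the complement;
  a strictly increasing chain of such ideals therefore gives linearly independent vectors there.\<close>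

lemma chain_length_le:
  assumes up: "upset E" and fin: "finite (S - E)"
    and J: "\<And>i. i \<le> n \<Longrightarrow> ideal (J i) (R :: ('a \<Rightarrow>\<^sub>0 'k::field) ring)"
    and E: "\<And>i. i \<le> n \<Longrightarrow> monomial_span E \<subseteq> J i"
    and strict: "\<And>i. i < n \<Longrightarrow> J i \<subset> J (Suc i)"
  shows "n \<le> card (S - E)"
proof -
  \<comment> \<open>Scalars act as constant monomials. These belong to the algebra of
    \<open>S\<close>, so its ideals are subspaces.\<close>
  define scale :: "'k \<Rightarrow> ('a \<Rightarrow>\<^sub>0 'k) \<Rightarrow> ('a \<Rightarrow>\<^sub>0 'k)" where
    "scale c f = Poly_Mapping.single 0 c * f" for c f
  interpret V: vector_space scale
    by unfold_locales (auto simp: scale_def algebra_simps single_add mult_single simp flip: mult.assoc)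
  \<comment> \<open>Deleting the terms with exponent in \<open>E\<close> changes \<open>f\<close> by
    an element of every \<open>J i\<close>, so membership in the ideals of the chain is
    unaffected.\<close>
  define trunc :: "('a \<Rightarrow>\<^sub>0 'k) \<Rightarrow> ('a \<Rightarrow>\<^sub>0 'k)" where
    "trunc f = (\<Sum>s\<in>Poly_Mapping.keys f - E. Poly_Mapping.single s (Poly_Mapping.lookup f s))" for f
  have trunc_diff: "f = trunc f + (\<Sum>s\<in>Poly_Mapping.keys f \<inter> E. Poly_Mapping.single s (Poly_Mapping.lookup f s))"
    for f
    unfolding trunc_def
    by (subst (1) poly_mapping_eq_sum_single, subst sum.union_disjoint[symmetric]) (auto intro: sum.cong)
  have rest: "(\<Sum>s\<in>Poly_Mapping.keys f \<inter> E. Poly_Mapping.single s (Poly_Mapping.lookup f s)) \<in> monomial_span E"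
    for f :: "'a \<Rightarrow>\<^sub>0 'k"
    by (intro sum_in_monomial_span single_in_monomial_span) auto
  have trunc_iff: "trunc f \<in> J i \<longleftrightarrow> f \<in> J i" if "i \<le> n" "f \<in> monomial_span S" for f i
  proof -
    note JJ = ideal.axioms(1)[OF J[OF that(1)]]
    let ?r = "\<Sum>s\<in>Poly_Mapping.keys f \<inter> E. Poly_Mapping.single s (Poly_Mapping.lookup f s)"
    have "?r \<in> J i" "- ?r \<in> J i"
      using rest E[OF that(1)] by (blast intro: uminus_in_monomial_span)+
    moreover have "trunc f = f + - ?r"
      using trunc_diff[of f] by (simp add: eq_diff_eq)
    ultimately show ?thesis
      using additive_subgroup.a_closed[OF JJ, of "trunc f" ?r]
        additive_subgroup.a_closed[OF JJ, of f "- ?r"] trunc_diff[of f]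
      by (metis monoid_algebra_simps(4))
  qed
  have "\<exists>f. \<forall>i<n. f i \<in> J (Suc i) \<and> f i \<notin> J i"
    using strict by (intro choice) blast
  then obtain f where f: "\<And>i. i < n \<Longrightarrow> f i \<in> J (Suc i)" "\<And>i. i < n \<Longrightarrow> f i \<notin> J i"
    by blast
  have fS: "f i \<in> monomial_span S" if "i < n" for i
    using additive_subgroup.a_subset[OF ideal.axioms(1)[OF J[of "Suc i"]]] f(1)[OF that] that by auto
  define t where "t i = trunc (f i)" for i
  have t: "t i \<in> J (Suc i)" "t i \<notin> J i" if "i < n" for i
    using that f fS trunc_iff[of "Suc i" "f i"] trunc_iff[of i "f i"] by (auto simp: t_def)
  have mono: "J i \<subseteq> J j" if "i \<le> j" "j \<le> n" for i j
    using that
  proof (induction j rule: dec_induct)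
    case (step m)
    then show ?case using strict[of m] by auto
  qed simp
  have subspace: "V.subspace (J i)" if "i \<le> n" for i
  proof (rule V.subspaceI)
    note JJ = ideal.axioms(1)[OF J[OF that(1)]]
    show "0 \<in> J i" using additive_subgroup.zero_closed[OF JJ] by simp
    show "x + y \<in> J i" if "x \<in> J i" "y \<in> J i" for x y
      using additive_subgroup.a_closed[OF JJ that] by simp
    show "scale c x \<in> J i" if "x \<in> J i" for c x
      using ideal.I_l_closed[OF J[OF \<open>i \<le> n\<close>] that, of "Poly_Mapping.single 0 c"] zero_mem
      by (simp add: scale_def single_in_monomial_span)
  qed
  \<comment> \<open>The earlier vectors lie in the subspace \<open>J m\<close>, which does not
    contain \<open>t m\<close>.\<close>
  have indep: "V.independent (t ` {..<m}) \<and> card (t ` {..<m}) = m" if "m \<le> n" for m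
    using that
  proof (induction m)
    case 0
    then show ?case by (simp add: V.independent_empty)
  next
    case (Suc m)
    have "t ` {..<m} \<subseteq> J m"
    proof safe
      fix i assume "i < m"
      then show "t i \<in> J m"
        using t(1)[of i] mono[of "Suc i" m] Suc.prems by auto
    qed
    then have "V.span (t ` {..<m}) \<subseteq> J m"
      using subspace Suc.prems by (intro V.span_minimal) auto
    then have "t m \<notin> V.span (t ` {..<m})"
      using t(2)[of m] Suc.prems by auto
    moreover from this have "t m \<notin> t ` {..<m}"
      using V.span_base[of "t m" "t ` {..<m}"] by argo
    ultimately show ?case
      using Suc by (simp add: lessThan_Suc V.independent_insert)
  qed
  let ?B = "(\<lambda>s. Poly_Mapping.single s 1) ` (S - E) :: ('a \<Rightarrow>\<^sub>0 'k) set"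
  have "t ` {..<n} \<subseteq> V.span ?B"
  proof safe
    fix i assume "i < n"
    have eq: "Poly_Mapping.single s (c :: 'k) = scale c (Poly_Mapping.single s 1)" for s c
      by (simp add: scale_def mult_single)
    have "Poly_Mapping.keys (f i) \<subseteq> S"
      using fS[OF \<open>i < n\<close>] by (simp add: monomial_span_def)
    then have "Poly_Mapping.single s (Poly_Mapping.lookup (f i) s) \<in> V.span ?B"
      if "s \<in> Poly_Mapping.keys (f i) - E" for s
      using that by (subst eq, intro V.span_scale V.span_base) auto
    then show "t i \<in> V.span ?B"
      unfolding t_def trunc_def by (rule V.span_sum)
  qed
  then have "card (t ` {..<n}) \<le> card ?B"
    using indep[of n] fin by (intro V.independent_span_bound[THEN conjunct2]) auto
  also have "\<dots> \<le> card (S - E)"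
    using fin by (rule card_image_le)
  finally show ?thesis
    using indep[of n] by simp
qed

end

section \<open>Lengths of quotients by monomial ideals\<close>

locale graded_submonoid = submonoid S for S :: "'a::ab_group_add set" +
  fixes h :: "'a \<Rightarrow> int"
  assumes h_add: "\<And>s t. h (s + t) = h s + h t"
    and h_nonneg: "\<And>s. s \<in> S \<Longrightarrow> h s \<ge> 0"
    and h_eq_0: "\<And>s. s \<in> S \<Longrightarrow> h s = 0 \<Longrightarrow> s = 0"
begin

text \<open>Exponents can be adjoined one at a time: take one of maximal height in the complement.
  Adding a nonzero element of \<open>S\<close> to it increases the height strictly and therefore
  lands in \<open>E\<close>.\<close>

lemma upset_chain_exists:
  assumes "upset E" "finite (S - E)"
  shows "\<exists>F. F 0 = E \<and> (\<forall>i\<le>card (S - E). upset (F i)) \<and> (\<forall>i<card (S - E). F i \<subset> F (Suc i))"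
  using assms
proof (induction "card (S - E)" arbitrary: E)
  case 0
  then show ?case by (intro exI[of _ "\<lambda>_. E"]) (simp flip: 0(1))
next
  case (Suc m)
  have "S - E \<noteq> {}"
    using Suc.hyps(2) by force
  then have "Max (h ` (S - E)) \<in> h ` (S - E)"
    using Suc.prems(2) by simp
  then obtain s where "s \<in> S - E" "h s = Max (h ` (S - E))"
    by auto
  then have s: "s \<in> S - E" "\<And>t. t \<in> S - E \<Longrightarrow> h t \<le> h s"
    using Suc.prems(2) by simp_all
  have up: "upset (insert s E)"
    unfolding upset_def
  proof safe
    fix t assume t: "t \<in> S" "s + t \<notin> E"
    then have "h (s + t) \<le> h s"
      using s add_mem by blast
    then show "s + t = s"
      using h_nonneg[OF t(1)] h_eq_0[OF t(1)] by (auto simp: h_add)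
  qed (use s Suc.prems in \<open>auto simp: upset_def\<close>)
  have card: "card (S - insert s E) = m"
    using s Suc.hyps(2) Suc.prems(2) by (simp add: Diff_insert[of S s E])
  moreover have "finite (S - insert s E)"
    using Suc.prems(2) by (rule rev_finite_subset) auto
  ultimately obtain F where F: "F 0 = insert s E" "\<forall>i\<le>m. upset (F i)" "\<forall>i<m. F i \<subset> F (Suc i)"
    using Suc.hyps(1)[of "insert s E"] up by auto
  show ?case
  proof (intro exI[of _ "case_nat E F"] conjI allI impI)
    show "upset (case_nat E F i)" if "i \<le> card (S - E)" for i
      using that F(2) Suc.prems(1) Suc.hyps(2) by (cases i) auto
    show "case_nat E F i \<subset> case_nat E F (Suc i)" if "i < card (S - E)" for i
      using that F(1,3) Suc.hyps(2) s by (cases i) auto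
  qed simp
qed

text \<open>Chains in the quotient are lifted to ideals above the monomial ideal and bounded by
  linear independence; the chain of upsets that adjoins one exponent at a time attains the
  bound.\<close>

lemma ring_length_monomial_quotient:
  assumes up: "upset E" and fin: "finite (S - E)"
  shows "ring_length ((R :: ('a \<Rightarrow>\<^sub>0 'k::field) ring) Quot monomial_span E) = enat (card (S - E))"
proof -
  interpret ring "R :: ('a \<Rightarrow>\<^sub>0 'k) ring" by (rule ring_R)
  let ?I = "monomial_span E :: ('a \<Rightarrow>\<^sub>0 'k) set"
  let ?Q = "R Quot ?I"
  note I = ideal_monomial_span[OF up, where ?'k = 'k]
  note bij = quot_ideal_correspondence[OF I]
  have "n \<le> card (S - E)" if J: "\<forall>i\<le>n. ideal (J i) ?Q" "\<forall>i<n. J i \<subset> J (Suc i)" for n J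
  proof -
    define J' where "J' i = inv_into {J. ideal J R \<and> ?I \<subseteq> J} ((`) ((+>\<^bsub>R\<^esub>) ?I)) (J i)" for i
    have J': "J' i \<in> {J. ideal J R \<and> ?I \<subseteq> J}" "(+>\<^bsub>R\<^esub>) ?I ` J' i = J i" if "i \<le> n" for i
      using J(1) that bij_betw_inv_into_right[OF bij, of "J i"] bij_betwE[OF bij_betw_inv_into[OF bij]]
      unfolding J'_def by (auto simp: that)
    \<comment> \<open>The ideal correspondence is available only as a bijection. Writing the lifted
      ideal as the union of its cosets makes it visibly monotone in \<open>J i\<close>.\<close>
    have eq: "J' i = \<Union> (J i)" if "i \<le> n" for i
    proof -
      have "J' i = (\<Union>j\<in>J' i. ?I +>\<^bsub>R\<^esub> j)"
        using J'(1)[OF that] ideal_incl_iff[OF I, of "J' i"] by simp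
      then show ?thesis using J'(2)[OF that] by simp
    qed
    have "J' i \<subset> J' (Suc i)" if "i < n" for i
    proof -
      have "J i \<subset> J (Suc i)" using J(2) that by blast
      then have "J' i \<subseteq> J' (Suc i)" using eq that by auto
      moreover have "J' i \<noteq> J' (Suc i)"
        using J'(2)[of i] J'(2)[of "Suc i"] \<open>J i \<subset> J (Suc i)\<close> that by auto
      ultimately show ?thesis by blast
    qed
    then show ?thesis
      using J'(1) by (intro chain_length_le[OF up fin, of n J']) auto
  qed
  moreover have "\<exists>J. (\<forall>i\<le>card (S - E). ideal (J i) ?Q) \<and> (\<forall>i<card (S - E). J i \<subset> J (Suc i))"
  proof -
    obtain F where F: "F 0 = E" "\<And>i. i \<le> card (S - E) \<Longrightarrow> upset (F i)"
      "\<And>i. i < card (S - E) \<Longrightarrow> F i \<subset> F (Suc i)"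
      using upset_chain_exists[OF up fin] by blast
    have EF: "E \<subseteq> F i" if "i \<le> card (S - E)" for i
      using that
    proof (induction i)
      case (Suc i)
      then show ?case using F(3)[of i] by auto
    qed (simp add: F)
    define J where "J i = (monomial_span (F i) :: ('a \<Rightarrow>\<^sub>0 'k) set)" for i
    have J: "ideal (J i) R" "?I \<subseteq> J i" if "i \<le> card (S - E)" for i
      using ideal_monomial_span[OF F(2)[OF that]] EF[OF that] by (auto simp: J_def monomial_span_def)
    have strict: "(+>\<^bsub>R\<^esub>) ?I ` J i \<subset> (+>\<^bsub>R\<^esub>) ?I ` J (Suc i)" if "i < card (S - E)" for i
    proof -
      obtain s where s: "s \<in> F (Suc i)" "s \<notin> F i"
        using F(3)[OF \<open>i < card (S - E)\<close>] by blast
      then have "Poly_Mapping.single s 1 \<in> J (Suc i) - J i"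
        by (simp add: J_def single_in_monomial_span_iff)
      moreover have "J i \<subseteq> J (Suc i)"
        using F(3)[OF that] by (auto simp: J_def monomial_span_def)
      ultimately have "J i \<subset> J (Suc i)" by blast
      moreover have "J i \<in> {J. ideal J R \<and> ?I \<subseteq> J}" "J (Suc i) \<in> {J. ideal J R \<and> ?I \<subseteq> J}"
        using J[of i] J[of "Suc i"] \<open>i < card (S - E)\<close> by simp_all
      then have "(+>\<^bsub>R\<^esub>) ?I ` J i = (+>\<^bsub>R\<^esub>) ?I ` J (Suc i) \<longleftrightarrow> J i = J (Suc i)"
        by (rule inj_on_eq_iff[OF bij_betw_imp_inj_on[OF bij]])
      ultimately show ?thesis
        using image_mono[of "J i" "J (Suc i)" "(+>\<^bsub>R\<^esub>) ?I"] by (simp add: psubset_eq)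
    qed
    have "ideal ((+>\<^bsub>R\<^esub>) ?I ` J i) ?Q" if "i \<le> card (S - E)" for i
      using bij_betw_apply[OF bij, of "J i"] J[OF that] by simp
    with strict show ?thesis
      by (intro exI[of _ "\<lambda>i. (+>\<^bsub>R\<^esub>) ?I ` J i"] conjI allI impI)
  qed
  ultimately show ?thesis
    unfolding ring_length_def by (intro Sup_eqI) auto
qed

lemma colength_monomial_span:
  assumes "upset E" "finite (S - E)"
  shows "colength (R :: ('a \<Rightarrow>\<^sub>0 'k::field) ring) (monomial_span E) = real (card (S - E))"
  by (simp add: colength_def ring_length_monomial_quotient[OF assms])

abbreviation above :: "int \<Rightarrow> 'a set" where
  "above a \<equiv> {s \<in> S. h s \<ge> a}"

lemma upset_above: "upset (above a)"
  unfolding upset_def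
proof (intro conjI ballI)
  fix e s assume "e \<in> above a" "s \<in> S"
  then show "e + s \<in> above a"
    using h_nonneg[of s] by (simp add: h_add add_mem)
qed auto

end

text \<open>\<open>split\<close> is the form in which generation in degree one is used: an element
  can be cut at any height up to its own.\<close>

locale standard_graded_submonoid = graded_submonoid S h for S :: "'a::ab_group_add set" and h +
  assumes split: "\<And>s a. s \<in> S \<Longrightarrow> 0 \<le> a \<Longrightarrow> a \<le> h s \<Longrightarrow> \<exists>t\<in>S. \<exists>u\<in>S. s = t + u \<and> h t = a"
begin

text \<open>Needed twice: with \<open>a = 1\<close> it computes the powers of the maximal ideal, and
  with \<open>a = k\<close> the powers of such a power, which enter its Hilbert-Samuel
  multiplicity.\<close>

lemma ideal_power_above:
  assumes "a \<ge> 0"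
  shows "ideal_power (R :: ('a \<Rightarrow>\<^sub>0 'k::field) ring) (monomial_span (above a)) n
           = monomial_span (above (a * int n))"
proof (induction n)
  case 0
  have "above 0 = S"
    using h_nonneg by auto
  then show ?case
    by (simp add: ideal_power_def ideals_set_def nat_pow_def)
next
  case (Suc n)
  have "ideal_power (R :: ('a \<Rightarrow>\<^sub>0 'k) ring) (monomial_span (above a)) (Suc n)
      = ideal_prod R (ideal_power R (monomial_span (above a)) n) (monomial_span (above a))"
    by (simp add: ideal_power_def ideals_set_def nat_pow_def)
  also have "\<dots> = monomial_span {s + t | s t. s \<in> above (a * int n) \<and> t \<in> above a}"
    unfolding Suc.IH by (rule ideal_prod_monomial_span) (rule upset_above)+
  also have "{s + t | s t. s \<in> above (a * int n) \<and> t \<in> above a} = above (a * int (Suc n))"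
  proof safe
    fix s assume "s \<in> S" "a * int (Suc n) \<le> h s"
    moreover from this obtain t u where "t \<in> S" "u \<in> S" "s = t + u" "h t = a * int n"
      using split[of s "a * int n"] assms by (auto simp: algebra_simps)
    ultimately show "\<exists>t u. s = t + u \<and> t \<in> above (a * int n) \<and> u \<in> above a"
      by (intro exI[of _ t] exI[of _ u]) (auto simp: h_add algebra_simps)
  qed (auto simp: h_add algebra_simps add_mem)
  finally show ?case .
qed

text \<open>By \<open>split\<close>, the elements of height exactly \<open>a\<close> generate all
  higher ones, so they can serve as \<open>E0\<close>.\<close>

lemma frobenius_power_above:
  assumes "prime CHAR('k::field)" "a \<ge> 0"
  shows "frobenius_power R (monomial_span (above a)) (CHAR('k) ^ n)
           = (monomial_span {(\<Sum>i<CHAR('k) ^ n. e) + s | e s. (e \<in> S \<and> h e = a) \<and> s \<in> S} :: ('a \<Rightarrow>\<^sub>0 'k) set)"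
proof -
  have "\<exists>e0\<in>{e \<in> S. h e = a}. \<exists>s\<in>S. e = e0 + s" if "e \<in> above a" for e
    using split[of e a] that assms by blast
  then show ?thesis
    using frobenius_power_monomial_span[OF assms(1) refl upset_above, of "{e \<in> S. h e = a}" a n] by auto
qed

end

section \<open>Counting integer points\<close>

text \<open>Stated for every Euclidean space, because points are counted both in the full space, for
  colengths, and in a slice of codimension one.\<close>

definition integer_points :: "'a::euclidean_space set" where
  "integer_points = {x. \<forall>b\<in>Basis. x \<bullet> b \<in> \<int>}"

text \<open>Its fibres over integer points are half-open unit cells, which partition the space
  without overlap.\<close>

definition vec_floor :: "'a::euclidean_space \<Rightarrow> 'a" where
  "vec_floor x = (\<Sum>b\<in>Basis. of_int \<lfloor>x \<bullet> b\<rfloor> *\<^sub>R b)"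

lemma vec_floor_inner [simp]: "b \<in> Basis \<Longrightarrow> vec_floor x \<bullet> b = of_int \<lfloor>x \<bullet> b\<rfloor>"
  by (simp add: vec_floor_def)

lemma vec_floor_in_integer_points [simp]: "vec_floor x \<in> integer_points"
  by (simp add: integer_points_def)

lemma integer_points_diff: "x \<in> integer_points \<Longrightarrow> y \<in> integer_points \<Longrightarrow> x - y \<in> integer_points"
  by (auto simp: integer_points_def inner_diff_left)

lemma integer_points_scaleR: "x \<in> integer_points \<Longrightarrow> real q *\<^sub>R x \<in> integer_points"
  by (auto simp: integer_points_def)

lemma vec_floor_eq_iff:
  assumes "z \<in> integer_points"
  shows "vec_floor x = z \<longleftrightarrow> (\<forall>b\<in>Basis. z \<bullet> b \<le> x \<bullet> b \<and> x \<bullet> b < z \<bullet> b + 1)"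
proof -
  have "real_of_int \<lfloor>x \<bullet> b\<rfloor> = z \<bullet> b \<longleftrightarrow> z \<bullet> b \<le> x \<bullet> b \<and> x \<bullet> b < z \<bullet> b + 1" if b: "b \<in> Basis" for b
  proof -
    obtain m where "z \<bullet> b = of_int m"
      using assms b by (auto simp: integer_points_def elim: Ints_cases)
    then show ?thesis
      by (simp add: floor_eq_iff)
  qed
  then show ?thesis
    by (subst euclidean_eq_iff) auto
qed

lemma vec_floor_diff:
  assumes "z \<in> integer_points"
  shows "vec_floor (x - z) = vec_floor x - z"
  using vec_floor_eq_iff[of "vec_floor x" x] assms
  by (subst vec_floor_eq_iff) (auto simp: integer_points_diff inner_diff_left)

lemma dist_vec_floor: "dist (vec_floor x) x \<le> DIM('a)" for x :: "'a::euclidean_space"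
proof -
  have "dist (vec_floor x) x \<le> (\<Sum>b\<in>Basis. \<bar>(vec_floor x - x) \<bullet> b\<bar>)"
    unfolding dist_norm by (rule norm_le_l1)
  also have "\<dots> \<le> (\<Sum>b\<in>(Basis :: 'a set). 1)"
    by (rule sum_mono) (simp add: inner_diff_left, linarith)
  finally show ?thesis by simp
qed

lemma vec_floor_measurable [measurable]: "vec_floor \<in> borel_measurable borel"
  unfolding vec_floor_def by measurable

lemma finite_bounded_integer_points:
  assumes "bounded A"
  shows "finite (A \<inter> integer_points)"
proof -
  obtain B where B: "\<And>x. x \<in> A \<Longrightarrow> norm x \<le> B"
    using assms by (auto simp: bounded_iff)
  have "A \<inter> integer_points \<subseteq> (\<lambda>f. \<Sum>b\<in>Basis. of_int (f b) *\<^sub>R b) ` (Basis \<rightarrow>\<^sub>E {- \<lceil>B\<rceil>..\<lceil>B\<rceil>})"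
  proof
    fix x assume x: "x \<in> A \<inter> integer_points"
    then have absB: "\<bar>x \<bullet> b\<bar> \<le> B" if "b \<in> Basis" for b
      using B[of x] Basis_le_norm[OF that, of x] by auto
    then have "\<lfloor>x \<bullet> b\<rfloor> \<in> {- \<lceil>B\<rceil>..\<lceil>B\<rceil>}" if "b \<in> Basis" for b
    proof -
      have "- B \<le> x \<bullet> b" "x \<bullet> b \<le> B"
        using absB[OF that] by linarith+
      then show ?thesis
        using floor_mono[of "- B" "x \<bullet> b"] floor_mono[of "x \<bullet> b" B] floor_le_ceiling[of B]
        by (auto simp: floor_minus intro: order_trans)
    qed
    moreover have "vec_floor x = x"
      using x by (subst vec_floor_eq_iff) auto
    ultimately show "x \<in> (\<lambda>f. \<Sum>b\<in>Basis. of_int (f b) *\<^sub>R b) ` (Basis \<rightarrow>\<^sub>E {- \<lceil>B\<rceil>..\<lceil>B\<rceil>})"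
      unfolding vec_floor_def by (intro image_eqI[of _ _ "restrict (\<lambda>b. \<lfloor>x \<bullet> b\<rfloor>) Basis"]) auto
  qed
  then show ?thesis
    by (rule finite_subset) (intro finite_imageI finite_PiE; simp)
qed

lemma integer_cell_subset:
  assumes "z \<in> integer_points"
  shows "box z (z + One) \<subseteq> {x. vec_floor x = z}" "{x. vec_floor x = z} \<subseteq> cbox z (z + One)"
  using vec_floor_eq_iff[OF assms] by (auto simp: mem_box inner_add_left less_imp_le)

lemma integer_cell_sets [measurable]: "{x. vec_floor x = z} \<in> sets borel"
  using measurable_sets_borel[OF vec_floor_measurable, of "{z}"] by (simp add: vimage_def)

text \<open>Disjointness requires half-open cells, while \<open>unit_cell\<close> is closed; the two
  kinds differ by a null set.\<close>

lemma measure_Int_integer_cell: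
  assumes z: "z \<in> integer_points" and N: "N \<in> sets borel"
  shows "measure lborel ({x. vec_floor x = z} \<inter> N) = measure lborel (cbox z (z + One) \<inter> N)"
proof -
  have "AE x in lborel. x \<notin> cbox z (z + One) - box z (z + One)"
    by (rule AE_not_in[OF null_sets_cbox_Diff_box])
  then have "AE x in lborel. x \<in> {x. vec_floor x = z} \<inter> N \<longleftrightarrow> x \<in> cbox z (z + One) \<inter> N"
    by eventually_elim (use integer_cell_subset[OF z] in auto)
  then show ?thesis
    using N by (intro measure_eq_AE) auto
qed

lemma measure_integer_cell: "z \<in> integer_points \<Longrightarrow> measure lborel {x. vec_floor x = z} = 1"
  using measure_Int_integer_cell[of z UNIV] by (simp add: inner_add_left)

lemma emeasure_bounded_borel_finite:
  "bounded A \<Longrightarrow> emeasure lborel A \<noteq> top_class.top"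
  using emeasure_bounded_finite[of A] by auto

lemma measure_vec_floor_scaled:
  fixes E :: "'a::euclidean_space set"
  assumes fin: "finite E" and E: "E \<subseteq> integer_points" and q: "q > 0"
  shows "measure lborel {x. vec_floor (q *\<^sub>R x) \<in> E} = card E / q ^ DIM('a)"
proof -
  have cell: "measure lborel {x. vec_floor (q *\<^sub>R x) = z} = 1 / q ^ DIM('a)"
    "bounded {x. vec_floor (q *\<^sub>R x) = z}" if z: "z \<in> E" for z
  proof -
    have eq: "{x. vec_floor (q *\<^sub>R x) = z} = (\<lambda>x. (1 / q) *\<^sub>R x + 0) ` {x. vec_floor x = z}"
      using q by (auto simp: image_iff intro!: exI[of _ "q *\<^sub>R _"])
    have "measure lborel {x. vec_floor (q *\<^sub>R x) = z} = measure lebesgue {x. vec_floor (q *\<^sub>R x) = z}"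
      by (subst measure_completion) (auto intro!: measurable_sets_borel[of "\<lambda>x. vec_floor (q *\<^sub>R x)" borel "{z}", simplified vimage_def, simplified])
    also have "\<dots> = \<bar>1 / q\<bar> ^ DIM('a) * measure lebesgue {x. vec_floor x = z}"
      unfolding eq by (rule measure_lebesgue_affine)
    also have "measure lebesgue {x. vec_floor x = z} = 1"
      using measure_integer_cell[of z] E z by (subst measure_completion) auto
    finally show "measure lborel {x. vec_floor (q *\<^sub>R x) = z} = 1 / q ^ DIM('a)"
      using q by (simp add: power_divide)
    have "bounded {x. vec_floor x = z}"
      using integer_cell_subset(2)[of z] E z bounded_subset[OF bounded_cbox] by blast
    then show "bounded {x. vec_floor (q *\<^sub>R x) = z}"
      unfolding eq by (simp add: bounded_scaling)
  qed
  have meas: "{x. vec_floor (q *\<^sub>R x) = z} \<in> sets lborel" for z :: 'a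
    using measurable_sets_borel[of "\<lambda>x. vec_floor (q *\<^sub>R x)" borel "{z}"] by (simp add: vimage_def)
  have "{x. vec_floor (q *\<^sub>R x) \<in> E} = (\<Union>z\<in>E. {x. vec_floor (q *\<^sub>R x) = z})"
    by auto
  also have "measure lborel \<dots> = (\<Sum>z\<in>E. measure lborel {x. vec_floor (q *\<^sub>R x) = z})"
    using cell(2) meas
    by (intro measure_finite_Union fin) (auto simp: disjoint_family_on_def emeasure_bounded_borel_finite)
  also have "\<dots> = card E / q ^ DIM('a)"
    using cell(1) by simp
  finally show ?thesis .
qed

text \<open>The number of points of \<open>E q\<close>, divided by \<open>q\<close> to the power of the dimension, is the volume of the set of
  all \<open>x\<close> for which \<open>q x\<close>, rounded down, belongs to \<open>E q\<close>; dominated convergence applies to these sets.\<close>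

lemma card_integer_points_tendsto:
  fixes E :: "nat \<Rightarrow> 'a::euclidean_space set"
  assumes E: "\<And>q. E q \<subseteq> integer_points"
    and bound: "\<And>q z. q > 0 \<Longrightarrow> z \<in> E q \<Longrightarrow> norm z \<le> real q * B"
    and A: "A \<in> sets borel"
    and lim: "AE x in lborel. \<forall>\<^sub>F q in sequentially. vec_floor (real q *\<^sub>R x) \<in> E q \<longleftrightarrow> x \<in> A"
  shows "(\<lambda>q. card (E q) / real q ^ DIM('a)) \<longlonglongrightarrow> measure lborel A"
proof -
  \<comment> \<open>For \<open>q = 0\<close> the preimage would be everything or nothing; the empty
    set keeps all \<open>X q\<close> inside one ball.\<close>
  define X where "X q = (if q = 0 then {} else {x. vec_floor (real q *\<^sub>R x) \<in> E q})" for q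
  have fin: "finite (E q)" if "q > 0" for q
  proof -
    have "E q \<subseteq> cball 0 (real q * B) \<inter> integer_points"
      using bound[OF that] E by auto
    then show ?thesis
      using finite_subset finite_bounded_integer_points[OF bounded_cball] by blast
  qed
  have X_sets: "X q \<in> sets borel" for q
  proof (cases "q = 0")
    case False
    then have "X q = (\<lambda>x. vec_floor (real q *\<^sub>R x)) -` E q"
      by (auto simp: X_def)
    moreover have "E q \<in> sets borel"
      using fin False by (intro borel_closed finite_imp_closed) auto
    ultimately show ?thesis
      using measurable_sets_borel[of "\<lambda>x. vec_floor (real q *\<^sub>R x)" borel "E q"] by simp
  qed (simp add: X_def)
  have X_bound: "X q \<subseteq> cball 0 (B + DIM('a))" for q
  proof
    fix x assume x: "x \<in> X q"
    then have q: "q > 0" by (auto simp: X_def split: if_splits)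
    have "real q * norm x = norm (real q *\<^sub>R x)"
      by simp
    also have "\<dots> \<le> norm (vec_floor (real q *\<^sub>R x)) + dist (vec_floor (real q *\<^sub>R x)) (real q *\<^sub>R x)"
      using norm_triangle_sub[of "real q *\<^sub>R x" "vec_floor (real q *\<^sub>R x)"]
      by (simp add: dist_norm norm_minus_commute)
    also have "\<dots> \<le> real q * B + DIM('a)"
      using x q by (intro add_mono bound dist_vec_floor) (auto simp: X_def)
    \<comment> \<open>Since \<open>q\<close> is at least 1, the rounding error is absorbed into a
      multiple of \<open>q\<close>.\<close>
    also have "\<dots> \<le> real q * (B + DIM('a))"
      unfolding distrib_left using mult_right_mono[of 1 "real q" "real DIM('a)"] q by linarith
    finally have "norm x \<le> B + DIM('a)"
      using q by (simp only: mult_le_cancel_left_pos of_nat_0_less_iff)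
    then show "x \<in> cball 0 (B + DIM('a))"
      by simp
  qed
  have "(\<lambda>q. integral\<^sup>L lborel (indicator (X q) :: 'a \<Rightarrow> real)) \<longlonglongrightarrow> integral\<^sup>L lborel (indicator A)"
  proof (rule integral_dominated_convergence[where w = "indicator (cball 0 (B + DIM('a)))"])
    show "integrable lborel (indicator (cball (0 :: 'a) (B + DIM('a))) :: 'a \<Rightarrow> real)"
      by (intro integrable_real_indicator emeasure_lborel_cball_finite) simp
    show "AE x in lborel. (\<lambda>q. indicator (X q) x :: real) \<longlonglongrightarrow> indicator A x"
      using lim
    proof eventually_elim
      case (elim x)
      then have "\<forall>\<^sub>F q in sequentially. indicator (X q) x = (indicator A x :: real)"
        using eventually_gt_at_top[of 0] by eventually_elim (auto simp: X_def indicator_def)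
      then show ?case by (rule tendsto_eventually)
    qed
    show "AE x in lborel. norm (indicator (X q) x :: real) \<le> indicator (cball 0 (B + DIM('a))) x" for q
      using X_bound[of q] by (intro AE_I2) (auto simp: indicator_def)
  qed (use A X_sets in auto)
  then have "(\<lambda>q. measure lborel (X q)) \<longlonglongrightarrow> measure lborel A"
    using A X_sets by simp
  moreover have "\<forall>\<^sub>F q in sequentially. measure lborel (X q) = card (E q) / real q ^ DIM('a)"
    using eventually_gt_at_top[of 0]
    by eventually_elim (use measure_vec_floor_scaled[OF fin E] in \<open>auto simp: X_def\<close>)
  ultimately show ?thesis
    by (rule Lim_transform_eventually)
qed

text \<open>Displacements of bounded size, caused by rounding or by translation with a fixed vector,
  disappear after rescaling.\<close>

lemma eventually_scaled_near_in_open: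
  fixes y :: "'a::real_normed_vector"
  assumes "open U" "y \<in> U"
  shows "\<forall>\<^sub>F q in sequentially. \<forall>z. dist z (real q *\<^sub>R y) \<le> B \<longrightarrow> (1 / real q) *\<^sub>R z \<in> U"
proof -
  obtain e where e: "e > 0" "ball y e \<subseteq> U"
    using assms openE by blast
  have "\<forall>\<^sub>F q in sequentially. real q > B / e"
    using filterlim_real_sequentially by (rule filterlim_at_top_dense[THEN iffD1, rule_format])
  then show ?thesis
    using eventually_gt_at_top[of 0]
  proof eventually_elim
    case (elim q)
    have "(1 / real q) *\<^sub>R z \<in> ball y e" if z: "dist z (real q *\<^sub>R y) \<le> B" for z
    proof -
      have "(1 / real q) *\<^sub>R z - y = (1 / real q) *\<^sub>R (z - real q *\<^sub>R y)"
        using elim by (simp add: scaleR_diff_right)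
      then have "dist ((1 / real q) *\<^sub>R z) y = dist z (real q *\<^sub>R y) / real q"
        by (simp add: dist_norm)
      also have "\<dots> \<le> B / real q"
        using z by (simp add: divide_right_mono)
      also have "\<dots> < e"
        using elim e by (simp add: field_simps)
      finally show ?thesis by (simp add: dist_commute)
    qed
    then show ?case using e by blast
  qed
qed

lemma AE_not_in_negligible:
  "N \<in> sets borel \<Longrightarrow> negligible N \<Longrightarrow> AE x in lborel. x \<notin> N"
  by (intro AE_not_in) (simp add: negligible_iff_null_sets null_sets_completion_iff)

text \<open>Supplies the exceptional null sets for the almost everywhere arguments about the cone
  and its slices.\<close>

lemma AE_not_in_convex_frontier:
  fixes S :: "'a::euclidean_space set"
  assumes "convex S"
  shows "AE x in lborel. x - a \<notin> frontier S"
proof -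
  have "{x. x - a \<in> frontier S} = (+) a ` frontier S"
    by (auto simp: image_iff intro!: bexI[of _ "_ - a"])
  moreover have "closed ((+) a ` frontier S)"
    by (intro closed_translation) simp
  ultimately have "AE x in lborel. x \<notin> {x. x - a \<in> frontier S}"
    using negligible_convex_frontier[OF assms] by (intro AE_not_in_negligible) (auto simp: negligible_translation)
  then show ?thesis by simp
qed

section \<open>Lattice vectors\<close>

lemma rvec_nth [simp]: "rvec u $ i = of_int (u $ i)"
  by (simp add: rvec_def)

lemma rvec_simps [simp]: "rvec 0 = 0" "rvec (u + w) = rvec u + rvec w" "rvec (- u) = - rvec u"
  "rvec (u - w) = rvec u - rvec w"
  by (simp_all add: vec_eq_iff)

lemma rvec_eq_iff [simp]: "rvec u = rvec w \<longleftrightarrow> u = w"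
  by (simp add: vec_eq_iff)

lemma inj_rvec: "inj rvec"
  by (simp add: inj_def)

lemma rvec_sum: "rvec (sum f A) = (\<Sum>x\<in>A. rvec (f x))"
  by (induction A rule: infinite_finite_induct) auto

lemma rvec_in_integer_points: "rvec u \<in> integer_points"
  by (auto simp: integer_points_def Basis_vec_def inner_axis)

lemma integer_points_rvecE:
  assumes "z \<in> integer_points"
  obtains u where "z = rvec u"
proof
  have "z $ i \<in> \<int>" for i
    using assms by (auto simp: integer_points_def Basis_vec_def inner_axis dest!: bspec[of _ _ "axis i 1"])
  then show "z = rvec (\<chi> i. \<lfloor>z $ i\<rfloor>)"
    by (simp add: vec_eq_iff)
qed

lemma finite_bounded_int_vec:
  fixes A :: "(real ^ 'n) set"
  assumes "bounded A"
  shows "finite {u. rvec u \<in> A}"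
proof -
  have "rvec ` {u. rvec u \<in> A} \<subseteq> A \<inter> integer_points"
    using rvec_in_integer_points by auto
  then have "finite (rvec ` {u. rvec u \<in> A})"
    using finite_bounded_integer_points[OF assms] by (rule finite_subset)
  then show ?thesis
    by (rule finite_imageD) (simp add: inj_on_def)
qed

section \<open>Cones of a fan are generated by their rays\<close>

lemma mem_convex_cone_hull_finite:
  fixes G :: "'a::real_vector set"
  assumes "finite G"
  shows "x \<in> convex_cone hull G \<longleftrightarrow> (\<exists>c. (\<forall>g\<in>G. 0 \<le> c g) \<and> x = (\<Sum>g\<in>G. c g *\<^sub>R g))"
proof
  let ?T = "{x. \<exists>c. (\<forall>g\<in>G. 0 \<le> c g) \<and> x = (\<Sum>g\<in>G. c g *\<^sub>R g)}"
  assume "x \<in> convex_cone hull G"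
  moreover have "convex_cone ?T"
    unfolding convex_cone_iff
  proof (intro conjI)
    show "0 \<in> ?T"
      by (auto intro!: exI[of _ "\<lambda>_. 0"])
    show "\<forall>x\<in>?T. \<forall>c\<ge>0. c *\<^sub>R x \<in> ?T"
    proof (clarsimp)
      fix c :: "'a \<Rightarrow> real" and t :: real assume "\<forall>g\<in>G. 0 \<le> c g" "0 \<le> t"
      then show "\<exists>c'. (\<forall>g\<in>G. 0 \<le> c' g) \<and> t *\<^sub>R (\<Sum>g\<in>G. c g *\<^sub>R g) = (\<Sum>g\<in>G. c' g *\<^sub>R g)"
        by (intro exI[of _ "\<lambda>g. t * c g"]) (auto simp: scaleR_sum_right)
    qed
    show "\<forall>x\<in>?T. \<forall>y\<in>?T. x + y \<in> ?T"
    proof (clarsimp)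
      fix c d :: "'a \<Rightarrow> real" assume "\<forall>g\<in>G. 0 \<le> c g" "\<forall>g\<in>G. 0 \<le> d g"
      then show "\<exists>c'. (\<forall>g\<in>G. 0 \<le> c' g) \<and> (\<Sum>g\<in>G. c g *\<^sub>R g) + (\<Sum>g\<in>G. d g *\<^sub>R g) = (\<Sum>g\<in>G. c' g *\<^sub>R g)"
        by (intro exI[of _ "\<lambda>g. c g + d g"]) (auto simp: scaleR_left_distrib sum.distrib)
    qed
  qed
  moreover have "G \<subseteq> ?T"
  proof
    fix g assume "g \<in> G"
    then have "g = (\<Sum>g'\<in>G. (if g' = g then 1 else 0) *\<^sub>R g')"
      using assms by (simp add: if_distrib[of "\<lambda>c. c *\<^sub>R _"] cong: if_cong)
    then show "g \<in> ?T"
      by (intro CollectI exI[of _ "\<lambda>g'. if g' = g then 1 else 0"]) auto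
  qed
  ultimately show "\<exists>c. (\<forall>g\<in>G. 0 \<le> c g) \<and> x = (\<Sum>g\<in>G. c g *\<^sub>R g)"
    using hull_minimal[of G ?T convex_cone] by blast
next
  assume "\<exists>c. (\<forall>g\<in>G. 0 \<le> c g) \<and> x = (\<Sum>g\<in>G. c g *\<^sub>R g)"
  then obtain c where c: "\<forall>g\<in>G. 0 \<le> c g" "x = (\<Sum>g\<in>G. c g *\<^sub>R g)" by blast
  have "(\<Sum>g\<in>F. c g *\<^sub>R g) \<in> convex_cone hull G" if "F \<subseteq> G" for F
    using finite_subset[OF that assms] that
    by (induction F rule: finite_induct)
       (use c(1) in \<open>auto intro!: convex_cone_hull_contains_0 convex_cone_hull_add convex_cone_hull_mul intro: hull_inc\<close>)
  then show "x \<in> convex_cone hull G"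
    using c(2) by blast
qed

lemma scaleR_mem_convex_cone_hull_singleton:
  fixes g :: "'a::real_vector"
  shows "0 \<le> c \<Longrightarrow> c *\<^sub>R g \<in> convex_cone hull {g}"
  by (simp add: convex_cone_hull_mul hull_inc)

text \<open>Let a point c g of the ray lie strictly between x and y, and expand all three in the
  generators. Minimality of g forces its coefficient \<open>e g\<close> to be at least
  \<open>c\<close>. Then the negative of each remaining term is again in the cone, so strong
  convexity makes that term vanish, and with it the corresponding terms of x and y.\<close>

lemma ray_face_of_cone:
  fixes G :: "'a::real_vector set"
  assumes fin: "finite G" and strong: "\<And>x. x \<in> convex_cone hull G \<Longrightarrow> - x \<in> convex_cone hull G \<Longrightarrow> x = 0"
    and g: "g \<in> G" "g \<noteq> 0" and minimal: "g \<notin> convex_cone hull (G - {g})"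
  shows "convex_cone hull {g} face_of convex_cone hull G"
  unfolding face_of_def
proof (intro conjI ballI impI)
  show "convex_cone hull {g} \<subseteq> convex_cone hull G"
    using g by (intro hull_mono) auto
  show "convex (convex_cone hull {g})"
    by (rule convex_convex_cone_hull)
  fix x y z assume x: "x \<in> convex_cone hull G" and y: "y \<in> convex_cone hull G"
    and z: "z \<in> convex_cone hull {g}" "z \<in> open_segment x y"
  obtain a where a: "\<forall>h\<in>G. 0 \<le> a h" "x = (\<Sum>h\<in>G. a h *\<^sub>R h)"
    using x mem_convex_cone_hull_finite[OF fin] by blast
  obtain b where b: "\<forall>h\<in>G. 0 \<le> b h" "y = (\<Sum>h\<in>G. b h *\<^sub>R h)"
    using y mem_convex_cone_hull_finite[OF fin] by blast
  obtain c where c: "0 \<le> c" "z = c *\<^sub>R g"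
    using z(1) mem_convex_cone_hull_finite[of "{g}" z] by auto
  obtain t where t: "0 < t" "t < 1" "z = (1 - t) *\<^sub>R x + t *\<^sub>R y"
    using z(2) by (auto simp: in_segment)
  define e where "e h = (1 - t) * a h + t * b h" for h
  have e_nonneg: "0 \<le> e h" if "h \<in> G" for h
    using that a b t by (auto simp: e_def)
  have "z = (\<Sum>h\<in>G. e h *\<^sub>R h)"
    by (simp add: t a b e_def scaleR_sum_right scaleR_left_distrib sum.distrib)
  then have z_eq: "c *\<^sub>R g = e g *\<^sub>R g + (\<Sum>h\<in>G - {g}. e h *\<^sub>R h)"
    using fin g by (simp add: c sum.remove)
  have rest: "(\<Sum>h\<in>F. e h *\<^sub>R h) \<in> convex_cone hull F" if "F \<subseteq> G" for F
    using that e_nonneg mem_convex_cone_hull_finite[of F] finite_subset[OF that fin] by blast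
  have "c \<le> e g"
  proof (rule ccontr)
    assume "\<not> c \<le> e g"
    moreover have "(c - e g) *\<^sub>R g = (\<Sum>h\<in>G - {g}. e h *\<^sub>R h)"
      using z_eq by (simp add: algebra_simps)
    ultimately have "g = (1 / (c - e g)) *\<^sub>R (\<Sum>h\<in>G - {g}. e h *\<^sub>R h)"
      by (simp flip: \<open>(c - e g) *\<^sub>R g = _\<close>)
    also have "\<dots> \<in> convex_cone hull (G - {g})"
      using rest[of "G - {g}"] \<open>\<not> c \<le> e g\<close> by (intro convex_cone_hull_mul) auto
    finally show False using minimal by blast
  qed
  have e0: "e h *\<^sub>R h = 0" if h: "h \<in> G - {g}" for h
  proof (rule strong)
    show "e h *\<^sub>R h \<in> convex_cone hull G"
      using h e_nonneg by (intro convex_cone_hull_mul hull_inc) auto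
    have "- (e h *\<^sub>R h) = (e g - c) *\<^sub>R g + (\<Sum>h\<in>G - {g} - {h}. e h *\<^sub>R h)"
      using z_eq h fin by (simp add: sum.remove[of "G - {g}" h] algebra_simps eq_neg_iff_add_eq_0)
    also have "\<dots> \<in> convex_cone hull G"
      using \<open>c \<le> e g\<close> g rest[of "G - {g} - {h}"] hull_mono[of "G - {g} - {h}" G convex_cone]
      by (intro convex_cone_hull_add convex_cone_hull_mul) (auto intro: hull_inc)
    finally show "- (e h *\<^sub>R h) \<in> convex_cone hull G" .
  qed
  have ab0: "a h *\<^sub>R h = 0 \<and> b h *\<^sub>R h = 0" if h: "h \<in> G - {g}" for h
  proof (cases "h = 0")
    case False
    then have "(1 - t) * a h + t * b h = 0"
      using e0[OF h] by (simp add: e_def)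
    moreover have "0 \<le> (1 - t) * a h" "0 \<le> t * b h"
      using h a b t by auto
    ultimately have "(1 - t) * a h = 0" "t * b h = 0"
      by linarith+
    then show ?thesis
      using t by auto
  qed auto
  have "x = a g *\<^sub>R g" "y = b g *\<^sub>R g"
  proof -
    have "(\<Sum>h\<in>G - {g}. a h *\<^sub>R h) = 0" "(\<Sum>h\<in>G - {g}. b h *\<^sub>R h) = 0"
      using ab0 by (simp_all add: sum.neutral)
    then show "x = a g *\<^sub>R g" "y = b g *\<^sub>R g"
      using fin g by (simp_all add: a b sum.remove)
  qed
  then show "x \<in> convex_cone hull {g}" "y \<in> convex_cone hull {g}"
    using a b g by (auto intro: scaleR_mem_convex_cone_hull_singleton)
qed

lemma ex_minimal_generators:
  assumes "finite (G :: 'a::real_vector set)"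
  shows "\<exists>F\<subseteq>G. convex_cone hull F = convex_cone hull G \<and> (\<forall>g\<in>F. g \<notin> convex_cone hull (F - {g}))"
  using assms
proof (induction "card G" arbitrary: G rule: less_induct)
  case less
  show ?case
  proof (cases "\<exists>g\<in>G. g \<in> convex_cone hull (G - {g})")
    case True
    then obtain g where g: "g \<in> G" "g \<in> convex_cone hull (G - {g})" by blast
    then have "convex_cone hull (G - {g}) = convex_cone hull G"
      by (metis hull_redundant insert_Diff)
    moreover obtain F where "F \<subseteq> G - {g}" "convex_cone hull F = convex_cone hull (G - {g})"
      "\<forall>g\<in>F. g \<notin> convex_cone hull (F - {g})"
      using less.hyps[of "G - {g}"] less.prems g card_Diff1_less[of G g] by blast
    ultimately show ?thesis by auto
  qed auto
qed

lemma ex_primitive: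
  assumes "(g :: int ^ 'n) \<noteq> 0"
  shows "\<exists>v c. primitive_vec v \<and> c > 0 \<and> rvec g = c *\<^sub>R rvec v"
proof -
  define d where "d = Gcd (range (($) g))"
  define v :: "int ^ 'n" where "v = (\<chi> i. g $ i div d)"
  have dvd: "d dvd g $ i" for i
    unfolding d_def by (intro Gcd_dvd) auto
  have "d \<noteq> 0"
    using assms by (auto simp: vec_eq_iff d_def)
  moreover have "d \<ge> 0"
    by (simp add: d_def)
  ultimately have d: "d > 0"
    by linarith
  have g: "g $ i = d * v $ i" for i
    using dvd[of i] by (simp add: v_def)
  have "range (($) g) = (*) d ` range (($) v)"
    unfolding image_image g ..
  then have "d = normalize (d * Gcd (range (($) v)))"
    by (metis Gcd_mult d_def)
  also have "\<dots> = d * Gcd (range (($) v))"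
    using d by (simp add: abs_mult)
  finally have "primitive_vec v"
    using d by (simp add: primitive_vec_def)
  moreover have "rvec g = of_int d *\<^sub>R rvec v"
    unfolding vec_eq_iff vector_scaleR_component rvec_nth g by simp
  ultimately show ?thesis
    using d by (intro exI[of _ v] exI[of _ "of_int d"]) auto
qed

lemma convex_cone_hull_scale_singleton:
  fixes g :: "'a::real_vector"
  assumes "c > 0"
  shows "convex_cone hull {c *\<^sub>R g} = convex_cone hull {g}"
proof (rule antisym; rule hull_minimal; (rule convex_cone_convex_cone_hull)?; safe)
  show "c *\<^sub>R g \<in> convex_cone hull {g}"
    using assms by (intro scaleR_mem_convex_cone_hull_singleton) auto
  have "(1 / c) *\<^sub>R c *\<^sub>R g \<in> convex_cone hull {c *\<^sub>R g}"
    using assms by (intro scaleR_mem_convex_cone_hull_singleton) auto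
  then show "g \<in> convex_cone hull {c *\<^sub>R g}"
    using assms by simp
qed

lemma fan_coneE:
  assumes "fan \<Delta>" "\<sigma> \<in> \<Delta>"
  obtains G :: "(int ^ 'n) set" where "finite G" "(\<sigma> :: (real ^ 'n) set) = convex_cone hull (rvec ` G)"
    and "\<And>x. x \<in> \<sigma> \<Longrightarrow> - x \<in> \<sigma> \<Longrightarrow> x = 0"
proof -
  have "fan_cone \<sigma>"
    using assms by (simp add: fan_def)
  then show thesis
    using that unfolding fan_cone_def by metis
qed

text \<open>\<open>div_polytope\<close> and \<open>local_datum\<close> speak only about ray
  generators; this transports their information to whole cones. Each nonzero member of a minimal
  generating set spans a face, and faces of cones of the fan belong to the fan, so its primitive
  multiple is a ray generator.\<close>

lemma fan_cone_generated_by_rays: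
  assumes fan: "fan \<Delta>" and \<sigma>: "\<sigma> \<in> \<Delta>"
  shows "\<sigma> = convex_cone hull (rvec ` {v \<in> ray_gens \<Delta>. rvec v \<in> \<sigma>})"
proof
  obtain G :: "(int ^ 'a) set" where G: "finite G" "\<sigma> = convex_cone hull (rvec ` G)"
    and strong: "\<And>x. x \<in> \<sigma> \<Longrightarrow> - x \<in> \<sigma> \<Longrightarrow> x = 0"
    using fan_coneE[OF assms] by metis
  let ?H = "convex_cone hull (rvec ` {v \<in> ray_gens \<Delta>. rvec v \<in> \<sigma>})"
  obtain F where F: "F \<subseteq> rvec ` G" "convex_cone hull F = \<sigma>" "\<forall>g\<in>F. g \<notin> convex_cone hull (F - {g})"
    using ex_minimal_generators[of "rvec ` G"] G by auto
  have finF: "finite F"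
    using F(1) G(1) finite_surj by blast
  have "g \<in> ?H" if "g \<in> F" for g
  proof (cases "g = 0")
    case True
    then show ?thesis by (simp add: convex_cone_hull_contains_0)
  next
    case False
    obtain w where w: "g = rvec w"
      using \<open>g \<in> F\<close> F(1) by blast
    then have "w \<noteq> 0"
      using False by auto
    then obtain v c where v: "primitive_vec v" "c > 0" "rvec w = c *\<^sub>R rvec v"
      using ex_primitive[of w] by blast
    have face: "convex_cone hull {g} face_of \<sigma>"
      unfolding F(2)[symmetric]
      by (rule ray_face_of_cone[OF finF _ that False]) (use strong F that in auto)
    then have "convex_cone hull {g} \<subseteq> \<sigma>"
      by (rule face_of_imp_subset)
    moreover have "\<forall>\<sigma>\<in>\<Delta>. \<forall>\<tau>. \<tau> face_of \<sigma> \<and> \<tau> \<noteq> {} \<longrightarrow> \<tau> \<in> \<Delta>"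
      using fan by (simp add: fan_def)
    then have "convex_cone hull {g} \<in> \<Delta>"
      using face \<sigma> convex_cone_hull_nonempty by metis
    moreover have "convex_cone hull {g} = convex_cone hull {rvec v}"
      by (simp add: w v convex_cone_hull_scale_singleton)
    ultimately have "v \<in> ray_gens \<Delta>" "rvec v \<in> \<sigma>"
      using v hull_inc[of "rvec v" "{rvec v}" convex_cone] by (auto simp: ray_gens_def)
    then have "rvec v \<in> ?H"
      by (intro hull_inc) auto
    then show ?thesis
      unfolding w v by (rule convex_cone_hull_mul) (use v in auto)
  qed
  then show "\<sigma> \<subseteq> ?H"
    unfolding F(2)[symmetric] by (intro hull_minimal convex_cone_convex_cone_hull) auto
  show "?H \<subseteq> \<sigma>"
    unfolding G(2) by (intro hull_minimal convex_cone_convex_cone_hull) auto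
qed

section \<open>Consequences of very ampleness\<close>

lemma chart_point_in_variety:
  assumes "\<sigma> \<in> \<Delta>" "\<gamma> \<in> chart \<sigma>"
  shows "glue \<Delta> `` {(\<sigma>, \<gamma>)} \<in> toric_variety \<Delta>" and "(\<sigma>, \<gamma>) \<in> glue \<Delta> `` {(\<sigma>, \<gamma>)}"
proof -
  have pt: "(\<sigma>, \<gamma>) \<in> chart_points \<Delta>"
    using assms by (simp add: chart_points_def)
  then show "glue \<Delta> `` {(\<sigma>, \<gamma>)} \<in> toric_variety \<Delta>"
    unfolding toric_variety_def by (rule quotientI)
  have "\<gamma> = restrict \<gamma> (dual_semigroup \<sigma>)"
    using assms(2) by (simp add: chart_def extensional_restrict)
  then show "(\<sigma>, \<gamma>) \<in> glue \<Delta> `` {(\<sigma>, \<gamma>)}"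
    using pt assms(2) by (auto simp: glue_def intro!: bexI[of _ \<gamma>])
qed

text \<open>On the rays of the cone, \<open>m\<close> attains the bounds that define the polytope. A
  half-space through the origin is a convex cone, so the inequality spreads from the rays to their
  hull.\<close>

lemma inner_ge_on_cone:
  assumes fan: "fan \<Delta>" and \<sigma>: "\<sigma> \<in> \<Delta>" and m: "local_datum \<Delta> a \<sigma> m"
    and x: "x \<in> div_polytope \<Delta> a" and y: "y \<in> \<sigma>"
  shows "(x - rvec m) \<bullet> y \<ge> 0"
proof -
  have "convex_cone hull (rvec ` {v \<in> ray_gens \<Delta>. rvec v \<in> \<sigma>}) \<subseteq> {y. (x - rvec m) \<bullet> y \<ge> 0}"
    using m x by (intro hull_minimal convex_cone_halfspace_ge)
      (auto simp: local_datum_def div_polytope_def inner_diff_left)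
  then show ?thesis
    using fan_cone_generated_by_rays[OF fan \<sigma>] y by blast
qed

text \<open>The absence of base points is tested at the distinguished point of each chart, where the
  character \<open>\<chi>\<^sup>u\<close> takes the value \<open>1\<close> if \<open>u\<close> is orthogonal to the cone and \<open>0\<close> otherwise.\<close>

lemma local_datum_lattice_point:
  assumes fan: "fan \<Delta>" and cartier: "T_Cartier \<Delta> a" and \<sigma>: "\<sigma> \<in> \<Delta>"
    and base: "section_map \<Delta> a \<in> (toric_variety \<Delta> :: ((real ^ 'n) set \<times> (int ^ 'n \<Rightarrow> 'k::field)) set set)
                 \<rightarrow> proj_space (lattice_points (div_polytope \<Delta> a))"
  shows "\<exists>u\<in>lattice_points (div_polytope \<Delta> a). local_datum \<Delta> a \<sigma> u"
proof -
  let ?L = "lattice_points (div_polytope \<Delta> a)"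
  obtain m where m: "local_datum \<Delta> a \<sigma> m"
    using cartier \<sigma> by (auto simp: T_Cartier_def)
  define perp where "perp u \<longleftrightarrow> (\<forall>x\<in>\<sigma>. rvec u \<bullet> x = 0)" for u
  define \<gamma> :: "int ^ 'n \<Rightarrow> 'k" where
    "\<gamma> = restrict (\<lambda>u. if perp u then 1 else 0) (dual_semigroup \<sigma>)"
  \<comment> \<open>A sum of two nonnegative pairings vanishes only if both do; this makes
    \<open>\<gamma>\<close> multiplicative.\<close>
  have perp_add: "perp (u + w) \<longleftrightarrow> perp u \<and> perp w" if "u \<in> dual_semigroup \<sigma>" "w \<in> dual_semigroup \<sigma>" for u w
    using that by (auto simp: perp_def dual_semigroup_def inner_add_left add_nonneg_eq_0_iff)
  have add: "u + w \<in> dual_semigroup \<sigma>" if "u \<in> dual_semigroup \<sigma>" "w \<in> dual_semigroup \<sigma>" for u w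
    using that by (auto simp: dual_semigroup_def inner_add_left)
  have "0 \<in> dual_semigroup \<sigma>" "perp 0"
    by (auto simp: dual_semigroup_def perp_def)
  then have \<gamma>: "\<gamma> \<in> chart \<sigma>"
    unfolding chart_def using perp_add add by (auto simp: \<gamma>_def)
  let ?x = "glue \<Delta> `` {(\<sigma>, \<gamma>)}"
  have "section_map \<Delta> a ?x \<in> proj_space ?L"
    using base chart_point_in_variety(1)[OF \<sigma> \<gamma>] by blast
  moreover have "(\<lambda>u\<in>?L. 1 * \<gamma> (u - m)) \<in> section_map \<Delta> a ?x"
    unfolding section_map_def using m chart_point_in_variety(2)[OF \<sigma> \<gamma>]
    by (intro CollectI exI[of _ 1] exI[of _ \<sigma>] exI[of _ \<gamma>] exI[of _ m]) auto
  ultimately obtain u where u: "u \<in> ?L" "\<gamma> (u - m) \<noteq> 0"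
    unfolding proj_space_def line_of_def
    by (force simp: fun_eq_iff restrict_def split: if_splits)
  have "u - m \<in> dual_semigroup \<sigma>"
    using inner_ge_on_cone[OF fan \<sigma> m] u(1) by (auto simp: dual_semigroup_def lattice_points_def)
  then have "perp (u - m)"
    using u(2) by (auto simp: \<gamma>_def split: if_splits)
  \<comment> \<open>A nonvanishing section \<open>u\<close> differs from the datum \<open>m\<close>
    by a character orthogonal to the cone, hence takes the same values on its rays.\<close>
  then have "local_datum \<Delta> a \<sigma> u"
    using m by (auto simp: local_datum_def perp_def inner_diff_left)
  then show ?thesis
    using u(1) by blast
qed

text \<open>Each cone has a local datum \<open>u \<sigma>\<close> that is a lattice point of the
  polytope. A functional separating a point of the polytope from the hull of these data would lie in
  some cone \<sigma>, by completeness; but \<open>u \<sigma>\<close> minimizes on the polytope every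
  functional in \<sigma>. The same inclusion makes the polytope bounded.\<close>

lemma div_polytope_eq_hull:
  assumes complete: "complete_fan \<Delta>" and cartier: "T_Cartier \<Delta> a"
    and base: "section_map \<Delta> a \<in> (toric_variety \<Delta> :: ((real ^ 'n) set \<times> (int ^ 'n \<Rightarrow> 'k::field)) set set)
                 \<rightarrow> proj_space (lattice_points (div_polytope \<Delta> a))"
  shows "finite (lattice_points (div_polytope \<Delta> a))"
    and "div_polytope \<Delta> a = convex hull (rvec ` lattice_points (div_polytope \<Delta> a))"
proof -
  let ?P = "div_polytope \<Delta> a"
  let ?L = "lattice_points ?P"
  have fan: "fan \<Delta>" and UN: "\<Union>\<Delta> = UNIV"
    using complete by (auto simp: complete_fan_def)
  then have fin: "finite \<Delta>"
    by (simp add: fan_def)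
  obtain u where u: "\<And>\<sigma>. \<sigma> \<in> \<Delta> \<Longrightarrow> u \<sigma> \<in> ?L" "\<And>\<sigma>. \<sigma> \<in> \<Delta> \<Longrightarrow> local_datum \<Delta> a \<sigma> (u \<sigma>)"
    using local_datum_lattice_point[OF fan cartier _ base] by metis
  have sub: "?P \<subseteq> convex hull (rvec ` u ` \<Delta>)"
  proof (rule ccontr)
    assume "\<not> ?thesis"
    then obtain x where x: "x \<in> ?P" "x \<notin> convex hull (rvec ` u ` \<Delta>)" by blast
    have "closed (convex hull (rvec ` u ` \<Delta>))"
      using fin by (intro compact_imp_closed finite_imp_compact_convex_hull) auto
    then obtain y b where y: "y \<bullet> x < b" "\<forall>z\<in>convex hull (rvec ` u ` \<Delta>). b < y \<bullet> z"
      using separating_hyperplane_closed_point[OF convex_convex_hull _ x(2)] by blast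
    obtain \<sigma> where \<sigma>: "\<sigma> \<in> \<Delta>" "y \<in> \<sigma>"
      using UN by blast
    then have "b < y \<bullet> rvec (u \<sigma>)"
      using y(2) by (simp add: hull_inc)
    moreover have "(x - rvec (u \<sigma>)) \<bullet> y \<ge> 0"
      using inner_ge_on_cone[OF fan \<sigma>(1) u(2) x(1) \<sigma>(2)] \<sigma> by blast
    ultimately show False
      using y(1) by (simp add: inner_diff_left inner_diff_right inner_commute)
  qed
  have "convex ?P"
  proof -
    have "?P = (\<Inter>v\<in>ray_gens \<Delta>. {x. rvec v \<bullet> x \<ge> - of_int (a v)})"
      by (auto simp: div_polytope_def inner_commute)
    then show ?thesis
      by (simp add: convex_INT convex_halfspace_ge)
  qed
  then have "convex hull (rvec ` ?L) \<subseteq> ?P"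
    by (intro hull_minimal) (auto simp: lattice_points_def)
  moreover have "convex hull (rvec ` u ` \<Delta>) \<subseteq> convex hull (rvec ` ?L)"
    using u(1) by (intro hull_mono) auto
  ultimately show "?P = convex hull (rvec ` ?L)"
    using sub by blast
  have "bounded (convex hull (rvec ` u ` \<Delta>))"
    using fin by (intro compact_imp_bounded finite_imp_compact_convex_hull) auto
  then show "finite ?L"
    unfolding lattice_points_def using bounded_subset[OF _ sub] by (intro finite_bounded_int_vec)
qed

text \<open>Strong convexity makes the origin a face of every cone of the fan. The chart of this
  face is the torus.\<close>

lemma zero_cone_in_fan:
  assumes fan: "fan \<Delta>"
  shows "{0} \<in> \<Delta>"
proof -
  obtain \<sigma> where \<sigma>: "\<sigma> \<in> \<Delta>"
    using fan by (auto simp: fan_def)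
  then obtain G :: "(int ^ 'a) set" where G: "\<sigma> = convex_cone hull (rvec ` G)"
    and strong: "\<And>x. x \<in> \<sigma> \<Longrightarrow> - x \<in> \<sigma> \<Longrightarrow> x = 0"
    using fan_coneE[OF fan \<sigma>] by metis
  have "x = 0 \<and> y = 0" if xy: "x \<in> \<sigma>" "y \<in> \<sigma>" "0 \<in> open_segment x y" for x y
  proof -
    obtain t where t: "0 < t" "t < 1" "0 = (1 - t) *\<^sub>R x + t *\<^sub>R y"
      using xy(3) by (auto simp: in_segment)
    have "(1 - t) *\<^sub>R x \<in> \<sigma>" "t *\<^sub>R y \<in> \<sigma>"
      using xy t unfolding G by (auto intro: convex_cone_hull_mul)
    moreover have "- ((1 - t) *\<^sub>R x) = t *\<^sub>R y" "- (t *\<^sub>R y) = (1 - t) *\<^sub>R x"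
      using t(3) by (simp_all add: eq_neg_iff_add_eq_0 minus_equation_iff neg_eq_iff_add_eq_0 add.commute)
    ultimately have "(1 - t) *\<^sub>R x = 0" "t *\<^sub>R y = 0"
      using strong by metis+
    then show ?thesis using t by simp
  qed
  then have "{0} face_of \<sigma>"
    unfolding face_of_def using G convex_cone_hull_contains_0 by auto
  then show ?thesis
    using fan \<sigma> unfolding fan_def by blast
qed

lemma prod_single:
  "(\<Prod>u\<in>A. Poly_Mapping.single (g u) (1 :: 'k::comm_ring_1)) = Poly_Mapping.single (\<Sum>u\<in>A. g u :: 'a::comm_monoid_add) 1"
  by (induction A rule: infinite_finite_induct) (auto simp: mult_single)

lemma ex_list_of_multiplicities:
  assumes "finite A"
  shows "\<exists>xs. set xs \<subseteq> A \<and> length xs = (\<Sum>u\<in>A. n u) \<and> sum_list xs = (\<Sum>u\<in>A. \<Sum>i<n u. u :: 'a::comm_monoid_add)"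
  using assms
proof (induction A rule: finite_induct)
  case (insert u A)
  then obtain xs where "set xs \<subseteq> A" "length xs = (\<Sum>u\<in>A. n u)" "sum_list xs = (\<Sum>u\<in>A. \<Sum>i<n u. u)" by blast
  moreover have "sum_list (replicate k u) = (\<Sum>i<k. u)" for k
    by (induction k) (auto simp: add.commute)
  ultimately show ?case
    using insert.hyps by (intro exI[of _ "replicate (n u) u @ xs"]) (auto simp: set_replicate_conv_if)
qed auto

text \<open>Substituting characters into a monomial of degree \<open>e\<close> yields the character
  of a sum of \<open>e\<close> lattice points. Different monomials may cancel, so only an inclusion
  of exponents is claimed.\<close>

lemma keys_pullback_zero:
  assumes F: "homogeneous L e F" and w: "w \<in> Poly_Mapping.keys (pullback 0 F)"
  shows "\<exists>xs. set xs \<subseteq> L \<and> length xs = e \<and> sum_list xs = w"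
proof -
  have "pullback 0 F = (\<Sum>t\<in>Poly_Mapping.keys F.
      Poly_Mapping.single (\<Sum>u\<in>Poly_Mapping.keys t. \<Sum>i<Poly_Mapping.lookup t u. u) (Poly_Mapping.lookup F t))"
    by (simp add: pullback_def poly_subst_def single_power prod_single mult_single)
  then obtain t where t: "t \<in> Poly_Mapping.keys F"
    and w: "w = (\<Sum>u\<in>Poly_Mapping.keys t. \<Sum>i<Poly_Mapping.lookup t u. u)"
    using w keys_sum[of "\<lambda>t. Poly_Mapping.single (\<Sum>u\<in>Poly_Mapping.keys t. \<Sum>i<Poly_Mapping.lookup t u. u)
       (Poly_Mapping.lookup F t)" "Poly_Mapping.keys F"]
    by (auto split: if_splits)
  then show ?thesis
    using F ex_list_of_multiplicities[OF finite_keys, of t "Poly_Mapping.lookup t"]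
    unfolding homogeneous_def by (metis subset_trans)
qed

text \<open>Surjectivity on the stalk at the unit of the torus, applied to the regular function \<open>\<chi>\<^sup>w\<close>.\<close>

lemma lattice_generated:
  assumes fan: "fan \<Delta>" and surj: "surjective_on_stalks TYPE('k::field) (\<Delta> :: (real ^ 'n) set set) a"
  shows "\<exists>xs ys. set xs \<subseteq> lattice_points (div_polytope \<Delta> a) \<and> set ys \<subseteq> lattice_points (div_polytope \<Delta> a) \<and>
           length xs = length ys \<and> w = sum_list xs - sum_list ys"
proof -
  define \<gamma> :: "int ^ 'n \<Rightarrow> 'k" where "\<gamma> = (\<lambda>_. 1)"
  have dual: "dual_semigroup {0} = (UNIV :: (int ^ 'n) set)"
    by (auto simp: dual_semigroup_def)
  have \<gamma>: "\<gamma> \<in> chart {0}"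
    by (simp add: chart_def dual \<gamma>_def)
  note x = chart_point_in_variety[OF zero_cone_in_fan[OF fan] \<gamma>]
  \<comment> \<open>The condition is vacuous: a primitive vector is not zero, so the zero cone
    contains no ray generator.\<close>
  have "local_datum \<Delta> a {0} 0"
    unfolding local_datum_def
  proof (intro ballI impI)
    fix v assume "v \<in> ray_gens \<Delta>" "rvec v \<in> {0}"
    moreover from this have "v = 0"
      by (metis rvec_eq_iff rvec_simps(1) singletonD)
    ultimately show "rvec 0 \<bullet> rvec v = - real_of_int (a v)"
      by (simp add: ray_gens_def primitive_vec_def)
  qed
  moreover have "Poly_Mapping.single w 1 \<in> chart_ring {0}" "(1 :: (int ^ 'n) \<Rightarrow>\<^sub>0 'k) \<in> chart_ring {0}"
    by (auto simp: chart_ring_def dual)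
  moreover have "eval_at 1 \<gamma> \<noteq> 0"
    by (simp add: eval_at_def \<gamma>_def)
  ultimately obtain e F G where FG: "homogeneous (lattice_points (div_polytope \<Delta> a)) e F"
    "homogeneous (lattice_points (div_polytope \<Delta> a)) e G"
    "eval_at (pullback 0 G) \<gamma> \<noteq> 0" "Poly_Mapping.single w 1 * pullback 0 G = pullback 0 F * (1 :: _ \<Rightarrow>\<^sub>0 'k)"
    using surj x unfolding surjective_on_stalks_def by blast
  \<comment> \<open>The pullback of \<open>G\<close> is nonzero because its value is. Any exponent
    \<open>g\<close> in it has the form \<open>f - w\<close> with \<open>f\<close> in the pullback
    of \<open>F\<close>, and both \<open>f\<close> and \<open>g\<close> are sums of \<open>e\<close>
    lattice points.\<close>
  have G_eq: "pullback 0 G = Poly_Mapping.single (- w) 1 * pullback 0 F"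
    using arg_cong[OF FG(4), of "\<lambda>f. Poly_Mapping.single (- w) 1 * f"]
    by (simp add: mult_single flip: mult.assoc)
  obtain g where g: "g \<in> Poly_Mapping.keys (pullback 0 G)"
    using FG(3) unfolding eval_at_def by (metis ex_in_conv sum.empty)
  then obtain f where f: "f \<in> Poly_Mapping.keys (pullback 0 F)" "g = - w + f"
    using keys_mult[of "Poly_Mapping.single (- w) (1 :: 'k)" "pullback 0 F"] unfolding G_eq by auto
  obtain xs ys where "set xs \<subseteq> lattice_points (div_polytope \<Delta> a)" "length xs = e" "sum_list xs = f"
    "set ys \<subseteq> lattice_points (div_polytope \<Delta> a)" "length ys = e" "sum_list ys = g"
    using keys_pullback_zero[OF FG(1) f(1)] keys_pullback_zero[OF FG(2) g] by blast
  then show ?thesis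
    using f(2) by (intro exI[of _ xs] exI[of _ ys]) auto
qed

section \<open>The semigroup and the cone of a lattice polytope\<close>

definition emb :: "(int ^ 'n) \<times> int \<Rightarrow> (real ^ 'n) \<times> real" where
  "emb s = (rvec (fst s), of_int (snd s))"

lemma emb_simps [simp]: "emb 0 = 0" "emb (s + t) = emb s + emb t" "emb (s - t) = emb s - emb t"
  by (simp_all add: emb_def zero_prod_def)

lemma emb_sum: "emb (sum f A) = (\<Sum>x\<in>A. emb (f x))"
  by (induction A rule: infinite_finite_induct) auto

lemma emb_eq_iff [simp]: "emb s = emb t \<longleftrightarrow> s = t"
  by (auto simp: emb_def prod_eq_iff)

lemma snd_emb [simp]: "snd (emb s) = of_int (snd s)"
  by (simp add: emb_def)

lemma inj_emb: "inj emb"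
  by (simp add: inj_def)

lemma emb_in_integer_points [simp]: "emb s \<in> integer_points"
  by (auto simp: integer_points_def Basis_prod_def emb_def Basis_vec_def inner_axis)

lemma integer_points_embE:
  assumes "z \<in> integer_points"
  obtains s where "z = emb s"
proof -
  have "fst z \<in> integer_points" "snd z \<in> \<int>"
    using assms by (auto simp: integer_points_def Basis_prod_def inner_prod_def)
  then obtain u k where "fst z = rvec u" "snd z = of_int k"
    by (metis Ints_cases integer_points_rvecE)
  then show thesis
    using that[of "(u, k)"] by (simp add: emb_def prod_eq_iff)
qed

text \<open>Trims multiplicities to a total of exactly \<open>k\<close>, the degree of the
  generators of the \<open>k\<close>-th power of the maximal ideal.\<close>

lemma ex_smaller_multiplicities:
  assumes "finite A" "k \<le> (\<Sum>u\<in>A. m u)"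
  shows "\<exists>m'. (\<forall>u. m' u \<le> m u) \<and> (\<Sum>u\<in>A. m' u) = (k :: nat)"
  using assms(2)
proof (induction k)
  case 0
  then show ?case by (intro exI[of _ "\<lambda>_. 0"]) auto
next
  case (Suc k)
  then obtain m' where m': "\<forall>u. m' u \<le> m u" "(\<Sum>u\<in>A. m' u) = k" by auto
  obtain u where u: "u \<in> A" "m' u < m u"
    using Suc.prems m' sum_mono[of A m m'] by (metis not_less Suc_n_not_le_n order_trans)
  have "(\<Sum>v\<in>A. (m'(u := Suc (m' u))) v) = Suc k"
    using m'(2) assms(1) u(1) by (simp add: sum.remove[of A u])
  then show ?case
    using m'(1) u(2) by (intro exI[of _ "m'(u := Suc (m' u))"]) auto
qed

text \<open>What the rest of the proof retains of the toric variety. Equal lengths in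
  \<open>generated\<close> mean that the differences of lattice points of the polytope generate the
  lattice, so that \<open>w\<close> is reached in degree 0.\<close>

locale lattice_polytope =
  fixes P :: "(real ^ 'n) set"
  assumes finite_lattice_points: "finite (lattice_points P)"
    and polytope_eq_hull: "P = convex hull (rvec ` lattice_points P)"
    and generated: "\<And>w. \<exists>xs ys. set xs \<subseteq> lattice_points P \<and> set ys \<subseteq> lattice_points P \<and>
           length xs = length ys \<and> w = sum_list xs - sum_list ys"
begin

abbreviation L :: "(int ^ 'n) set" where "L \<equiv> lattice_points P"
abbreviation S :: "((int ^ 'n) \<times> int) set" where "S \<equiv> coord_semigroup P"
abbreviation C :: "((real ^ 'n) \<times> real) set" where "C \<equiv> poly_cone P"

text \<open>The semigroup in the coordinates of \<open>mem_cone_iff_sum\<close>, with natural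
  numbers in place of nonnegative reals; rounding coefficients down passes from the cone to the
  semigroup.\<close>

definition comb :: "(int ^ 'n \<Rightarrow> nat) \<Rightarrow> (int ^ 'n) \<times> int" where
  "comb n = (\<Sum>u\<in>L. \<Sum>i<n u. (u, 1))"

lemma L_nonempty: "L \<noteq> {}"
proof
  assume "L = {}"
  with generated[of "\<chi> i. 1"] have "(\<chi> i. (1 :: int)) = (0 :: int ^ 'n)"
    by simp
  then show False by (simp add: vec_eq_iff)
qed

lemma P_nonempty: "P \<noteq> {}"
  using L_nonempty by (auto simp: lattice_points_def)

lemma compact_P: "compact P"
  by (subst polytope_eq_hull) (intro finite_imp_compact_convex_hull finite_imageI finite_lattice_points)

lemma convex_P: "convex P"
  by (subst polytope_eq_hull) (rule convex_convex_hull)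

lemma poly_cone_eq_hull: "C = convex_cone hull ((\<lambda>u. (rvec u, 1)) ` L)"
proof -
  have "P \<times> {1} = convex hull (rvec ` L \<times> {1 :: real})"
    by (subst polytope_eq_hull) (simp add: convex_hull_Times)
  also have "rvec ` L \<times> {1 :: real} = (\<lambda>u. (rvec u, 1)) ` L"
    by auto
  finally have eq: "P \<times> {1} = convex hull ((\<lambda>u. (rvec u, 1 :: real)) ` L)" .
  show ?thesis
    unfolding poly_cone_def eq
  proof (rule antisym)
    show "convex_cone hull (convex hull ((\<lambda>u. (rvec u, 1 :: real)) ` L)) \<subseteq> convex_cone hull ((\<lambda>u. (rvec u, 1)) ` L)"
      by (intro hull_minimal convex_hull_subset_convex_cone_hull convex_cone_convex_cone_hull)
    show "convex_cone hull ((\<lambda>u. (rvec u, 1)) ` L) \<subseteq> convex_cone hull (convex hull ((\<lambda>u. (rvec u, 1 :: real)) ` L))"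
      by (intro hull_mono hull_subset)
  qed
qed

lemma mem_cone_iff_sum:
  "x \<in> C \<longleftrightarrow> (\<exists>c. (\<forall>u\<in>L. 0 \<le> c u) \<and> x = (\<Sum>u\<in>L. c u *\<^sub>R (rvec u, 1)))"
proof -
  have inj: "inj_on (\<lambda>u. (rvec u, 1 :: real)) L"
    by (simp add: inj_on_def)
  have "x \<in> C \<longleftrightarrow> (\<exists>c. (\<forall>u\<in>L. 0 \<le> c (rvec u, 1 :: real)) \<and> x = (\<Sum>u\<in>L. c (rvec u, 1) *\<^sub>R (rvec u, 1)))"
    unfolding poly_cone_eq_hull
    by (subst mem_convex_cone_hull_finite) (simp_all add: finite_lattice_points sum.reindex[OF inj])
  also have "\<dots> \<longleftrightarrow> (\<exists>c. (\<forall>u\<in>L. 0 \<le> c u) \<and> x = (\<Sum>u\<in>L. c u *\<^sub>R (rvec u, 1)))"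
    (is "?l = ?r")
  proof
    assume ?r
    then obtain c where c: "\<forall>u\<in>L. 0 \<le> c u" "x = (\<Sum>u\<in>L. c u *\<^sub>R (rvec u, 1))" by blast
    define c' where "c' y = c (inv_into UNIV rvec (fst y))" for y :: "(real ^ 'n) \<times> real"
    have "c' (rvec u, 1) = c u" for u
      by (simp add: c'_def inv_f_f[OF inj_rvec])
    then show ?l
      using c by (intro exI[of _ c']) simp
  next
    assume ?l
    then obtain c where "\<forall>u\<in>L. 0 \<le> c (rvec u, 1 :: real)" "x = (\<Sum>u\<in>L. c (rvec u, 1) *\<^sub>R (rvec u, 1))"
      by blast
    then show ?r
      by (intro exI[of _ "\<lambda>u. c (rvec u, 1)"] conjI)
  qed
  finally show ?thesis .
qed

lemma mem_cone_iff: "(x, z) \<in> C \<longleftrightarrow> 0 \<le> z \<and> (\<exists>p\<in>P. x = z *\<^sub>R p)"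
proof -
  have "convex hull (P \<times> {1 :: real}) = P \<times> {1}"
    by (intro hull_same convex_Times convex_P) simp
  then have "C = (\<Union>x\<in>P \<times> {1}. \<Union>c\<in>{0..}. {c *\<^sub>R x})"
    unfolding poly_cone_def using P_nonempty by (subst convex_cone_hull_convex_hull_nonempty) auto
  then show ?thesis by auto
qed

lemma closed_cone: "closed C"
  unfolding poly_cone_eq_hull by (intro closed_convex_cone_hull finite_imageI finite_lattice_points)

lemma convex_cone: "convex C"
  unfolding poly_cone_def by (rule convex_convex_cone_hull)

lemma cone_scale: "x \<in> C \<Longrightarrow> 0 \<le> c \<Longrightarrow> c *\<^sub>R x \<in> C"
  unfolding poly_cone_def by (rule convex_cone_hull_mul)

section \<open>The semigroup as a standard graded monoid, and its position in the cone\<close>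

lemma zero_mem_S: "0 \<in> S"
  unfolding coord_semigroup_def by (auto intro!: exI[of _ "[]"])

lemma add_mem_S: "s \<in> S \<Longrightarrow> t \<in> S \<Longrightarrow> s + t \<in> S"
  unfolding coord_semigroup_def by clarsimp (metis le_sup_iff set_append sum_list_append)

lemma snd_sum_list_S: "set ws \<subseteq> L \<times> {1} \<Longrightarrow> snd (sum_list ws) = int (length ws)"
  by (induction ws) auto

sublocale standard_graded_submonoid S snd
proof
  show "0 \<in> S" "\<And>s t. s \<in> S \<Longrightarrow> t \<in> S \<Longrightarrow> s + t \<in> S"
    by (rule zero_mem_S, rule add_mem_S)
  show "0 \<le> snd s" if "s \<in> S" for s
    using that by (auto simp: coord_semigroup_def snd_sum_list_S)
  show "s = 0" if "s \<in> S" "snd s = 0" for s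
    using that by (auto simp: coord_semigroup_def snd_sum_list_S)
  show "\<exists>t\<in>S. \<exists>u\<in>S. s = t + u \<and> snd t = a" if s: "s \<in> S" and a: "0 \<le> a" "a \<le> snd s" for s a
  proof -
    obtain ws where ws: "s = sum_list ws" "set ws \<subseteq> L \<times> {1}"
      using s by (auto simp: coord_semigroup_def)
    let ?t = "take (nat a) ws" and ?u = "drop (nat a) ws"
    have sub: "set ?t \<subseteq> L \<times> {1}" "set ?u \<subseteq> L \<times> {1}"
      using ws(2) set_take_subset set_drop_subset by fast+
    have "s = sum_list ?t + sum_list ?u"
      by (simp add: ws(1) flip: sum_list_append)
    moreover have "snd (sum_list ?t) = a"
      using a ws sub by (simp add: snd_sum_list_S)
    moreover have "sum_list ?t \<in> S" "sum_list ?u \<in> S"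
      using sub unfolding coord_semigroup_def by blast+
    ultimately show ?thesis
      by blast
  qed
qed auto

lemma sum_mem_S: "(\<And>i. i \<in> A \<Longrightarrow> f i \<in> S) \<Longrightarrow> sum f A \<in> S"
  by (induction A rule: infinite_finite_induct) (auto simp: zero_mem_S add_mem_S)

lemma generator_mem_S: "u \<in> L \<Longrightarrow> (u, 1) \<in> S"
  unfolding coord_semigroup_def by (auto intro!: exI[of _ "[(u, 1)]"])

lemma comb_mem_S: "comb n \<in> S"
  unfolding comb_def by (intro sum_mem_S generator_mem_S)

lemma emb_comb: "emb (comb n) = (\<Sum>u\<in>L. real (n u) *\<^sub>R (rvec u, 1))"
  unfolding comb_def emb_sum by (simp add: emb_def sum_constant_scaleR)

lemma snd_comb: "snd (comb n) = (\<Sum>u\<in>L. int (n u))"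
  unfolding comb_def by (simp add: snd_sum)

lemma mem_S_iff_comb: "s \<in> S \<longleftrightarrow> (\<exists>n. s = comb n)"
proof
  assume "s \<in> S"
  then obtain ws where "s = sum_list ws" "set ws \<subseteq> L \<times> {1}"
    by (auto simp: coord_semigroup_def)
  then show "\<exists>n. s = comb n"
  proof (induction ws arbitrary: s)
    case Nil
    then show ?case by (auto simp: comb_def intro!: exI[of _ "\<lambda>_. 0"])
  next
    case (Cons w ws)
    then obtain n where n: "sum_list ws = comb n" by auto
    obtain u where u: "w = (u, 1)" "u \<in> L"
      using Cons.prems by auto
    have "comb (n(u := Suc (n u))) = w + comb n"
      unfolding comb_def using u finite_lattice_points by (simp add: sum.remove[of L u] algebra_simps)
    then show ?case
      using Cons.prems n by (metis sum_list.Cons)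
  qed
qed (auto simp: comb_mem_S)

lemma emb_mem_cone:
  assumes "s \<in> S"
  shows "emb s \<in> C"
proof -
  obtain n where "s = comb n"
    using assms mem_S_iff_comb by blast
  then show ?thesis
    unfolding mem_cone_iff_sum by (intro exI[of _ "\<lambda>u. real (n u)"]) (simp add: emb_comb del: scaleR_Pair)
qed

lemma cone_height_nonneg:
  assumes "x \<in> C" shows "0 \<le> snd x"
  using assms mem_cone_iff[of "fst x" "snd x"] by simp

text \<open>The slices are multiples of a compact polytope, so the height controls the norm. All
  boundedness statements about parts of the cone come from here.\<close>

lemma cone_norm_bound: "\<exists>B\<ge>0. \<forall>x\<in>C. norm x \<le> B * snd x"
proof -
  obtain B where B: "\<And>p. p \<in> P \<Longrightarrow> norm p \<le> B"
    using compact_imp_bounded[OF compact_P] by (auto simp: bounded_iff)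
  have "B \<ge> 0"
    using P_nonempty B norm_ge_zero order_trans by blast
  moreover have "norm (x, z) \<le> (B + 1) * z" if xz: "(x, z) \<in> C" for x z
  proof -
    obtain p where p: "p \<in> P" "x = z *\<^sub>R p" "0 \<le> z"
      using xz mem_cone_iff by blast
    have "norm (x, z) \<le> norm x + norm z"
      using sqrt_sum_squares_le_sum_abs[of "norm x" z] by (simp add: norm_Pair)
    also have "norm x \<le> z * B"
      using p B[OF p(1)] by (simp add: mult_left_mono)
    finally show ?thesis
      using p by (simp add: algebra_simps)
  qed
  ultimately show ?thesis
    by (intro exI[of _ "B + 1"]) auto
qed

lemma emb_sum_const: "emb (\<Sum>i<q. e) = real q *\<^sub>R emb e"
  by (simp add: emb_sum sum_constant_scaleR)

lemma finite_bounded_emb: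
  assumes "bounded A"
  shows "finite {s :: (int ^ 'n) \<times> int. emb s \<in> A}"
proof -
  have "emb ` {s. emb s \<in> A} \<subseteq> A \<inter> integer_points"
    by auto
  then have "finite (emb ` {s :: (int ^ 'n) \<times> int. emb s \<in> A})"
    using finite_bounded_integer_points[OF assms] by (rule finite_subset)
  then show ?thesis
    by (rule finite_imageD) (simp add: inj_on_def)
qed

text \<open>\<open>generated\<close> settles height 0. Another height is reduced to it by a multiple
  \<open>b\<close> of one generator, moved to the minuend or to the subtrahend according to the
  sign.\<close>

lemma difference_of_S: "\<exists>s\<in>S. \<exists>s'\<in>S. t = s - s'"
proof -
  have zero: "\<exists>s\<in>S. \<exists>s'\<in>S. (w, 0) = s - s'" for w
  proof -
    obtain xs ys where xy: "set xs \<subseteq> L" "set ys \<subseteq> L" "length xs = length ys" "w = sum_list xs - sum_list ys"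
      using generated by blast
    define lift where "lift zs = sum_list (map (\<lambda>u. (u, 1 :: int)) zs)" for zs :: "(int ^ 'n) list"
    have "lift zs = (sum_list zs, int (length zs))" for zs
      unfolding lift_def by (induction zs) (auto simp: zero_prod_def)
    then have "(w, 0) = lift xs - lift ys"
      using xy by simp
    moreover have "lift zs \<in> S" if "set zs \<subseteq> L" for zs
      using that unfolding lift_def coord_semigroup_def by (intro CollectI exI[of _ "map (\<lambda>u. (u, 1)) zs"]) auto
    ultimately show ?thesis
      using xy by blast
  qed
  obtain u0 where u0: "u0 \<in> L"
    using L_nonempty by blast
  define b where "b = (\<Sum>i<nat \<bar>snd t\<bar>. (u0, 1 :: int))"
  have b: "b \<in> S" "snd b = \<bar>snd t\<bar>"
    unfolding b_def using u0 by (auto intro!: sum_mem_S generator_mem_S simp: snd_sum)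
  show ?thesis
  proof (cases "snd t \<ge> 0")
    case True
    then have "t - b = (fst (t - b), 0)"
      using b by (simp add: prod_eq_iff)
    then obtain s s' where "s \<in> S" "s' \<in> S" "t - b = s - s'"
      using zero by metis
    then have "t = (s + b) - s'" "s + b \<in> S" "s' \<in> S"
      using b add_mem_S by (auto simp: algebra_simps eq_diff_eq)
    then show ?thesis by blast
  next
    case False
    then have "t + b = (fst (t + b), 0)"
      using b by (simp add: prod_eq_iff)
    then obtain s s' where "s \<in> S" "s' \<in> S" "t + b = s - s'"
      using zero by metis
    then have "t = s - (s' + b)" "s \<in> S" "s' + b \<in> S"
      using b add_mem_S by (auto simp: algebra_simps eq_diff_eq)
    then show ?thesis by blast
  qed
qed

text \<open>Up to the semigroup itself, the lattice points of the cone fall into finitely many classes,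
  represented by lattice points of the zonotope spanned by the generators.\<close>

lemma conductor: "\<exists>c\<in>S. \<forall>t. emb t \<in> C \<longrightarrow> c + t \<in> S"
proof -
  define B where "B = (\<Sum>u\<in>L. norm (rvec u, 1 :: real))"
  define F where "F = {t :: (int ^ 'n) \<times> int. emb t \<in> cball 0 B}"
  have finF: "finite F"
    unfolding F_def by (intro finite_bounded_emb bounded_cball)
  obtain s s' where s: "\<And>t. s t \<in> S" "\<And>t. s' t \<in> S" "\<And>t. t = s t - s' t"
    using difference_of_S by metis
  \<comment> \<open>Summing all subtrahends treats every \<open>t\<close> in \<open>F\<close> at
    once: in \<open>c + t\<close> the summand \<open>s' t\<close> is replaced by \<open>s t\<close>,
    and everything left is in \<open>S\<close>.\<close>
  define c where "c = (\<Sum>t\<in>F. s' t)"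
  have cF: "c + t \<in> S" if "t \<in> F" for t
  proof -
    have "c + t = (\<Sum>t\<in>F - {t}. s' t) + s t"
      unfolding c_def using finF that s(3)[of t] by (simp add: sum.remove[of F t] algebra_simps)
    then show ?thesis
      using s(1,2) by (simp add: add_mem_S sum_mem_S)
  qed
  have "c + t \<in> S" if t: "emb t \<in> C" for t
  proof -
    obtain a where a: "\<forall>u\<in>L. 0 \<le> a u" "emb t = (\<Sum>u\<in>L. a u *\<^sub>R (rvec u, 1))"
      using t mem_cone_iff_sum by blast
    define n where "n u = nat \<lfloor>a u\<rfloor>" for u
    have n: "real (n u) = of_int \<lfloor>a u\<rfloor>" if "u \<in> L" for u
      using a(1) that by (simp add: n_def)
    have "emb (t - comb n) = (\<Sum>u\<in>L. (a u - real (n u)) *\<^sub>R (rvec u, 1))"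
      by (simp add: a(2) emb_comb scaleR_diff_left sum_subtractf del: scaleR_Pair)
    also have "norm \<dots> \<le> B"
      unfolding B_def
    proof (rule sum_norm_le)
      fix u assume "u \<in> L"
      then have "\<bar>a u - real (n u)\<bar> \<le> 1"
        using n by (simp add: abs_le_iff) linarith
      then show "norm ((a u - real (n u)) *\<^sub>R (rvec u, 1 :: real)) \<le> norm (rvec u, 1 :: real)"
        by (simp only: norm_scaleR mult_left_le_one_le norm_ge_zero abs_ge_zero)
    qed
    finally have "t - comb n \<in> F"
      by (simp add: F_def)
    then have "c + (t - comb n) + comb n \<in> S"
      by (intro add_mem_S cF comb_mem_S)
    then show ?thesis by (simp add: algebra_simps)
  qed
  moreover have "c \<in> S"
    unfolding c_def using s by (intro sum_mem_S)
  ultimately show ?thesis by blast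
qed

text \<open>Rounding down the coefficients loses less than 1 for each of the \<open>card L\<close>
  generators, so the integral parts still have total at least \<open>k\<close> and can be trimmed to
  exactly \<open>k\<close>.\<close>

lemma cone_point_dominates:
  assumes x: "(x, real k + \<mu>) \<in> C" and \<mu>: "real (card L) \<le> \<mu>"
  shows "\<exists>e\<in>S. snd e = int k \<and> (x, real k + \<mu>) - emb e \<in> C"
proof -
  obtain a where a: "\<forall>u\<in>L. 0 \<le> a u" "(x, real k + \<mu>) = (\<Sum>u\<in>L. a u *\<^sub>R (rvec u, 1))"
    using x mem_cone_iff_sum by blast
  have sum_a: "(\<Sum>u\<in>L. a u) = real k + \<mu>"
    using arg_cong[OF a(2), of snd] by (simp add: snd_sum)
  have "real k \<le> (\<Sum>u\<in>L. a u - 1)"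
    using \<mu> sum_a by (simp add: sum_subtractf)
  also have "\<dots> \<le> (\<Sum>u\<in>L. real (nat \<lfloor>a u\<rfloor>))"
    by (rule sum_mono) linarith
  finally have "k \<le> (\<Sum>u\<in>L. nat \<lfloor>a u\<rfloor>)"
    by (simp flip: of_nat_sum)
  then obtain m where m: "\<forall>u. m u \<le> nat \<lfloor>a u\<rfloor>" "(\<Sum>u\<in>L. m u) = k"
    using ex_smaller_multiplicities[OF finite_lattice_points] by blast
  have "(x, real k + \<mu>) - emb (comb m) = (\<Sum>u\<in>L. (a u - real (m u)) *\<^sub>R (rvec u, 1))"
    unfolding a(2) emb_comb by (simp add: scaleR_diff_left sum_subtractf del: scaleR_Pair)
  moreover have "0 \<le> a u - real (m u)" if "u \<in> L" for u
    using a(1) m(1)[rule_format, of u] that by (simp add: le_nat_iff le_floor_iff)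
  ultimately have "(x, real k + \<mu>) - emb (comb m) \<in> C"
    unfolding mem_cone_iff_sum by (intro exI[of _ "\<lambda>u. a u - real (m u)"] conjI ballI)
  moreover have "snd (comb m) = int k"
    using m(2) by (simp add: snd_comb flip: of_nat_sum)
  ultimately show ?thesis
    using comb_mem_S by blast
qed

text \<open>The discrete counterpart of \<open>cone_point_dominates\<close>: division of the
  multiplicities by \<open>q\<close> loses a remainder below \<open>q\<close> for each generator. It
  makes the colengths of the Frobenius powers finite, with heights bounded linearly in
  \<open>q\<close>.\<close>

lemma semigroup_element_dominates:
  assumes s: "s \<in> S" and h: "int q * int (k + card L) \<le> snd s" and q: "q > 0"
  shows "\<exists>e\<in>S. snd e = int k \<and> (\<exists>s'\<in>S. s = (\<Sum>i<q. e) + s')"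
proof -
  obtain n where n: "s = comb n"
    using s mem_S_iff_comb by blast
  have "q * (k + card L) \<le> (\<Sum>u\<in>L. n u)"
    using h by (simp add: n snd_comb flip: of_nat_sum of_nat_mult of_nat_add)
  also have "\<dots> = (\<Sum>u\<in>L. q * (n u div q) + n u mod q)"
    by simp
  also have "\<dots> \<le> (\<Sum>u\<in>L. q * (n u div q) + q)"
    using q by (intro sum_mono add_left_mono less_imp_le mod_less_divisor)
  also have "\<dots> = q * ((\<Sum>u\<in>L. n u div q) + card L)"
    by (simp add: sum.distrib sum_distrib_left algebra_simps)
  finally have "k \<le> (\<Sum>u\<in>L. n u div q)"
    using q by simp
  then obtain m where m: "\<forall>u. m u \<le> n u div q" "(\<Sum>u\<in>L. m u) = k"
    using ex_smaller_multiplicities[OF finite_lattice_points] by blast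
  have qm: "q * m u \<le> n u" for u
    using m(1) q by (metis less_eq_div_iff_mult_less_eq mult.commute)
  have "emb s = emb ((\<Sum>i<q. comb m) + comb (\<lambda>u. n u - q * m u))"
    unfolding n emb_simps emb_sum_const emb_comb scaleR_sum_right sum.distrib[symmetric]
    by (intro sum.cong refl) (simp add: qm of_nat_diff flip: scaleR_left_distrib del: scaleR_Pair)
  then have "s = (\<Sum>i<q. comb m) + comb (\<lambda>u. n u - q * m u)"
    by (simp only: emb_eq_iff)
  moreover have "snd (comb m) = int k"
    using m(2) by (simp add: snd_comb flip: of_nat_sum)
  ultimately show ?thesis
    using comb_mem_S by blast
qed

end

section \<open>Multiplicities as volumes\<close>

lemma snd_vec_floor: "snd (vec_floor x) = of_int \<lfloor>snd x\<rfloor>" for x :: "(real ^ 'n) \<times> real"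
proof -
  have "((0 :: real ^ 'n), 1 :: real) \<in> Basis"
    by (simp add: Basis_prod_def)
  from vec_floor_inner[OF this, of x] show ?thesis
    by (simp add: inner_prod_def)
qed

context lattice_polytope
begin

lemma coord_ring_eq: "coord_ring P = (R :: ((int ^ 'n) \<times> int \<Rightarrow>\<^sub>0 'k::field) ring)"
  by (simp add: coord_ring_def monoid_algebra_def)

lemma graded_max_ideal_eq: "graded_max_ideal P = (monomial_span (above 1) :: ((int ^ 'n) \<times> int \<Rightarrow>\<^sub>0 'k::field) set)"
  unfolding graded_max_ideal_def coord_ring_eq monoid_algebra_simps by (auto simp: monomial_span_def)

lemma ideal_power_graded_max_ideal:
  "ideal_power R (graded_max_ideal P) k
     = (monomial_span (above (int k)) :: ((int ^ 'n) \<times> int \<Rightarrow>\<^sub>0 'k::field) set)"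
  unfolding graded_max_ideal_eq using ideal_power_above[of 1 k] by simp

text \<open>For an interior point, the rounded multiple stays in the cone for large \<open>q\<close>
  even after subtraction of the conductor, hence lies in \<open>S\<close>. For an exterior point the
  rounded multiple stays outside the cone, which contains \<open>S\<close>.\<close>

lemma eventually_vec_floor_mem_S:
  assumes "x \<notin> frontier C"
  shows "\<forall>\<^sub>F q in sequentially. vec_floor (real q *\<^sub>R x) \<in> emb ` S \<longleftrightarrow> x \<in> C"
proof -
  obtain c where c: "c \<in> S" "\<And>t. emb t \<in> C \<Longrightarrow> c + t \<in> S"
    using conductor by blast
  \<comment> \<open>The displacement allowed: the shift by the conductor and the rounding
    error.\<close>
  define B where "B = norm (emb c) + DIM((real ^ 'n) \<times> real)"
  have scale: "(1 / real q) *\<^sub>R z \<in> C \<longleftrightarrow> z \<in> C" if "q > 0" for q z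
    using cone_scale[of "(1 / real q) *\<^sub>R z" "real q"] cone_scale[of z "1 / real q"] that by auto
  show ?thesis
  proof (cases "x \<in> interior C")
    case True
    from eventually_scaled_near_in_open[OF open_interior True, of B]
    show ?thesis
      using eventually_gt_at_top[of 0]
    proof eventually_elim
      case (elim q)
      let ?z = "vec_floor (real q *\<^sub>R x)"
      have "dist (?z - emb c) (real q *\<^sub>R x) \<le> dist ?z (real q *\<^sub>R x) + norm (emb c)"
        using norm_triangle_ineq4[of "?z - real q *\<^sub>R x" "emb c"] by (simp add: dist_norm algebra_simps)
      also have "\<dots> \<le> B"
        unfolding B_def using dist_vec_floor[of "real q *\<^sub>R x"] by simp
      finally have "?z - emb c \<in> C"
        using elim scale interior_subset by blast
      moreover obtain t where t: "?z - emb c = emb t"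
        using integer_points_embE[of "?z - emb c"] by (metis emb_in_integer_points integer_points_diff vec_floor_in_integer_points)
      ultimately have "c + t \<in> S"
        using c by simp
      moreover have "?z = emb (c + t)"
        using t by (simp add: algebra_simps)
      ultimately show ?case
        using True interior_subset by blast
    qed
  next
    case False
    then have x: "x \<in> - C"
      using assms closed_cone by (simp add: frontier_def)
    from eventually_scaled_near_in_open[OF _ x, of B] closed_cone
    have "\<forall>\<^sub>F q in sequentially. \<forall>z. dist z (real q *\<^sub>R x) \<le> B \<longrightarrow> (1 / real q) *\<^sub>R z \<in> - C"
      by (simp add: open_Compl)
    then show ?thesis
      using eventually_gt_at_top[of 0]
    proof eventually_elim
      case (elim q)
      have "dist (vec_floor (real q *\<^sub>R x)) (real q *\<^sub>R x) \<le> B"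
        unfolding B_def using dist_vec_floor[of "real q *\<^sub>R x"] by (simp add: add_increasing)
      then have "vec_floor (real q *\<^sub>R x) \<notin> C"
        using elim scale[of q] by blast
      then show ?case
        using x emb_mem_cone by auto
    qed
  qed
qed

lemma finite_height_le: "finite {s \<in> S. snd s \<le> a}"
proof -
  obtain B where B: "B \<ge> 0" "\<And>x. x \<in> C \<Longrightarrow> norm x \<le> B * snd x"
    using cone_norm_bound by blast
  have "norm (emb s) \<le> B * of_int a" if "s \<in> S" "snd s \<le> a" for s
    using B(2)[OF emb_mem_cone[OF that(1)]] mult_left_mono[of "real_of_int (snd s)" "real_of_int a" B] B(1) that(2)
    by simp
  then have "{s \<in> S. snd s \<le> a} \<subseteq> {s. emb s \<in> cball 0 (B * of_int a)}"
    by auto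
  then show ?thesis
    using finite_bounded_emb[OF bounded_cball] by (rule finite_subset)
qed

lemma borel_shifted_cone [measurable]: "{x. x - y \<in> C} \<in> sets borel"
proof -
  have "closed ((\<lambda>x. x - y) -` C)"
    by (intro closed_vimage closed_cone continuous_intros)
  then show ?thesis
    by (simp add: vimage_def borel_closed)
qed

lemma borel_cone [measurable]: "C \<in> sets borel"
  using closed_cone by (rule borel_closed)

section \<open>The Hilbert-Samuel multiplicity as a volume\<close>

lemma card_S_below_tendsto:
  "(\<lambda>n. card {s \<in> S. snd s < int k * int n} / real n ^ (CARD('n) + 1)) \<longlonglongrightarrow> measure lborel {x \<in> C. snd x < real k}"
proof -
  obtain B where B: "B \<ge> 0" "\<And>x. x \<in> C \<Longrightarrow> norm x \<le> B * snd x"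
    using cone_norm_bound by blast
  define E where "E n = emb ` {s \<in> S. snd s < int k * int n}" for n
  have "(\<lambda>n. card (E n) / real n ^ DIM((real ^ 'n) \<times> real)) \<longlonglongrightarrow> measure lborel {x \<in> C. snd x < real k}"
  proof (rule card_integer_points_tendsto)
    show "E n \<subseteq> integer_points" for n
      by (auto simp: E_def)
    show "norm z \<le> real n * (B * real k)" if "z \<in> E n" for n z
    proof -
      obtain s where s: "z = emb s" "s \<in> S" "snd s < int k * int n"
        using \<open>z \<in> E n\<close> by (auto simp: E_def)
      then have "real_of_int (snd s) \<le> real k * real n"
        by (metis less_imp_le of_int_le_iff of_int_mult of_int_of_nat_eq)
      then have "B * snd z \<le> B * (real k * real n)"
        using s B(1) by (simp add: mult_left_mono)
      then show ?thesis
        using B(2)[OF emb_mem_cone[OF s(2)]] s(1) by (simp add: algebra_simps)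
    qed
    have "{x \<in> C. snd x < real k} = C \<inter> {x. snd x < real k}"
      by auto
    moreover have "open {x :: (real ^ 'n) \<times> real. snd x < real k}"
      by (intro open_Collect_less continuous_intros)
    ultimately show "{x \<in> C. snd x < real k} \<in> sets borel"
      by (simp add: borel_open)
    have "AE x in lborel. x - 0 \<notin> frontier C"
      by (rule AE_not_in_convex_frontier[OF convex_cone])
    then show "AE x in lborel. \<forall>\<^sub>F n in sequentially.
        vec_floor (real n *\<^sub>R x) \<in> E n \<longleftrightarrow> x \<in> {x \<in> C. snd x < real k}"
    proof eventually_elim
      case (elim x)
      then have "\<forall>\<^sub>F n in sequentially. vec_floor (real n *\<^sub>R x) \<in> emb ` S \<longleftrightarrow> x \<in> C"
        by (intro eventually_vec_floor_mem_S) simp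
      then show ?case
        using eventually_gt_at_top[of 0]
      proof eventually_elim
        case (elim n)
        let ?z = "vec_floor (real n *\<^sub>R x)"
        have "?z \<in> E n \<longleftrightarrow> ?z \<in> emb ` S \<and> snd ?z < real k * real n"
        proof -
          have key: "snd (emb s) < real k * real n \<longleftrightarrow> snd s < int k * int n" for s :: "(int ^ 'n) \<times> int"
            unfolding snd_emb by (metis of_int_less_iff of_int_mult of_int_of_nat_eq)
          show ?thesis
          proof
            assume "?z \<in> E n"
            then obtain s where "?z = emb s" "s \<in> S" "snd s < int k * int n"
              unfolding E_def by blast
            then show "?z \<in> emb ` S \<and> snd ?z < real k * real n"
              using key[of s] by simp
          next
            assume z: "?z \<in> emb ` S \<and> snd ?z < real k * real n"
            then obtain s where "?z = emb s" "s \<in> S"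
              by blast
            then show "?z \<in> E n"
              using z key[of s] unfolding E_def by (intro image_eqI[of _ _ s]) simp_all
          qed
        qed
        \<comment> \<open>A floor lies below an integer exactly when the number itself does, so the
          strict height condition survives rounding without error.\<close>
        also have "snd ?z < real k * real n \<longleftrightarrow> real n * snd x < real k * real n"
        proof -
          have "snd ?z = of_int \<lfloor>real n * snd x\<rfloor>" "real k * real n = of_int (int k * int n)"
            by (simp_all add: snd_vec_floor)
          then show ?thesis
            using floor_less_iff[of "real n * snd x" "int k * int n"] by (simp only: of_int_less_iff)
        qed
        also have "\<dots> \<longleftrightarrow> snd x < real k"
          using elim by (simp add: mult.commute)
        finally show ?case
          using elim by auto
      qed
    qed
  qed
  then show ?thesis
    by (simp add: E_def card_image[OF inj_on_subset[OF inj_emb]])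
qed

lemma hilbert_samuel_mult_eq:
  "hilbert_samuel_mult (CARD('n) + 1) (coord_ring P :: ((int ^ 'n) \<times> int \<Rightarrow>\<^sub>0 'k::field) ring)
      (ideal_power (coord_ring P) (graded_max_ideal P) k)
    = fact (CARD('n) + 1) * measure lborel {x \<in> C. snd x < real k}"
proof -
  let ?R = "R :: ((int ^ 'n) \<times> int \<Rightarrow>\<^sub>0 'k) ring"
  have "colength ?R (ideal_power ?R (monomial_span (above (int k))) n) = card {s \<in> S. snd s < int k * int n}" for n
  proof -
    have eq: "S - above (int k * int n) = {s \<in> S. snd s < int k * int n}"
      by auto
    have "finite {s \<in> S. snd s < int k * int n}"
      by (rule finite_subset[OF _ finite_height_le[of "int k * int n"]]) auto
    then show ?thesis
      unfolding ideal_power_above[OF of_nat_0_le_iff]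
      by (subst colength_monomial_span[OF upset_above]) (simp_all only: eq)
  qed
  then show ?thesis
    unfolding hilbert_samuel_mult_def coord_ring_eq ideal_power_graded_max_ideal
    using tendsto_mult_left[OF card_S_below_tendsto, of "fact (CARD('n) + 1)" k]
    by (intro limI) simp
qed

section \<open>The Hilbert-Kunz multiplicity as a volume\<close>

definition generators_of_power :: "nat \<Rightarrow> ((int ^ 'n) \<times> int) set" where
  "generators_of_power k = {s \<in> S. snd s = int k}"

text \<open>The limit shape, rescaled by 1/q, of the exponents outside the \<open>q\<close>-th
  Frobenius power of the \<open>k\<close>-th power of the maximal ideal. The apexes are genuine
  elements of \<open>S\<close>, not arbitrary lattice points of the cone.\<close>

definition uncovered :: "nat \<Rightarrow> ((real ^ 'n) \<times> real) set" where
  "uncovered k = {x \<in> C. \<forall>e\<in>generators_of_power k. x - emb e \<notin> C}"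

lemma finite_generators_of_power: "finite (generators_of_power k)"
  unfolding generators_of_power_def by (rule finite_subset[OF _ finite_height_le[of "int k"]]) auto

lemma borel_uncovered [measurable]: "uncovered k \<in> sets borel"
proof -
  have "uncovered k = C - (\<Union>e\<in>generators_of_power k. {x. x - emb e \<in> C})"
    by (auto simp: uncovered_def)
  then show ?thesis
    using finite_generators_of_power by (auto intro!: sets.Diff sets.finite_UN borel_shifted_cone borel_cone)
qed

text \<open>Since q e is integral, rounding q (x - e) gives the rounding of q x minus q e. So
  membership in \<open>F q\<close> is governed by \<open>eventually_vec_floor_mem_S\<close> at x and
  at the finitely many points x - e.\<close>

lemma card_S_uncovered_tendsto:
  fixes k
  defines "F \<equiv> \<lambda>q. S - {(\<Sum>i<q. e) + s | e s. (e \<in> S \<and> snd e = int k) \<and> s \<in> S}"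
  shows "\<And>q. q > 0 \<Longrightarrow> finite (F q)"
    and "(\<lambda>q. card (F q) / real q ^ (CARD('n) + 1)) \<longlonglongrightarrow> measure lborel (uncovered k)"
proof -
  obtain B where B: "B \<ge> 0" "\<And>x. x \<in> C \<Longrightarrow> norm x \<le> B * snd x"
    using cone_norm_bound by blast
  have FS: "F q \<subseteq> S" for q
    unfolding F_def by blast
  have height: "snd s \<le> int q * int (k + card L)" if "s \<in> F q" "q > 0" for q s
  proof (rule ccontr)
    assume "\<not> ?thesis"
    then have "\<exists>e\<in>S. snd e = int k \<and> (\<exists>s'\<in>S. s = (\<Sum>i<q. e) + s')"
      using that by (intro semigroup_element_dominates) (auto simp: F_def)
    then show False
      using that by (auto simp: F_def)
  qed
  show "finite (F q)" if "q > 0" for q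
    using height that by (intro finite_subset[OF _ finite_height_le[of "int q * int (k + card L)"]]) (auto simp: F_def)
  have "(\<lambda>q. card (emb ` F q) / real q ^ DIM((real ^ 'n) \<times> real)) \<longlonglongrightarrow> measure lborel (uncovered k)"
  proof (rule card_integer_points_tendsto)
    show "emb ` F q \<subseteq> integer_points" for q
      by auto
    show "norm z \<le> real q * (B * real (k + card L))" if q: "q > 0" and z: "z \<in> emb ` F q" for q z
    proof -
      obtain s where s: "z = emb s" "s \<in> F q" "s \<in> S"
        using z FS by blast
      then have "real_of_int (snd s) \<le> real q * real (k + card L)"
        using height[OF s(2) q] by (metis of_int_le_iff of_int_mult of_int_of_nat_eq)
      then have "B * snd z \<le> B * (real q * real (k + card L))"
        using s B(1) by (simp only: snd_emb mult_left_mono)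
      then show ?thesis
        using B(2)[OF emb_mem_cone[OF s(3)]] s(1) by (simp add: algebra_simps)
    qed
    have "AE x in lborel. x - 0 \<notin> frontier C \<and> (\<forall>e\<in>generators_of_power k. x - emb e \<notin> frontier C)"
      using AE_not_in_convex_frontier[OF convex_cone] finite_generators_of_power
      by (intro AE_conjI AE_finite_allI) blast+
    then show "AE x in lborel. \<forall>\<^sub>F q in sequentially. vec_floor (real q *\<^sub>R x) \<in> emb ` F q \<longleftrightarrow> x \<in> uncovered k"
    proof eventually_elim
      case (elim x)
      have "\<forall>\<^sub>F q in sequentially. vec_floor (real q *\<^sub>R x) \<in> emb ` S \<longleftrightarrow> x \<in> C"
        using elim by (intro eventually_vec_floor_mem_S) simp
      moreover have "\<forall>\<^sub>F q in sequentially. \<forall>e\<in>generators_of_power k.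
          vec_floor (real q *\<^sub>R (x - emb e)) \<in> emb ` S \<longleftrightarrow> x - emb e \<in> C"
        using elim finite_generators_of_power by (intro eventually_ball_finite ballI eventually_vec_floor_mem_S) auto
      ultimately show ?case
      proof eventually_elim
        case (elim q)
        let ?z = "vec_floor (real q *\<^sub>R x)"
        have shift: "vec_floor (real q *\<^sub>R (x - emb e)) = ?z - real q *\<^sub>R emb e" for e
          unfolding scaleR_diff_right by (intro vec_floor_diff integer_points_scaleR) simp
        have "?z \<in> emb ` F q \<longleftrightarrow> ?z \<in> emb ` S \<and> (\<forall>e\<in>generators_of_power k. ?z - real q *\<^sub>R emb e \<notin> emb ` S)"
        proof -
          obtain t where t: "?z = emb t"
            using integer_points_embE vec_floor_in_integer_points by blast
          have "?z - real q *\<^sub>R emb e \<in> emb ` S \<longleftrightarrow> t - (\<Sum>i<q. e) \<in> S" for e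
            unfolding t emb_sum_const[symmetric] emb_simps(3)[symmetric] by (auto simp del: emb_simps)
          moreover have "emb t \<in> emb ` X \<longleftrightarrow> t \<in> X" for X
            by (auto simp del: emb_simps)
          moreover have "t \<in> F q \<longleftrightarrow> t \<in> S \<and> (\<forall>e\<in>generators_of_power k. t - (\<Sum>i<q. e) \<notin> S)"
          proof -
            have "(\<exists>e s. t = (\<Sum>i<q. e) + s \<and> (e \<in> S \<and> snd e = int k) \<and> s \<in> S)
              \<longleftrightarrow> (\<exists>e. (e \<in> S \<and> snd e = int k) \<and> t - (\<Sum>i<q. e) \<in> S)"
              by (metis add_diff_cancel_left' diff_add_cancel add.commute)
            then show ?thesis
              unfolding F_def generators_of_power_def by blast
          qed
          ultimately show ?thesis
            by (simp add: t)
        qed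
        then show ?case
          using elim unfolding shift uncovered_def by blast
      qed
    qed
  qed (rule borel_uncovered)
  then show "(\<lambda>q. card (F q) / real q ^ (CARD('n) + 1)) \<longlonglongrightarrow> measure lborel (uncovered k)"
    by (simp add: card_image[OF inj_on_subset[OF inj_emb]])
qed

text \<open>The counting limit holds along all \<open>q\<close>; powers of the characteristic enter
  only to identify the counted sets with complements of Frobenius powers.\<close>

lemma hilbert_kunz_mult_eq:
  assumes "prime CHAR('k::field)"
  shows "hilbert_kunz_mult CHAR('k) (CARD('n) + 1) (coord_ring P :: ((int ^ 'n) \<times> int \<Rightarrow>\<^sub>0 'k) ring)
      (ideal_power (coord_ring P) (graded_max_ideal P) k)
    = measure lborel (uncovered k)"
proof -
  let ?R = "R :: ((int ^ 'n) \<times> int \<Rightarrow>\<^sub>0 'k) ring" and ?p = "CHAR('k)"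
  define F where "F q = S - {(\<Sum>i<q. e) + s | e s. (e \<in> S \<and> snd e = int k) \<and> s \<in> S}" for q :: nat
  have "colength ?R (frobenius_power ?R (monomial_span (above (int k))) (?p ^ n)) = card (F (?p ^ n))" for n
  proof -
    have p: "?p ^ n > 0"
      using assms prime_gt_0_nat by simp
    have "upset {(\<Sum>i<?p ^ n. e) + s | e s. (e \<in> S \<and> snd e = int k) \<and> s \<in> S}"
      using upset_multiples[of "{e \<in> S. snd e = int k}" "?p ^ n"] by simp
    then show ?thesis
      unfolding frobenius_power_above[OF assms of_nat_0_le_iff]
      by (subst colength_monomial_span) (use card_S_uncovered_tendsto(1)[OF p] in \<open>simp_all add: F_def\<close>)
  qed
  moreover have "filterlim (\<lambda>n. ?p ^ n) sequentially sequentially"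
    using assms prime_gt_1_nat by (intro filterlim_subseq) (auto simp: strict_mono_def)
  from filterlim_compose[OF card_S_uncovered_tendsto(2) this, of k]
  have "(\<lambda>n. card (F (?p ^ n)) / real (?p ^ n) ^ (CARD('n) + 1)) \<longlonglongrightarrow> measure lborel (uncovered k)"
    by (simp add: F_def)
  ultimately show ?thesis
    unfolding hilbert_kunz_mult_def coord_ring_eq ideal_power_graded_max_ideal
    by (intro limI) simp
qed

end

section \<open>The function \<open>\<phi>\<^sub>D\<close>\<close>

text \<open>Cavalieri's principle; boundedness keeps the volumes finite, so the real-valued measure
  may replace the extended one.\<close>

lemma measure_eq_integral_slices:
  fixes X :: "('a::euclidean_space \<times> real) set"
  assumes X: "X \<in> sets borel" and bdd: "bounded X"
  shows "has_bochner_integral lborel (\<lambda>z. measure lborel {x. (x, z) \<in> X}) (measure lborel X)"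
proof (rule has_bochner_integral_nn_integral)
  have X': "X \<in> sets (lborel \<Otimes>\<^sub>M lborel)"
    unfolding lborel_prod using X by simp
  have "bounded {x. (x, z) \<in> X}" for z
    by (rule bounded_subset[OF bounded_fst[OF bdd]]) force
  then have slice: "emeasure lborel ((\<lambda>x. (x, z)) -` X) = ennreal (measure lborel {x. (x, z) \<in> X})" for z
    by (simp add: vimage_def emeasure_eq_ennreal_measure emeasure_bounded_borel_finite)
  show "(\<lambda>z. measure lborel {x. (x, z) \<in> X}) \<in> borel_measurable lborel"
    using lborel_pair.measurable_emeasure_Pair2[OF X'] unfolding measure_def vimage_def by measurable
  have "(\<integral>\<^sup>+z. ennreal (measure lborel {x. (x, z) \<in> X}) \<partial>lborel) = emeasure lborel X"
    using lborel_pair.emeasure_pair_measure_alt2[OF X'] unfolding slice lborel_prod by simp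
  also have "\<dots> = ennreal (measure lborel X)"
    using emeasure_bounded_borel_finite[OF bdd] by (rule emeasure_eq_ennreal_measure)
  finally show "(\<integral>\<^sup>+z. ennreal (measure lborel {x. (x, z) \<in> X}) \<partial>lborel) = ennreal (measure lborel X)" .
qed auto

lemma unit_cell_eq_cbox:
  fixes w :: "int ^ 'n"
  shows "unit_cell w = cbox (rvec w) (rvec w + One)"
proof -
  have "(\<forall>i. 0 \<le> x $ i \<and> x $ i \<le> 1) \<longleftrightarrow> x \<in> cbox 0 One" for x :: "real ^ 'n"
  proof -
    have "(\<forall>b\<in>Basis. 0 \<le> x \<bullet> b \<and> x \<bullet> b \<le> 1) \<longleftrightarrow> (\<forall>i. 0 \<le> x $ i \<and> x $ i \<le> 1)"
      by (auto simp: Basis_vec_def inner_axis)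
    then show ?thesis
      by (simp add: mem_box)
  qed
  then show ?thesis
    using cbox_translation[of "rvec w" 0 One] by (simp add: unit_cell_def)
qed

context lattice_polytope
begin

text \<open>The apexes in \<open>phi\<close> sit at height 1, so the slice at height \<mu> + 1 sees
  each cone at relative height \<mu>. The set is invariant under lattice translations, which makes
  \<open>phi\<close> independent of the cell.\<close>

definition gaps :: "real \<Rightarrow> (real ^ 'n) set" where
  "gaps \<mu> = {x. \<forall>u. (x - rvec u, \<mu>) \<notin> C}"

definition gap_density :: "real \<Rightarrow> real" where
  "gap_density \<mu> = measure lborel (cbox 0 One \<inter> gaps \<mu>)"

lemma closed_cone_slice: "closed {x. (x - y, \<mu>) \<in> C}"
proof -
  have "closed ((\<lambda>x. (x - y, \<mu>)) -` C)"
    by (intro closed_vimage closed_cone continuous_intros)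
  then show ?thesis by (simp add: vimage_def)
qed

lemma borel_gaps [measurable]: "gaps \<mu> \<in> sets borel"
proof -
  have "gaps \<mu> = - (\<Union>u. {x. (x - rvec u, \<mu>) \<in> C})"
    by (auto simp: gaps_def)
  moreover have "(\<Union>u. {x. (x - rvec u, \<mu>) \<in> C}) \<in> sets borel"
    by (intro sets.countable_UN borel_closed closed_cone_slice image_subsetI)
  ultimately show ?thesis
    using borel_comp by metis
qed

lemma gaps_translation: "(+) (rvec w) ` (cbox 0 One \<inter> gaps \<mu>) = cbox (rvec w) (rvec w + One) \<inter> gaps \<mu>"
proof -
  have "x - rvec w \<in> gaps \<mu> \<longleftrightarrow> x \<in> gaps \<mu>" for x
  proof
    assume l: "x - rvec w \<in> gaps \<mu>"
    show "x \<in> gaps \<mu>"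
      unfolding gaps_def
    proof safe
      fix u assume "(x - rvec u, \<mu>) \<in> C"
      then have "(x - rvec w - rvec (u - w), \<mu>) \<in> C"
        by simp
      with l show False unfolding gaps_def by blast
    qed
  next
    assume r: "x \<in> gaps \<mu>"
    show "x - rvec w \<in> gaps \<mu>"
      unfolding gaps_def
    proof safe
      fix u assume "(x - rvec w - rvec u, \<mu>) \<in> C"
      then have "(x - rvec (w + u), \<mu>) \<in> C"
        by (simp add: algebra_simps)
      with r show False unfolding gaps_def by blast
    qed
  qed
  moreover have "(+) (rvec w) ` A = {x. x - rvec w \<in> A}" for A :: "(real ^ 'n) set"
    by (auto simp: image_iff intro!: bexI[of _ "_ - rvec w"])
  ultimately have "(+) (rvec w) ` (cbox 0 One \<inter> gaps \<mu>) = (+) (rvec w) ` cbox 0 One \<inter> gaps \<mu>"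
    by auto
  then show ?thesis
    using cbox_translation[of "rvec w" 0 One] by simp
qed

lemma measure_cell_gaps: "measure lborel (cbox (rvec w) (rvec w + One) \<inter> gaps \<mu>) = gap_density \<mu>"
proof -
  have "measure lebesgue (cbox (rvec w) (rvec w + One) \<inter> gaps \<mu>) = measure lebesgue (cbox 0 One \<inter> gaps \<mu>)"
    unfolding gaps_translation[symmetric] by (rule measure_translation)
  then show ?thesis
    unfolding gap_density_def by (simp add: borel_gaps)
qed

lemma phi_eq: "phi P w \<mu> = gap_density \<mu>"
proof -
  have "(x, \<mu> + 1) \<in> (+) (rvec u, 1) ` C \<longleftrightarrow> (x - rvec u, \<mu>) \<in> C" for x u
  proof
    assume "(x, \<mu> + 1) \<in> (+) (rvec u, 1) ` C"
    then show "(x - rvec u, \<mu>) \<in> C" by (auto simp: algebra_simps)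
  next
    assume "(x - rvec u, \<mu>) \<in> C"
    then show "(x, \<mu> + 1) \<in> (+) (rvec u, 1) ` C"
      by (intro image_eqI[of _ _ "(x - rvec u, \<mu>)"]) auto
  qed
  then have "{x. (x, \<mu> + 1) \<in> unit_cell w \<times> {\<mu> + 1} - (\<Union>u. (+) (rvec u, 1) ` C)}
      = cbox (rvec w) (rvec w + One) \<inter> gaps \<mu>"
    by (auto simp: unit_cell_eq_cbox gaps_def)
  then show ?thesis
    unfolding phi_def slice_vol_def using measure_cell_gaps[of w \<mu>] by (simp add: borel_gaps)
qed

lemma gap_density_nonneg: "0 \<le> gap_density \<mu>"
  by (simp add: gap_density_def)

lemma gap_density_le_1: "gap_density \<mu> \<le> 1"
proof -
  have "gap_density \<mu> \<le> measure lborel (cbox (0 :: real ^ 'n) One)"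
    unfolding gap_density_def by (intro measure_mono_fmeasurable fmeasurableI) (auto simp: borel_gaps)
  then show ?thesis by simp
qed

lemma cone_slice_eq_image: "0 \<le> \<mu> \<Longrightarrow> {y. (y, \<mu>) \<in> C} = (\<lambda>p. \<mu> *\<^sub>R p) ` P"
  by (auto simp: mem_cone_iff)

text \<open>Radial projection to height \<mu> is continuous on positive heights, and the cone is
  stable under scaling, so the preimage of the interior of the slice is an open part of the
  cone.\<close>

lemma slice_interior:
  assumes "\<mu> > 0" "y \<in> interior {y. (y, \<mu>) \<in> C}"
  shows "(y, \<mu>) \<in> interior C"
proof -
  let ?f = "\<lambda>p :: (real ^ 'n) \<times> real. (\<mu> / snd p) *\<^sub>R fst p"
  have "open ({p :: (real ^ 'n) \<times> real. 0 < snd p} \<inter> ?f -` interior {y. (y, \<mu>) \<in> C})"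
    by (intro continuous_open_preimage continuous_intros open_Collect_less) auto
  moreover have "{p :: (real ^ 'n) \<times> real. 0 < snd p} \<inter> ?f -` interior {y. (y, \<mu>) \<in> C} \<subseteq> C"
  proof
    fix p assume p: "p \<in> {p :: (real ^ 'n) \<times> real. 0 < snd p} \<inter> ?f -` interior {y. (y, \<mu>) \<in> C}"
    then have "(?f p, \<mu>) \<in> C"
      using interior_subset by blast
    then have "(snd p / \<mu>) *\<^sub>R (?f p, \<mu>) \<in> C"
      using assms p by (intro cone_scale) auto
    then show "p \<in> C"
      using assms p by simp
  qed
  ultimately have "{p :: (real ^ 'n) \<times> real. 0 < snd p} \<inter> ?f -` interior {y. (y, \<mu>) \<in> C} \<subseteq> interior C"
    by (intro interior_maximal)
  then show ?thesis
    using assms by auto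
qed

text \<open>There are countably many translates, and each slice of positive height is convex with
  null frontier. At height 0 the slice is a single point.\<close>

lemma AE_slice_interior:
  assumes "\<mu> \<ge> 0"
  shows "AE x in lborel. \<forall>u. (x - rvec u, \<mu>) \<in> C \<longrightarrow> (x - rvec u, \<mu>) \<in> interior C"
  unfolding AE_all_countable
proof
  fix u :: "int ^ 'n"
  show "AE x in lborel. (x - rvec u, \<mu>) \<in> C \<longrightarrow> (x - rvec u, \<mu>) \<in> interior C"
  proof (cases "\<mu> = 0")
    case True
    have "AE x in lborel. x \<noteq> rvec u"
      by (rule AE_lborel_singleton)
    then show ?thesis
      by eventually_elim (auto simp: mem_cone_iff True)
  next
    case False
    have "convex {y. (y, \<mu>) \<in> C}"
      unfolding cone_slice_eq_image[OF assms] by (intro convex_scaling convex_P)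
    then have "AE x in lborel. x - rvec u \<notin> frontier {y. (y, \<mu>) \<in> C}"
      by (rule AE_not_in_convex_frontier)
    then show ?thesis
    proof eventually_elim
      case (elim x)
      have "closed {y. (y, \<mu>) \<in> C}"
        using closed_cone_slice[of 0 \<mu>] by simp
      then show ?case
        using elim False assms slice_interior[of \<mu> "x - rvec u"] by (auto simp: frontier_def)
    qed
  qed
qed

text \<open>By dominated convergence it suffices that membership in the gaps is eventually constant
  for almost every x. A covered x is in the interior of a translate and stays covered. For an
  uncovered x only the finitely many translates in \<open>U\<close> can reach it at heights below
  \<mu> + 1, and each misses it eventually because the cone is closed.\<close>

lemma gap_density_continuous: "continuous_on {0..} gap_density"
  unfolding continuous_on_sequentially
proof safe
  fix \<mu> and m :: "nat \<Rightarrow> real"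
  assume "0 \<le> \<mu>" and m: "\<forall>n. m n \<in> {0..}" "m \<longlonglongrightarrow> \<mu>"
  obtain B where B: "B \<ge> 0" "\<And>x. x \<in> C \<Longrightarrow> norm x \<le> B * snd x"
    using cone_norm_bound by blast
  have "AE x in lborel. \<forall>\<^sub>F n in sequentially. x \<in> gaps (m n) \<longleftrightarrow> x \<in> gaps \<mu>"
    using AE_slice_interior[OF \<open>0 \<le> \<mu>\<close>]
  proof eventually_elim
    case (elim x)
    have lim: "(\<lambda>n. (x - rvec u, m n)) \<longlonglongrightarrow> (x - rvec u, \<mu>)" for u
      using m(2) by (intro tendsto_intros)
    show ?case
    proof (cases "x \<in> gaps \<mu>")
      case False
      then obtain u where "(x - rvec u, \<mu>) \<in> interior C"
        using elim by (auto simp: gaps_def)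
      then have "\<forall>\<^sub>F n in sequentially. (x - rvec u, m n) \<in> interior C"
        using lim by (intro topological_tendstoD) auto
      then show ?thesis
        by eventually_elim (use False interior_subset[of C] in \<open>auto simp: gaps_def\<close>)
    next
      case True
      define U where "U = {u. rvec u \<in> cball x (B * (\<mu> + 1))}"
      have "finite U"
        unfolding U_def by (intro finite_bounded_int_vec bounded_cball)
      moreover have "\<forall>\<^sub>F n in sequentially. (x - rvec u, m n) \<in> - C" for u
        using True lim closed_cone by (intro topological_tendstoD) (auto simp: gaps_def open_Compl)
      ultimately have "\<forall>\<^sub>F n in sequentially. \<forall>u\<in>U. (x - rvec u, m n) \<in> - C"
        by (intro eventually_ball_finite) auto
      moreover have "\<forall>\<^sub>F n in sequentially. m n < \<mu> + 1"
        using m(2) by (rule order_tendstoD) simp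
      ultimately show ?thesis
      proof eventually_elim
        case (elim n)
        have "(x - rvec u, m n) \<notin> C" if "u \<notin> U" for u
        proof
          assume C: "(x - rvec u, m n) \<in> C"
          have "norm (x - rvec u) \<le> norm (x - rvec u, m n)"
            using norm_fst_le[of "x - rvec u" "m n"] by simp
          also have "\<dots> \<le> B * m n"
            using B(2)[OF C] by simp
          also have "\<dots> \<le> B * (\<mu> + 1)"
            using elim B(1) by (intro mult_left_mono) auto
          finally show False
            using that by (simp add: U_def dist_norm)
        qed
        then show ?case
          using True elim by (auto simp: gaps_def)
      qed
    qed
  qed
  then have "AE x in lborel. (\<lambda>n. indicator (cbox 0 One \<inter> gaps (m n)) x :: real) \<longlonglongrightarrow> indicator (cbox 0 One \<inter> gaps \<mu>) x"
  proof eventually_elim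
    case (elim x)
    then have "\<forall>\<^sub>F n in sequentially. indicator (cbox 0 One \<inter> gaps (m n)) x = (indicator (cbox 0 One \<inter> gaps \<mu>) x :: real)"
      by eventually_elim (auto simp: indicator_def)
    then show ?case by (rule tendsto_eventually)
  qed
  then have "(\<lambda>n. integral\<^sup>L lborel (indicator (cbox 0 One \<inter> gaps (m n)) :: _ \<Rightarrow> real))
      \<longlonglongrightarrow> integral\<^sup>L lborel (indicator (cbox 0 One \<inter> gaps \<mu>))"
    by (intro integral_dominated_convergence[where w = "indicator (cbox 0 One)"])
      (auto simp: borel_gaps indicator_def intro!: integrable_real_indicator)
  then show "(gap_density \<circ> m) \<longlonglongrightarrow> gap_density \<mu>"
    by (simp add: gap_density_def o_def borel_gaps)
qed

text \<open>A lattice vector is a difference of semigroup elements of equal height, hence a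
  combination with coefficient sum 0. Such combinations form a subspace, which contains the basis; a
  multiple of one lattice point then adjusts the sum.\<close>

lemma ex_affine_combination: "\<exists>a. (\<Sum>u\<in>L. a u) = \<mu> \<and> x = (\<Sum>u\<in>L. a u *\<^sub>R rvec u)"
proof -
  define V where "V = {x. \<exists>a. (\<Sum>u\<in>L. a u) = 0 \<and> x = (\<Sum>u\<in>L. a u *\<^sub>R rvec u)}"
  have rvec_V: "rvec w \<in> V" for w
  proof -
    obtain s s' where s: "s \<in> S" "s' \<in> S" "(w, 0) = s - s'"
      using difference_of_S by blast
    then obtain n n' where n: "s = comb n" "s' = comb n'"
      using mem_S_iff_comb by blast
    have eq: "(rvec w, 0 :: real) = (\<Sum>u\<in>L. (real (n u) - real (n' u)) *\<^sub>R (rvec u, 1))"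
      using arg_cong[OF s(3), of emb] unfolding n emb_simps emb_comb
      by (simp add: emb_def scaleR_diff_left sum_subtractf del: scaleR_Pair)
    show ?thesis
      unfolding V_def using arg_cong[OF eq, of fst] arg_cong[OF eq, of snd]
      by (intro CollectI exI[of _ "\<lambda>u. real (n u) - real (n' u)"]) (simp add: fst_sum snd_sum)
  qed
  have "subspace V"
  proof (rule subspaceI)
    show "0 \<in> V"
      unfolding V_def by (auto intro!: exI[of _ "\<lambda>_. 0"])
    show "x + y \<in> V" if xy: "x \<in> V" "y \<in> V" for x y
    proof -
      obtain a b where "(\<Sum>u\<in>L. a u) = 0" "x = (\<Sum>u\<in>L. a u *\<^sub>R rvec u)"
        "(\<Sum>u\<in>L. b u) = 0" "y = (\<Sum>u\<in>L. b u *\<^sub>R rvec u)"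
        using xy unfolding V_def by blast
      then show ?thesis
        unfolding V_def by (intro CollectI exI[of _ "\<lambda>u. a u + b u"]) (simp add: sum.distrib scaleR_left_distrib)
    qed
    show "c *\<^sub>R x \<in> V" if x: "x \<in> V" for c x
    proof -
      obtain a where "(\<Sum>u\<in>L. a u) = 0" "x = (\<Sum>u\<in>L. a u *\<^sub>R rvec u)"
        using x unfolding V_def by blast
      then show ?thesis
        unfolding V_def by (intro CollectI exI[of _ "\<lambda>u. c * a u"]) (simp add: scaleR_sum_right flip: sum_distrib_left)
    qed
  qed
  moreover have "Basis \<subseteq> V"
  proof
    fix b :: "real ^ 'n" assume "b \<in> Basis"
    then obtain i where "b = axis i 1"
      by (auto simp: Basis_vec_def)
    then have "b = rvec (axis i 1)"
      by (simp add: vec_eq_iff axis_def)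
    then show "b \<in> V" by (simp add: rvec_V)
  qed
  ultimately have "V = UNIV"
    using span_minimal[of Basis V] span_Basis by blast
  obtain u0 where u0: "u0 \<in> L"
    using L_nonempty by blast
  obtain a where a: "(\<Sum>u\<in>L. a u) = 0" "x - \<mu> *\<^sub>R rvec u0 = (\<Sum>u\<in>L. a u *\<^sub>R rvec u)"
    using \<open>V = UNIV\<close> unfolding V_def by blast
  have "(\<Sum>u\<in>L. (if u = u0 then \<mu> else 0)) = \<mu>" "(\<Sum>u\<in>L. (if u = u0 then \<mu> else 0) *\<^sub>R rvec u) = \<mu> *\<^sub>R rvec u0"
    using u0 finite_lattice_points by (simp_all add: if_distrib[of "\<lambda>c. c *\<^sub>R _"] cong: if_cong)
  then show ?thesis
    using a by (intro exI[of _ "\<lambda>u. a u + (if u = u0 then \<mu> else 0)"])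
      (simp add: sum.distrib scaleR_left_distrib algebra_simps)
qed

text \<open>Adding \<open>N\<close> copies of every lattice point of the polytope makes the
  coefficients of an affine combination for x nonnegative and puts the point in the cone at height
  \<open>card L * N + \<mu>\<close>. \<open>cone_point_dominates\<close> then yields an apex at
  height \<open>card L * N\<close>, and undoing the lattice translation gives the required
  \<open>u\<close>.\<close>

lemma gaps_empty:
  assumes "real (card L) \<le> \<mu>"
  shows "gaps \<mu> = {}"
proof -
  have "\<exists>u. (x - rvec u, \<mu>) \<in> C" for x
  proof -
    obtain a where a: "(\<Sum>u\<in>L. a u) = \<mu>" "x = (\<Sum>u\<in>L. a u *\<^sub>R rvec u)"
      using ex_affine_combination by blast
    define N where "N = nat \<lceil>\<Sum>u\<in>L. \<bar>a u\<bar>\<rceil>"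
    have N: "0 \<le> a u + real N" if "u \<in> L" for u
    proof -
      have "\<bar>a u\<bar> \<le> (\<Sum>u\<in>L. \<bar>a u\<bar>)"
        using that finite_lattice_points by (intro member_le_sum) auto
      then show ?thesis
        unfolding N_def by linarith
    qed
    have shift: "rvec (\<Sum>u\<in>L. \<Sum>i<N. u) = (\<Sum>u\<in>L. real N *\<^sub>R rvec u)"
      by (simp only: rvec_sum sum_constant_scaleR card_lessThan)
    have "(x + rvec (\<Sum>u\<in>L. \<Sum>i<N. u), real (card L * N) + \<mu>) = (\<Sum>u\<in>L. (a u + real N) *\<^sub>R (rvec u, 1))"
      using a unfolding shift by (simp add: sum.distrib scaleR_left_distrib prod_eq_iff fst_sum snd_sum)
    then have "(x + rvec (\<Sum>u\<in>L. \<Sum>i<N. u), real (card L * N) + \<mu>) \<in> C"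
      unfolding mem_cone_iff_sum using N by (intro exI[of _ "\<lambda>u. a u + real N"] conjI ballI)
    then obtain e where e: "e \<in> S" "snd e = int (card L * N)"
      "(x + rvec (\<Sum>u\<in>L. \<Sum>i<N. u), real (card L * N) + \<mu>) - emb e \<in> C"
      using cone_point_dominates[OF _ assms] by blast
    have "(x - rvec (fst e - (\<Sum>u\<in>L. \<Sum>i<N. u)), \<mu>) \<in> C"
      using e(2,3) by (simp add: emb_def algebra_simps)
    then show ?thesis by blast
  qed
  then show ?thesis
    unfolding gaps_def by blast
qed

lemma gap_density_eq_0: "real (card L) \<le> \<mu> \<Longrightarrow> gap_density \<mu> = 0"
  by (simp add: gap_density_def gaps_empty)

end

section \<open>Density of the uncovered points in high slices\<close>

context lattice_polytope
begin

abbreviation vol_P :: real where "vol_P \<equiv> measure lborel P"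

lemma borel_slice: "X \<in> sets borel \<Longrightarrow> {x. (x, z) \<in> X} \<in> sets borel"
  for X :: "((real ^ 'n) \<times> real) set"
  using measurable_sets_borel[of "\<lambda>x. (x, z)" borel X] by (simp add: vimage_def)

lemma bounded_slice: "bounded X \<Longrightarrow> bounded {x. (x, z) \<in> X}"
  for X :: "((real ^ 'n) \<times> real) set"
  by (rule bounded_subset[OF bounded_fst]) force+

lemma bounded_cone_below: "bounded {x \<in> C. snd x \<le> a}"
proof -
  obtain B where B: "B \<ge> 0" "\<And>x. x \<in> C \<Longrightarrow> norm x \<le> B * snd x"
    using cone_norm_bound by blast
  have "norm x \<le> B * a" if "x \<in> C" "snd x \<le> a" for x
    using B(2)[OF that(1)] mult_left_mono[OF that(2) B(1)] by linarith
  then show ?thesis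
    unfolding bounded_iff by blast
qed

lemma bounded_cone_slice: "bounded {x. (x, z) \<in> C}"
proof -
  have eq: "{x. (x, z) \<in> C} = {x. (x, z) \<in> {x \<in> C. snd x \<le> z}}"
    by auto
  show ?thesis
    unfolding eq by (rule bounded_slice[OF bounded_cone_below])
qed

lemma measure_cone_slice:
  assumes "0 \<le> z"
  shows "measure lborel {x. (x, z) \<in> C} = z ^ CARD('n) * vol_P"
proof -
  have "measure lebesgue {x. (x, z) \<in> C} = measure lebesgue ((\<lambda>p. z *\<^sub>R p + 0) ` P)"
    using cone_slice_eq_image[OF assms] by simp
  also have "\<dots> = \<bar>z\<bar> ^ DIM(real ^ 'n) * measure lebesgue P"
    by (rule measure_lebesgue_affine)
  finally show ?thesis
    using assms borel_slice[OF borel_cone, of z] borel_compact[OF compact_P] by simp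
qed

lemma uncovered_height_less:
  assumes "(x, real k + \<mu>) \<in> uncovered k"
  shows "\<mu> < real (card L)"
proof (rule ccontr)
  assume "\<not> ?thesis"
  then obtain e where "e \<in> S" "snd e = int k" "(x, real k + \<mu>) - emb e \<in> C"
    using assms cone_point_dominates[of x k \<mu>] by (auto simp: uncovered_def)
  moreover from this have "e \<in> generators_of_power k"
    by (simp add: generators_of_power_def)
  ultimately show False
    using assms unfolding uncovered_def by blast
qed

lemma bounded_uncovered: "bounded (uncovered k)"
proof (rule bounded_subset[OF bounded_cone_below[of "real k + real (card L)"]])
  show "uncovered k \<subseteq> {x \<in> C. snd x \<le> real k + real (card L)}"
  proof
    fix p assume p: "p \<in> uncovered k"
    then have "(fst p, real k + (snd p - real k)) \<in> uncovered k"
      by simp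
    from uncovered_height_less[OF this] p show "p \<in> {x \<in> C. snd x \<le> real k + real (card L)}"
      by (auto simp: uncovered_def)
  qed
qed

lemma measure_uncovered_slice_le:
  assumes "0 \<le> \<mu>"
  shows "measure lborel {x. (x, real k + \<mu>) \<in> uncovered k} \<le> (real k + \<mu>) ^ CARD('n) * vol_P"
proof -
  have "measure lborel {x. (x, real k + \<mu>) \<in> uncovered k} \<le> measure lborel {x. (x, real k + \<mu>) \<in> C}"
    using emeasure_bounded_borel_finite[OF bounded_cone_slice] borel_slice[OF borel_cone] borel_slice[OF borel_uncovered]
    by (intro measure_mono_fmeasurable fmeasurableI) (auto simp: uncovered_def less_top)
  then show ?thesis
    using assms by (simp add: measure_cone_slice)
qed

text \<open>Every lattice point that is deep inside the cone belongs to the semigroup. Hence on a unit cell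
  around a deep lattice point \<open>w\<close> of height \<open>k\<close>, the uncovered set at height \<open>k + \<mu>\<close> is
  the periodic set \<open>gaps \<mu>\<close>, and all but \<open>o(k\<^sup>d\<^sup>-\<^sup>1)\<close> of the slice consists of such cells.\<close>

lemma measure_uncovered_slice_tendsto:
  assumes \<mu>: "0 \<le> \<mu>"
  shows "(\<lambda>k. measure lborel {x. (x, real k + \<mu>) \<in> uncovered k} / real k ^ CARD('n)) \<longlonglongrightarrow> vol_P * gap_density \<mu>"
proof -
  obtain B where B: "B \<ge> 0" "\<And>x. x \<in> C \<Longrightarrow> norm x \<le> B * snd x"
    using cone_norm_bound by blast
  obtain c where c: "c \<in> S" "\<And>t. emb t \<in> C \<Longrightarrow> c + t \<in> S"
    using conductor by blast
  \<comment> \<open>One radius for two purposes: the rise by \<mu> plus rounding, and the reach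
    \<open>B * \<mu>\<close> of a slice plus rounding plus the conductor.\<close>
  define \<rho> where "\<rho> = B * \<mu> + \<mu> + DIM(real ^ 'n) + norm (emb c)"
  have \<rho>: "\<rho> \<ge> 0" "\<mu> + DIM(real ^ 'n) \<le> \<rho>" "B * \<mu> + DIM(real ^ 'n) + norm (emb c) \<le> \<rho>"
    using B(1) \<mu> by (simp_all add: \<rho>_def)
  define E where "E k = {z \<in> integer_points. cball (z, real k) \<rho> \<subseteq> C}" for k :: nat
  have E_cone: "(z, real k) \<in> C" if "z \<in> E k" for z k
    using that \<rho>(1) by (auto simp: E_def)
  have E_norm: "norm z \<le> real k * B" if "z \<in> E k" for z k
    using B(2)[OF E_cone[OF that]] norm_fst_le[of z "real k"] by (simp add: mult.commute)
  have finE: "finite (E k)" for k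
    using finite_bounded_integer_points[OF bounded_cball, of "0 :: real ^ 'n" "real k * B"] E_norm
    by (elim rev_finite_subset) (auto simp: E_def)
  have scale: "(1 / real q) *\<^sub>R z \<in> C \<longleftrightarrow> z \<in> C" if "q > 0" for q z
    using cone_scale[of "(1 / real q) *\<^sub>R z" "real q"] cone_scale[of z "1 / real q"] that by auto
  have card_lim: "(\<lambda>k. card (E k) / real k ^ DIM(real ^ 'n)) \<longlonglongrightarrow> measure lborel {x. (x, 1) \<in> C}"
  proof (rule card_integer_points_tendsto)
    show "E k \<subseteq> integer_points" for k
      by (auto simp: E_def)
    show "norm z \<le> real k * B" if "z \<in> E k" for k z
      using E_norm that .
    show "{x. (x, 1) \<in> C} \<in> sets borel"
      by (rule borel_slice[OF borel_cone])
    have "AE x in lborel. \<forall>u. (x - rvec u, 1) \<in> C \<longrightarrow> (x - rvec u, 1) \<in> interior C"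
      by (rule AE_slice_interior) simp
    then show "AE x in lborel. \<forall>\<^sub>F k in sequentially. vec_floor (real k *\<^sub>R x) \<in> E k \<longleftrightarrow> x \<in> {x. (x, 1) \<in> C}"
    proof eventually_elim
      case (elim x)
      then have int: "(x, 1) \<in> C \<longrightarrow> (x, 1) \<in> interior C"
        using elim[rule_format, of 0] by simp
      have floor_dist: "dist (vec_floor (real k *\<^sub>R x), real k) (real k *\<^sub>R (x, 1)) \<le> DIM(real ^ 'n)" for k
        using dist_vec_floor[of "real k *\<^sub>R x"] by (simp add: dist_Pair_Pair)
      show ?case
      proof (cases "(x, 1) \<in> C")
        case True
        then have "(x, 1) \<in> interior C"
          using int by blast
        from eventually_scaled_near_in_open[OF open_interior this, of "\<rho> + DIM(real ^ 'n)"]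
        show ?thesis
          using eventually_gt_at_top[of 0]
        proof eventually_elim
          case (elim k)
          have "cball (vec_floor (real k *\<^sub>R x), real k) \<rho> \<subseteq> C"
          proof
            fix z assume "z \<in> cball (vec_floor (real k *\<^sub>R x), real k) \<rho>"
            then have "dist z (real k *\<^sub>R (x, 1)) \<le> \<rho> + DIM(real ^ 'n)"
              using floor_dist[of k] dist_triangle[of z "real k *\<^sub>R (x, 1)" "(vec_floor (real k *\<^sub>R x), real k)"]
              by (simp add: dist_commute)
            then show "z \<in> C"
              using elim scale interior_subset by blast
          qed
          then show ?case
            using True by (simp add: E_def)
        qed
      next
        case False
        then have "(x, 1) \<in> - C" by simp
        from eventually_scaled_near_in_open[OF _ this, of "DIM(real ^ 'n)"] closed_cone
        have "\<forall>\<^sub>F k in sequentially. \<forall>z. dist z (real k *\<^sub>R (x, 1)) \<le> DIM(real ^ 'n) \<longrightarrow> (1 / real k) *\<^sub>R z \<in> - C"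
          by (simp add: open_Compl)
        then show ?thesis
          using eventually_gt_at_top[of 0]
        proof eventually_elim
          case (elim k)
          then have "(vec_floor (real k *\<^sub>R x), real k) \<notin> C"
            using scale[of k] floor_dist[of k] by blast
          then show ?case
            using E_cone False by auto
        qed
      qed
    qed
  qed
  define D where "D k = {x. vec_floor x \<in> E k}" for k
  have D_sets: "D k \<in> sets borel" for k
  proof -
    have "E k \<in> sets borel"
      using finE by (intro borel_closed finite_imp_closed)
    then show ?thesis
      using measurable_sets_borel[OF vec_floor_measurable, of "E k"] by (simp add: D_def vimage_def)
  qed
  have D_measure: "measure lborel (D k) = card (E k)" for k
    using measure_vec_floor_scaled[OF finE, of k 1] by (simp add: D_def E_def)
  have D_cone: "(x, real k + \<mu>) \<in> C" if "x \<in> D k" for x k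
  proof -
    have "dist (vec_floor x, real k) (x, real k + \<mu>) \<le> dist (vec_floor x) x + \<mu>"
      using sqrt_sum_squares_le_sum_abs[of "dist (vec_floor x) x" \<mu>] \<mu> by (simp add: dist_Pair_Pair dist_real_def)
    also have "\<dots> \<le> \<rho>"
      using dist_vec_floor[of x] \<rho>(2) by simp
    finally show ?thesis
      using that by (auto simp: D_def E_def)
  qed
  have D_gaps: "(x, real k + \<mu>) \<in> uncovered k \<longleftrightarrow> x \<in> gaps \<mu>" if x: "x \<in> D k" for x k
  proof
    assume "x \<in> gaps \<mu>"
    then have "(x, real k + \<mu>) - emb e \<notin> C" if "e \<in> generators_of_power k" for e
      using that by (auto simp: gaps_def generators_of_power_def emb_def)
    then show "(x, real k + \<mu>) \<in> uncovered k"
      using D_cone[OF x] by (auto simp: uncovered_def)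
  next
    assume unc: "(x, real k + \<mu>) \<in> uncovered k"
    show "x \<in> gaps \<mu>"
      unfolding gaps_def
    proof safe
      fix u assume u: "(x - rvec u, \<mu>) \<in> C"
      \<comment> \<open>A translate that reaches x has its apex close to the deep lattice point
        \<open>vec_floor x\<close>. Subtracting the conductor does not leave the cone there, so the
        apex belongs to \<open>S\<close>.\<close>
      have "norm (x - rvec u) \<le> B * \<mu>"
        using B(2)[OF u] norm_fst_le[of "x - rvec u" \<mu>] by simp
      have "dist (vec_floor x, real k) (emb ((u, int k) - c)) \<le> dist (vec_floor x) (rvec u) + norm (emb c)"
        using norm_triangle_ineq[of "(vec_floor x - rvec u, 0)" "emb c"]
        by (simp add: dist_norm emb_def algebra_simps norm_Pair)
      also have "dist (vec_floor x) (rvec u) \<le> dist (vec_floor x) x + norm (x - rvec u)"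
        using dist_triangle[of "vec_floor x" "rvec u" x] by (simp add: dist_norm)
      finally have "dist (vec_floor x, real k) (emb ((u, int k) - c)) \<le> \<rho>"
        using dist_vec_floor[of x] \<open>norm (x - rvec u) \<le> B * \<mu>\<close> \<rho>(3) by linarith
      then have "emb ((u, int k) - c) \<in> C"
        using x by (auto simp: D_def E_def simp del: emb_simps)
      then have "(u, int k) \<in> generators_of_power k"
        using c(2)[of "(u, int k) - c"] by (simp add: generators_of_power_def)
      then show False
        using unc u by (auto simp: uncovered_def emb_def)
    qed
  qed
  define T where "T k = {x. (x, real k + \<mu>) \<in> uncovered k}" for k
  have T_sets: "T k \<in> sets borel" for k
    unfolding T_def by (rule borel_slice[OF borel_uncovered])
  have T_bdd: "bounded (T k)" for k
    unfolding T_def by (rule bounded_slice[OF bounded_uncovered])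
  have TD: "measure lborel (T k \<inter> D k) = card (E k) * gap_density \<mu>" for k
  proof -
    have "T k \<inter> D k = (\<Union>z\<in>E k. {x. vec_floor x = z} \<inter> gaps \<mu>)"
      using D_gaps by (auto simp: T_def D_def)
    also have "measure lborel \<dots> = (\<Sum>z\<in>E k. measure lborel ({x. vec_floor x = z} \<inter> gaps \<mu>))"
    proof (rule measure_finite_Union[OF finE])
      show "(\<lambda>z. {x. vec_floor x = z} \<inter> gaps \<mu>) ` E k \<subseteq> sets lborel"
        by (auto intro: integer_cell_sets borel_gaps)
      show "disjoint_family_on (\<lambda>z. {x. vec_floor x = z} \<inter> gaps \<mu>) (E k)"
        by (auto simp: disjoint_family_on_def)
      fix z assume "z \<in> E k"
      then have "z \<in> integer_points" by (simp add: E_def)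
      then have "bounded ({x. vec_floor x = z} \<inter> gaps \<mu>)"
        using integer_cell_subset(2)[of z] by (intro bounded_subset[OF bounded_cbox[of z "z + One"]]) auto
      then show "emeasure lborel ({x. vec_floor x = z} \<inter> gaps \<mu>) \<noteq> \<infinity>"
        using emeasure_bounded_borel_finite by simp
    qed
    also have "\<dots> = (\<Sum>z\<in>E k. gap_density \<mu>)"
    proof (rule sum.cong)
      fix z assume "z \<in> E k"
      then have z: "z \<in> integer_points" by (simp add: E_def)
      then obtain w where "z = rvec w"
        by (rule integer_points_rvecE)
      then show "measure lborel ({x. vec_floor x = z} \<inter> gaps \<mu>) = gap_density \<mu>"
        using measure_Int_integer_cell[OF z borel_gaps] measure_cell_gaps[of w \<mu>] by simp
    qed simp
    finally show ?thesis by simp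
  qed
  have "T k - D k \<subseteq> {x. (x, real k + \<mu>) \<in> C} - D k" for k
    by (auto simp: T_def uncovered_def)
  then have T_minus_D: "measure lborel (T k - D k) \<le> (real k + \<mu>) ^ CARD('n) * vol_P - card (E k)" for k
  proof -
    assume sub: "\<And>k. T k - D k \<subseteq> {x. (x, real k + \<mu>) \<in> C} - D k"
    let ?Q = "{x. (x, real k + \<mu>) \<in> C}"
    have Q: "?Q \<in> fmeasurable lborel"
      using emeasure_bounded_borel_finite[OF bounded_cone_slice] borel_slice[OF borel_cone]
      by (intro fmeasurableI) (auto simp: less_top)
    have "measure lborel (T k - D k) \<le> measure lborel (?Q - D k)"
      using sub[of k] Q D_sets T_sets by (intro measure_mono_fmeasurable fmeasurable_Diff) auto
    also have "\<dots> = measure lborel ?Q - measure lborel (D k)"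
      using Q D_sets D_cone by (intro measure_Diff) (auto simp: fmeasurable_def less_top)
    finally show ?thesis
      using \<mu> by (simp add: measure_cone_slice D_measure)
  qed
  have split: "measure lborel (T k) = card (E k) * gap_density \<mu> + measure lborel (T k - D k)" for k
  proof -
    have "bounded (T k \<inter> D k)" "bounded (T k - D k)"
      by (rule bounded_subset[OF T_bdd[of k]]; blast)+
    then have "measure lborel ((T k \<inter> D k) \<union> (T k - D k)) = measure lborel (T k \<inter> D k) + measure lborel (T k - D k)"
      using T_sets D_sets by (intro measure_Union) (auto simp: emeasure_bounded_borel_finite)
    then show ?thesis
      by (simp add: TD Int_Diff_Un)
  qed
  have vol: "measure lborel {x. (x, 1) \<in> C} = vol_P"
    using measure_cone_slice[of 1] by simp
  have lim_E: "(\<lambda>k. card (E k) / real k ^ CARD('n)) \<longlonglongrightarrow> vol_P"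
    using card_lim by (simp add: vol)
  have "(\<lambda>k. 1 + \<mu> / real k) \<longlonglongrightarrow> 1 + 0"
    by (intro tendsto_add tendsto_const tendsto_divide_0[OF tendsto_const])
      (rule filterlim_at_top_imp_at_infinity[OF filterlim_real_sequentially])
  then have "(\<lambda>k. (1 + \<mu> / real k) ^ CARD('n) * vol_P) \<longlonglongrightarrow> (1 + 0) ^ CARD('n) * vol_P"
    by (intro tendsto_intros)
  moreover have "\<forall>\<^sub>F k in sequentially. (1 + \<mu> / real k) ^ CARD('n) * vol_P = (real k + \<mu>) ^ CARD('n) * vol_P / real k ^ CARD('n)"
    using eventually_gt_at_top[of 0]
  proof eventually_elim
    case (elim k)
    then have eq: "1 + \<mu> / real k = (real k + \<mu>) / real k"
      by (simp add: add_divide_distrib)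
    show ?case
      unfolding eq power_divide by simp
  qed
  ultimately have lim_Q: "(\<lambda>k. (real k + \<mu>) ^ CARD('n) * vol_P / real k ^ CARD('n)) \<longlonglongrightarrow> vol_P"
    by (simp add: tendsto_cong)
  have lower: "(\<lambda>k. card (E k) / real k ^ CARD('n) * gap_density \<mu>) \<longlonglongrightarrow> vol_P * gap_density \<mu>"
    by (intro tendsto_intros lim_E)
  \<comment> \<open>The bracket is the volume of the slice of \<open>C\<close> outside the deep
    cells, taken as wholly uncovered. Both of its terms tend to \<open>vol_P\<close>, so it
    disappears in the limit.\<close>
  have upper: "(\<lambda>k. card (E k) / real k ^ CARD('n) * gap_density \<mu>
      + ((real k + \<mu>) ^ CARD('n) * vol_P / real k ^ CARD('n) - card (E k) / real k ^ CARD('n)))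
    \<longlonglongrightarrow> vol_P * gap_density \<mu> + (vol_P - vol_P)"
    by (intro tendsto_add tendsto_diff lower lim_Q lim_E)
  have "(\<lambda>k. measure lborel (T k) / real k ^ CARD('n)) \<longlonglongrightarrow> vol_P * gap_density \<mu>"
  proof (rule tendsto_sandwich[OF _ _ lower])
    show "\<forall>\<^sub>F k in sequentially. card (E k) / real k ^ CARD('n) * gap_density \<mu> \<le> measure lborel (T k) / real k ^ CARD('n)"
      by (intro always_eventually allI) (simp add: split divide_right_mono add_divide_distrib)
    show "\<forall>\<^sub>F k in sequentially. measure lborel (T k) / real k ^ CARD('n) \<le> card (E k) / real k ^ CARD('n) * gap_density \<mu>
      + ((real k + \<mu>) ^ CARD('n) * vol_P / real k ^ CARD('n) - card (E k) / real k ^ CARD('n))"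
      using T_minus_D
      by (intro always_eventually allI) (simp add: split add_divide_distrib diff_divide_distrib[symmetric] divide_right_mono)
  qed (use upper in simp)
  then show ?thesis
    by (simp add: T_def)
qed

end

section \<open>The limit formula\<close>

context lattice_polytope
begin

lemma integrable_gap_density: "set_integrable lborel {0..} gap_density"
  unfolding set_integrable_def
proof (rule Bochner_Integration.integrable_bound)
  show "integrable lborel (indicator {0..real (card L)} :: real \<Rightarrow> real)"
    by (intro integrable_real_indicator) auto
  show "(\<lambda>\<mu>. indicator {0..} \<mu> *\<^sub>R gap_density \<mu>) \<in> borel_measurable lborel"
    using borel_measurable_continuous_on_indicator[OF _ gap_density_continuous] by simp
  show "AE \<mu> in lborel. norm (indicator {0..} \<mu> *\<^sub>R gap_density \<mu>) \<le> norm (indicator {0..real (card L)} \<mu> :: real)"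
    using gap_density_nonneg gap_density_le_1 gap_density_eq_0
    by (intro AE_I2) (auto simp: indicator_def not_le)
qed

text \<open>Translates with apex at height \<open>k\<close> cover nothing below that height, so the
  subtracted volume is exactly the lower part of \<open>uncovered k\<close>; the rest is integrated
  by slices.\<close>

lemma measure_uncovered_diff:
  "has_bochner_integral lborel
     (\<lambda>\<mu>. indicator {0..} \<mu> * measure lborel {x. (x, real k + \<mu>) \<in> uncovered k})
     (measure lborel (uncovered k) - measure lborel {x \<in> C. snd x < real k})"
proof -
  define X where "X = uncovered k \<inter> {x. real k \<le> snd x}"
  have low_sets: "{x \<in> C. snd x < real k} \<in> sets borel"
  proof -
    have "{x \<in> C. snd x < real k} = C \<inter> {x. snd x < real k}"
      by auto
    moreover have "open {x :: (real ^ 'n) \<times> real. snd x < real k}"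
      by (intro open_Collect_less continuous_intros)
    ultimately show ?thesis
      by (simp add: borel_open borel_cone)
  qed
  have low: "{x \<in> C. snd x < real k} \<subseteq> uncovered k"
  proof -
    have "x - emb e \<notin> C" if "snd x < real k" "e \<in> generators_of_power k" for x e
      using cone_height_nonneg[of "x - emb e"] that by (auto simp: generators_of_power_def)
    then show ?thesis
      unfolding uncovered_def by blast
  qed
  have X_eq: "X = uncovered k - {x \<in> C. snd x < real k}"
    unfolding X_def uncovered_def by (auto simp: not_less)
  have X_sets: "X \<in> sets borel"
    unfolding X_eq using borel_uncovered low_sets by auto
  have X_bdd: "bounded X"
    unfolding X_def using bounded_uncovered by (rule bounded_subset) auto
  have "measure lborel X = measure lborel (uncovered k) - measure lborel {x \<in> C. snd x < real k}"
    unfolding X_eq using low low_sets borel_uncovered[of k] emeasure_bounded_borel_finite[OF bounded_uncovered]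
    by (intro measure_Diff) simp_all
  \<comment> \<open>The factor 1 puts the shift by \<open>k\<close> into the shape of the affine
    substitution rule.\<close>
  moreover have "has_bochner_integral lborel (\<lambda>\<mu>. measure lborel {x. (x, real k + 1 * \<mu>) \<in> X}) (measure lborel X /\<^sub>R \<bar>1\<bar>)"
    using measure_eq_integral_slices[OF X_sets X_bdd]
    by (subst lborel_has_bochner_integral_real_affine_iff[symmetric]) auto
  moreover have "measure lborel {x. (x, real k + 1 * \<mu>) \<in> X}
      = indicator {0..} \<mu> * measure lborel {x. (x, real k + \<mu>) \<in> uncovered k}" for \<mu>
    by (auto simp: X_def indicator_def)
  ultimately show ?thesis
    by simp
qed

text \<open>The volume of a pyramid of height 1. It turns \<open>vol_P\<close> into the multiplicity
  of the maximal ideal divided by (d-1)!.\<close>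

lemma vol_cone_below_one: "real (CARD('n) + 1) * measure lborel {x \<in> C. snd x < 1} = vol_P"
proof -
  let ?X = "{x \<in> C. snd x \<le> 1}"
  have bdd: "bounded ?X"
    by (rule bounded_cone_below)
  have "?X = C \<inter> {x. snd x \<le> 1}"
    by auto
  moreover have "closed {x :: (real ^ 'n) \<times> real. snd x \<le> 1}"
    by (intro closed_Collect_le continuous_intros)
  ultimately have sets: "?X \<in> sets borel"
    by (simp add: borel_closed borel_cone)
  have "measure lborel ?X = (\<integral>z. measure lborel {x. (x, z) \<in> ?X} \<partial>lborel)"
    using measure_eq_integral_slices[OF sets bdd] by (simp add: has_bochner_integral_iff)
  also have "\<dots> = (\<integral>z. vol_P * (z ^ CARD('n) * indicator {0..1} z) \<partial>lborel)"
  proof (rule Bochner_Integration.integral_cong)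
    fix z :: real
    have "{x. (x, z) \<in> ?X} = (if z \<in> {0..1} then {x. (x, z) \<in> C} else {})"
      by (auto simp: mem_cone_iff)
    then show "measure lborel {x. (x, z) \<in> ?X} = vol_P * (z ^ CARD('n) * indicator {0..1} z)"
      by (simp add: measure_cone_slice)
  qed simp
  also have "\<dots> = vol_P / real (CARD('n) + 1)"
    using integral_power[of 0 1 "CARD('n)"] by simp
  finally have closed: "measure lborel ?X = vol_P / real (CARD('n) + 1)" .
  have "measure lborel {x \<in> C. snd x < 1} = measure lborel ?X"
  proof (rule measure_eq_AE)
    have "{x :: (real ^ 'n) \<times> real. (0, 1) \<bullet> x = 1} = {x. snd x = 1}"
      by (simp add: inner_prod_def)
    moreover have "negligible {x :: (real ^ 'n) \<times> real. (0, 1) \<bullet> x = 1}"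
      by (rule negligible_hyperplane) (simp add: prod_eq_iff)
    moreover have "closed {x :: (real ^ 'n) \<times> real. (0, 1) \<bullet> x = 1}"
      by (rule closed_hyperplane)
    ultimately have "AE x in lborel. x \<notin> {x :: (real ^ 'n) \<times> real. snd x = 1}"
      by (intro AE_not_in_negligible borel_closed) auto
    then show "AE x in lborel. x \<in> {x \<in> C. snd x < 1} \<longleftrightarrow> x \<in> ?X"
      by eventually_elim auto
    have "{x \<in> C. snd x < 1} = C \<inter> {x. snd x < 1}"
      by auto
    moreover have "open {x :: (real ^ 'n) \<times> real. snd x < 1}"
      by (intro open_Collect_less continuous_intros)
    ultimately show "{x \<in> C. snd x < 1} \<in> sets lborel"
      by (simp add: borel_open borel_cone)
  qed (use sets in simp)
  then show ?thesis
    by (simp add: closed)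
qed

lemma uncovered_volume_tendsto:
  "(\<lambda>k. (measure lborel (uncovered k) - measure lborel {x \<in> C. snd x < real k}) / real k ^ CARD('n))
     \<longlonglongrightarrow> vol_P * integral {0..} gap_density"
\<comment> \<open>Starting at \<open>k = 1\<close> avoids division by zero and gives a majorant that
  is uniform in the index.\<close>
proof (rule LIMSEQ_offset[of _ 1])
  define g where "g k \<mu> = indicator {0..} \<mu> * measure lborel {x. (x, real k + \<mu>) \<in> uncovered k}" for k :: nat and \<mu> :: real
  let ?r = "real (card L)"
  have lim: "(\<lambda>k. \<integral>\<mu>. g (k + 1) \<mu> / real (k + 1) ^ CARD('n) \<partial>lborel)
      \<longlonglongrightarrow> (\<integral>\<mu>. vol_P * (indicator {0..} \<mu> *\<^sub>R gap_density \<mu>) \<partial>lborel)"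
  \<comment> \<open>For k at least 1 and \<mu> below \<open>?r\<close>, the ratio (k + \<mu>) / k is
    at most \<open>1 + ?r\<close>; from \<open>?r\<close> on the slices are empty.\<close>
  proof (rule integral_dominated_convergence[where w = "\<lambda>\<mu>. indicator {0..?r} \<mu> *\<^sub>R ((1 + ?r) ^ CARD('n) * vol_P)"])
    show "(\<lambda>\<mu>. vol_P * (indicator {0..} \<mu> *\<^sub>R gap_density \<mu>)) \<in> borel_measurable lborel"
      using borel_measurable_continuous_on_indicator[OF _ gap_density_continuous] by simp
    show "(\<lambda>\<mu>. g (k + 1) \<mu> / real (k + 1) ^ CARD('n)) \<in> borel_measurable lborel" for k
      using measure_uncovered_diff[of "k + 1"] unfolding g_def has_bochner_integral_iff
      by (intro borel_measurable_divide borel_measurable_const) (auto dest: borel_measurable_integrable)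
    show "integrable lborel (\<lambda>\<mu>. indicator {0..?r} \<mu> *\<^sub>R ((1 + ?r) ^ CARD('n) * vol_P))"
      by (intro integrable_scaleR_left integrable_real_indicator) auto
    have "(\<lambda>k. g (k + 1) \<mu> / real (k + 1) ^ CARD('n)) \<longlonglongrightarrow> vol_P * (indicator {0..} \<mu> *\<^sub>R gap_density \<mu>)" for \<mu>
      using LIMSEQ_ignore_initial_segment[OF measure_uncovered_slice_tendsto[of \<mu>], of 1]
      by (cases "0 \<le> \<mu>") (simp_all add: g_def)
    then show "AE \<mu> in lborel. (\<lambda>k. g (k + 1) \<mu> / real (k + 1) ^ CARD('n)) \<longlonglongrightarrow> vol_P * (indicator {0..} \<mu> *\<^sub>R gap_density \<mu>)"
      by (intro AE_I2)
    have "norm (g (k + 1) \<mu> / real (k + 1) ^ CARD('n)) \<le> indicator {0..?r} \<mu> *\<^sub>R ((1 + ?r) ^ CARD('n) * vol_P)" for k \<mu>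
    proof (cases "0 \<le> \<mu> \<and> \<mu> < ?r")
      case False
      have "{x. (x, real (k + 1) + \<mu>) \<in> uncovered (k + 1)} = {}" if "?r \<le> \<mu>"
        using uncovered_height_less[of _ "k + 1" \<mu>] that by force
      then have "g (k + 1) \<mu> = 0"
        using False by (auto simp: g_def indicator_def not_less)
      then show ?thesis by simp
    next
      case True
      have "measure lborel {x. (x, real (k + 1) + \<mu>) \<in> uncovered (k + 1)} \<le> (real (k + 1) + \<mu>) ^ CARD('n) * vol_P"
        using True by (intro measure_uncovered_slice_le) simp
      also have "\<dots> \<le> (real (k + 1) * (1 + ?r)) ^ CARD('n) * vol_P"
      proof (intro mult_right_mono power_mono)
        have "\<mu> \<le> real (k + 1) * ?r"
        proof -
          have "1 * ?r \<le> real (k + 1) * ?r"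
            by (intro mult_right_mono) auto
          then show ?thesis using True by linarith
        qed
        then show "real (k + 1) + \<mu> \<le> real (k + 1) * (1 + ?r)"
          by (simp add: distrib_left)
      qed (use True in auto)
      finally have "measure lborel {x. (x, real (k + 1) + \<mu>) \<in> uncovered (k + 1)} / real (k + 1) ^ CARD('n)
          \<le> (1 + ?r) ^ CARD('n) * vol_P"
        by (subst divide_le_eq) (simp_all add: power_mult_distrib mult_ac del: of_nat_add of_nat_Suc)
      then show ?thesis
        using True by (simp add: g_def del: of_nat_add of_nat_Suc)
    qed
    then show "AE \<mu> in lborel. norm (g (k + 1) \<mu> / real (k + 1) ^ CARD('n)) \<le> indicator {0..?r} \<mu> *\<^sub>R ((1 + ?r) ^ CARD('n) * vol_P)" for k
      by (intro AE_I2)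
  qed
  have slices: "(\<integral>\<mu>. g (k + 1) \<mu> / real (k + 1) ^ CARD('n) \<partial>lborel)
      = (measure lborel (uncovered (k + 1)) - measure lborel {x \<in> C. snd x < real (k + 1)}) / real (k + 1) ^ CARD('n)" for k
    using measure_uncovered_diff[of "k + 1"] unfolding g_def has_bochner_integral_iff by (subst integral_divide_zero) simp
  have density: "(\<integral>\<mu>. vol_P * (indicator {0..} \<mu> *\<^sub>R gap_density \<mu>) \<partial>lborel) = vol_P * integral {0..} gap_density"
    using set_borel_integral_eq_integral(2)[OF integrable_gap_density]
    unfolding set_lebesgue_integral_def by (subst integral_mult_right_zero) simp
  show "(\<lambda>k. (measure lborel (uncovered (k + 1)) - measure lborel {x \<in> C. snd x < real (k + 1)}) / real (k + 1) ^ CARD('n))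
     \<longlonglongrightarrow> vol_P * integral {0..} gap_density"
    using lim unfolding slices density .
qed

lemma multiplicity_limit:
  assumes "prime CHAR('k::field)"
  defines "A \<equiv> coord_ring P :: ((int ^ 'n) \<times> int \<Rightarrow>\<^sub>0 'k) ring"
    and "\<mm> \<equiv> graded_max_ideal P"
    and "d \<equiv> CARD('n) + 1"
  shows "(\<lambda>k. (hilbert_kunz_mult CHAR('k) d A (ideal_power A \<mm> k)
          - hilbert_samuel_mult d A (ideal_power A \<mm> k) / fact d) / real k ^ (d - 1))
      \<longlonglongrightarrow> hilbert_samuel_mult d A \<mm> / fact (d - 1) * integral {0..} gap_density"
proof -
  have "ideal_power A \<mm> 1 = \<mm>"
    using ideal_power_graded_max_ideal[of 1, where ?'k = 'k]
    unfolding A_def \<mm>_def coord_ring_eq graded_max_ideal_eq by simp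
  then have "hilbert_samuel_mult d A \<mm> = fact d * measure lborel {x \<in> C. snd x < 1}"
    using hilbert_samuel_mult_eq[of 1, where ?'k = 'k] by (simp add: A_def \<mm>_def d_def)
  also have "\<dots> / fact (d - 1) = vol_P"
    using vol_cone_below_one by (simp add: d_def)
  finally have "hilbert_samuel_mult d A \<mm> / fact (d - 1) = vol_P" .
  moreover have "hilbert_samuel_mult d A (ideal_power A \<mm> k) / fact d = measure lborel {x \<in> C. snd x < real k}" for k
    unfolding A_def \<mm>_def d_def hilbert_samuel_mult_eq by simp
  moreover have "hilbert_kunz_mult CHAR('k) d A (ideal_power A \<mm> k) = measure lborel (uncovered k)" for k
    unfolding A_def \<mm>_def d_def by (rule hilbert_kunz_mult_eq[OF assms(1)])
  ultimately show ?thesis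
    using uncovered_volume_tendsto by (simp add: d_def)
qed

end

theorem theorem1p3:
  fixes \<Delta> :: "(real ^ 'n) set set"
    and a :: "int ^ 'n \<Rightarrow> int"
    and d p :: nat
    and P :: "(real ^ 'n) set"
    and R :: "(((int ^ 'n) \<times> int) \<Rightarrow>\<^sub>0 'k::alg_closed_field) ring"
    and \<mm> :: "(((int ^ 'n) \<times> int) \<Rightarrow>\<^sub>0 'k) set"
    and v :: "int ^ 'n"
  assumes dim: "d = CARD('n) + 1"
    and char: "CHAR('k) = p" "p > 0"
    and complete: "complete_fan \<Delta>"
    and cartier: "T_Cartier \<Delta> a"
    and ample: "very_ample TYPE('k) \<Delta> a"
    and P: "P = div_polytope \<Delta> a"
    and R: "R = coord_ring P"
    and m: "\<mm> = graded_max_ideal P"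
  shows "(\<forall>w. \<forall>\<mu>\<ge>0. phi P w \<mu> = phi P v \<mu>) \<and>
    phi P v \<in> {0..} \<rightarrow> {0..} \<and>
    continuous_on {0..} (phi P v) \<and>
    compact (closure {\<mu>. 0 \<le> \<mu> \<and> phi P v \<mu> \<noteq> 0}) \<and>
    (\<lambda>k. (hilbert_kunz_mult p d R (ideal_power R \<mm> k)
          - hilbert_samuel_mult d R (ideal_power R \<mm> k) / fact d) / real k ^ (d - 1))
      \<longlonglongrightarrow> hilbert_samuel_mult d R \<mm> / fact (d - 1) * integral {0..} (phi P v)"
proof -
  have base: "section_map \<Delta> a \<in> (toric_variety \<Delta> :: ((real ^ 'n) set \<times> (int ^ 'n \<Rightarrow> 'k)) set set)
      \<rightarrow> proj_space (lattice_points (div_polytope \<Delta> a))"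
    and surj: "surjective_on_stalks TYPE('k) \<Delta> a"
    using ample unfolding very_ample_def Let_def by auto
  have "fan \<Delta>"
    using complete by (simp add: complete_fan_def)
  interpret lattice_polytope P
    using div_polytope_eq_hull[OF complete cartier base] lattice_generated[OF \<open>fan \<Delta>\<close> surj]
    by unfold_locales (simp_all add: P)
  have phi: "phi P w = gap_density" for w
    using phi_eq by blast
  have prime: "prime CHAR('k)"
    using char by (intro prime_CHAR_semidom) simp
  have "{\<mu>. 0 \<le> \<mu> \<and> gap_density \<mu> \<noteq> 0} \<subseteq> {0..real (card L)}"
  proof
    fix \<mu> assume "\<mu> \<in> {\<mu>. 0 \<le> \<mu> \<and> gap_density \<mu> \<noteq> 0}"
    then show "\<mu> \<in> {0..real (card L)}"
      using gap_density_eq_0[of \<mu>] by (cases "real (card L) \<le> \<mu>") auto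
  qed
  then have "compact (closure {\<mu>. 0 \<le> \<mu> \<and> gap_density \<mu> \<noteq> 0})"
    by (simp add: bounded_subset[OF bounded_closed_interval])
  then show ?thesis
    using gap_density_nonneg gap_density_continuous multiplicity_limit[OF prime]
    unfolding phi dim R m char(1)[symmetric] by auto
qed

end
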